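(* Let $k\ge2$ be a fixed integer. The generalized sieved ultraspherical polynomials of the second kind $B_n^{(\alpha,\gamma)}(x,k)$, orthogonal with respect to the measure $d\eta_{\alpha,\gamma}(x)=w_2(x,\alpha,\gamma)\,dx$ with $$w_2(x,\alpha,\gamma)=(1-x^2)^{\alpha+1/2}|U_{k-1}(x)|^{2\alpha}|T_k(x)|^{\gamma},\qquad x\in[-1,1],$$ can be characterized as the unique sieved random walk polynomials of the second kind whose corresponding probability measure $\mu$ satisfies, for all $m\in\mathbb{N}_0$: - the reversed measure $\mu^R_{k(2m+2)-2}$ has equal masses at the zeros of $T_k$; - $\mu^R_{k(2m+2)-2}$ has equal masses at the zeros of $U_{k-1}$; - $\mu^R_{k(2m+2)-2}$ has equal masses at the remaining $2mk$ support points. Moreover, for all $m\in\mathbb{N}$ the masses of $\eta^R_{\alpha,\gamma,k(2m+2)-2}$ at the zeros of $U_{k-1}$ and of $T_k$ are, respectively, $2\alpha+1$ times and $\gamma+1$ times the (equal) masses of $\eta^R_{\alpha,\gamma,k(2m+2)-2}$ at the remaining $2mk$ support points.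
   Context: $T_k$ and $U_{k-1}$ are the Chebyshev polynomials of the first and second kind; $\mathbb{N}=\{1,2,\dots\}$, $\mathbb{N}_0=\{0,1,2,\dots\}$; $\alpha>-1/2$, $\gamma>-1$. Sieved random walk polynomials of the second kind: given $A_n,B_n>0$ with $A_n+B_n=1$ ($n\ge0$), put $a_n=b_n=\tfrac12$ if $k\nmid n+1$, and $a_{nk-1}=A_{n-1}$, $b_{nk-1}=B_{n-1}$ ($n\ge1$). The polynomials are $s_0(x)=1$, $s_1(x)=2x$, $x\,s_n(x)=a_ns_{n+1}(x)+b_ns_{n-1}(x)$ for $n\ge1$. The corresponding probability measure is their orthogonality measure, a symmetric probability measure on $[-1,1]$. The polynomials $B_n^{(\alpha,\gamma)}(x,k)$ are those obtained from $A_{2m}=1-B_{2m}=\frac{2m+1+\gamma}{4m+2\alpha+\gamma+2}$ ($m\ge0$) and $A_{2m-1}=1-B_{2m-1}=\frac{2m}{4m+2\alpha+\gamma}$ ($m\ge1$). Here $\eta_{\alpha,\gamma}$ is also used for the probability measure with density proportional to $w_2(x,\alpha,\gamma)$. Reversed measures: the Stieltjes transform of a symmetric probability measure $\mu$ on $[-1,1]$ has the expansion $$\int_{-1}^{1}\frac{d\mu(x)}{z-x}=\cfrac{1}{z-\cfrac{p_2}{z-\cfrac{q_2p_4}{z-\cfrac{q_4p_6}{z-\cdots}}}},$$ with $p_{2i}\in[0,1]$, $q_{2i}=1-p_{2i}$, $q_0=1$. The $n$-th reversed measure $\mu_n^R$ is the symmetric probability measure with finite support determined by $$\int_{-1}^{1}\frac{d\mu_n^R(x)}{z-x}=\cfrac{1}{z-\cfrac{p_{2n}}{z-\cfrac{q_{2n}p_{2n-2}}{z-\cdots-\cfrac{q_4p_2}{z}}}}.$$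 For sieved random walk polynomials of the second kind, $\mu^R_{k(2m+2)-2}$ has $k(2m+2)-1$ support points, among them the $k$ zeros of $T_k$ and the $k-1$ zeros of $U_{k-1}$. $\eta^R_{\alpha,\gamma,n}$ denotes the $n$-th reversed measure of $\eta_{\alpha,\gamma}$.
   Formalization: The three equal-mass conditions alone do not characterize the polynomials (A_n=(n+3)/(2(n+2)) also satisfies them), so uniqueness is stated for given α, γ with the mass ratios 2α+1 and γ+1 of the "Moreover" sentence, for all m≥1, added to the characterizing conditions. *)

theory Defs
  imports "HOL-Probability.Probability" "HOL-Computational_Algebra.Polynomial"
begin

fun cheb_T :: "nat \<Rightarrow> real poly" where
  "cheb_T 0 = 1"
| "cheb_T (Suc 0) = [:0, 1:]"
| "cheb_T (Suc (Suc n)) = [:0, 2:] * cheb_T (Suc n) - cheb_T n"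

fun cheb_U :: "nat \<Rightarrow> real poly" where
  "cheb_U 0 = 1"
| "cheb_U (Suc 0) = [:0, 2:]"
| "cheb_U (Suc (Suc n)) = [:0, 2:] * cheb_U (Suc n) - cheb_U n"

definition zeros_T :: "nat \<Rightarrow> real set" where
  "zeros_T k = {x. poly (cheb_T k) x = 0}"

text \<open>The zeros of \<open>U\<^sub>k\<^sub>-\<^sub>1\<close>; note the shift of the index.\<close>

definition zeros_U :: "nat \<Rightarrow> real set" where
  "zeros_U k = {x. poly (cheb_U (k - 1)) x = 0}"

text \<open>\<open>sieve k A\<close> has value \<open>A (n - 1)\<close> at index \<open>n * k - 1\<close> (for \<open>n \<ge> 1\<close>) and \<open>1/2\<close> elsewhere.\<close>

definition sieve :: "nat \<Rightarrow> (nat \<Rightarrow> real) \<Rightarrow> nat \<Rightarrow> real" where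
  "sieve k A n = (if k dvd n + 1 then A ((n + 1) div k - 1) else 1 / 2)"

definition rw_coeffs :: "(nat \<Rightarrow> real) \<Rightarrow> (nat \<Rightarrow> real) \<Rightarrow> bool" where
  "rw_coeffs A B \<longleftrightarrow> (\<forall>n. A n > 0 \<and> B n > 0 \<and> A n + B n = 1)"

text \<open>The last equation is \<open>x s\<^sub>n = a\<^sub>n s\<^sub>n\<^sub>+\<^sub>1 + b\<^sub>n s\<^sub>n\<^sub>-\<^sub>1\<close> (\<open>n \<ge> 1\<close>), solved for \<open>s\<^sub>n\<^sub>+\<^sub>1\<close>.\<close>

fun sieved_rw_poly :: "nat \<Rightarrow> (nat \<Rightarrow> real) \<Rightarrow> (nat \<Rightarrow> real) \<Rightarrow> nat \<Rightarrow> real poly" where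
  "sieved_rw_poly k A B 0 = 1"
| "sieved_rw_poly k A B (Suc 0) = [:0, 2:]"
| "sieved_rw_poly k A B (Suc (Suc n)) =
     smult (1 / sieve k A (Suc n))
       ([:0, 1:] * sieved_rw_poly k A B (Suc n)
         - smult (sieve k B (Suc n)) (sieved_rw_poly k A B n))"

text \<open>In terms of \<open>m\<close>, the value at \<open>n = 2 m\<close> is \<open>(2 m + 1 + \<gamma>) / (4 m + 2 \<alpha> + \<gamma> + 2)\<close> and the value
  at \<open>n = 2 m - 1\<close> is \<open>2 m / (4 m + 2 \<alpha> + \<gamma>)\<close>.\<close>

definition ultra_A :: "real \<Rightarrow> real \<Rightarrow> nat \<Rightarrow> real" where
  "ultra_A \<alpha> \<gamma> n =
     (if even n then (real n + 1 + \<gamma>) / (2 * real n + 2 * \<alpha> + \<gamma> + 2)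
      else (real n + 1) / (2 * (real n + 1) + 2 * \<alpha> + \<gamma>))"

definition sieved_ultra_poly :: "nat \<Rightarrow> real \<Rightarrow> real \<Rightarrow> nat \<Rightarrow> real poly" where
  "sieved_ultra_poly k \<alpha> \<gamma> =
     sieved_rw_poly k (ultra_A \<alpha> \<gamma>) (\<lambda>n. 1 - ultra_A \<alpha> \<gamma> n)"

definition sym_prob_measure :: "real measure \<Rightarrow> bool" where
  "sym_prob_measure \<mu> \<longleftrightarrow>
     prob_space \<mu> \<and> sets \<mu> = sets borel \<and> (AE x in \<mu>. x \<in> {-1..1}) \<and> distr \<mu> borel uminus = \<mu>"

definition orthogonality_measure :: "(nat \<Rightarrow> real poly) \<Rightarrow> real measure \<Rightarrow> bool" where
  "orthogonality_measure s \<mu> \<longleftrightarrow>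
     sym_prob_measure \<mu> \<and>
     (\<forall>m n. (\<integral>x. poly (s m) x * poly (s n) x \<partial>\<mu>) = 0 \<longleftrightarrow> m \<noteq> n)"

text \<open>Since \<open>0 powr a = 0\<close> also for \<open>a = 0\<close>, this may differ from the usual weight at the finitely
  many zeros of its factors; the measure below is not affected.\<close>

definition w2 :: "nat \<Rightarrow> real \<Rightarrow> real \<Rightarrow> real \<Rightarrow> real" where
  "w2 k \<alpha> \<gamma> x =
     (1 - x\<^sup>2) powr (\<alpha> + 1 / 2) * \<bar>poly (cheb_U (k - 1)) x\<bar> powr (2 * \<alpha>)
       * \<bar>poly (cheb_T k) x\<bar> powr \<gamma>"

definition eta :: "nat \<Rightarrow> real \<Rightarrow> real \<Rightarrow> real measure" where
  "eta k \<alpha> \<gamma> =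
     density lborel
       (\<lambda>x. ennreal (indicator {-1..1} x * w2 k \<alpha> \<gamma> x / (LINT y:{-1..1}|lborel. w2 k \<alpha> \<gamma> y)))"

definition stieltjes :: "real measure \<Rightarrow> complex \<Rightarrow> complex" where
  "stieltjes \<mu> z = (\<integral>x. 1 / (z - complex_of_real x) \<partial>\<mu>)"

text \<open>\<open>cfrac c n z = 1 / (z - c 0 / (z - c 1 / (z - \<dots> - c (n - 1) / z)))\<close>, with \<open>n\<close> coefficients.\<close>

fun cfrac :: "(nat \<Rightarrow> real) \<Rightarrow> nat \<Rightarrow> complex \<Rightarrow> complex" where
  "cfrac c 0 z = 1 / z"
| "cfrac c (Suc n) z = 1 / (z - complex_of_real (c 0) * cfrac (\<lambda>i. c (Suc i)) n z)"

text \<open>The number \<open>p i\<close> stands for \<open>p\<^sub>2\<^sub>i\<close>, and \<open>p 0 = 0\<close> encodes \<open>q\<^sub>0 = 1\<close>: the coefficients of the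
  continued fraction are \<open>p\<^sub>2, q\<^sub>2 p\<^sub>4, q\<^sub>4 p\<^sub>6, \<dots>\<close>\<close>

definition stieltjes_params :: "real measure \<Rightarrow> (nat \<Rightarrow> real) \<Rightarrow> bool" where
  "stieltjes_params \<mu> p \<longleftrightarrow>
     p 0 = 0 \<and> (\<forall>i. 0 \<le> p i \<and> p i \<le> 1) \<and>
     (\<forall>z. z \<notin> complex_of_real ` {-1..1} \<longrightarrow>
        (\<lambda>n. cfrac (\<lambda>i. (1 - p i) * p (Suc i)) n z) \<longlonglongrightarrow> stieltjes \<mu> z)"

text \<open>The coefficients \<open>p\<^sub>2\<^sub>n, q\<^sub>2\<^sub>n p\<^sub>2\<^sub>n\<^sub>-\<^sub>2, \<dots>, q\<^sub>4 p\<^sub>2\<close>, at the indices \<open>0, \<dots>, n - 1\<close>.\<close>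

definition reversed_coeff :: "(nat \<Rightarrow> real) \<Rightarrow> nat \<Rightarrow> nat \<Rightarrow> real" where
  "reversed_coeff p n j = (if j = 0 then p n else (1 - p (n - j + 1)) * p (n - j))"

definition reversed_measure :: "real measure \<Rightarrow> nat \<Rightarrow> real measure" where
  "reversed_measure \<mu> n =
     (THE \<nu>. sym_prob_measure \<nu> \<and> (\<exists>S. finite S \<and> (AE x in \<nu>. x \<in> S)) \<and>
        (\<exists>p. stieltjes_params \<mu> p \<and>
           (\<forall>z. z \<notin> complex_of_real ` {-1..1} \<longrightarrow>
              stieltjes \<nu> z = cfrac (reversed_coeff p n) n z)))"

text \<open>Only meant for finitely supported measures.\<close>

definition support_points :: "real measure \<Rightarrow> real set" where
  "support_points \<nu> = {x. measure \<nu> {x} > 0}"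

definition remaining_points :: "nat \<Rightarrow> real measure \<Rightarrow> real set" where
  "remaining_points k \<nu> = support_points \<nu> - zeros_T k - zeros_U k"

definition equal_masses :: "real measure \<Rightarrow> real set \<Rightarrow> bool" where
  "equal_masses \<nu> S \<longleftrightarrow> (\<forall>x\<in>S. \<forall>y\<in>S. measure \<nu> {x} = measure \<nu> {y})"

definition equal_mass_property :: "nat \<Rightarrow> real measure \<Rightarrow> bool" where
  "equal_mass_property k \<nu> \<longleftrightarrow>
     equal_masses \<nu> (zeros_T k) \<and> equal_masses \<nu> (zeros_U k) \<and>
     equal_masses \<nu> (remaining_points k \<nu>)"

definition mass_ratios :: "nat \<Rightarrow> real \<Rightarrow> real \<Rightarrow> real measure \<Rightarrow> bool" where
  "mass_ratios k \<alpha> \<gamma> \<nu> \<longleftrightarrow>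
     (\<forall>y\<in>remaining_points k \<nu>.
        (\<forall>x\<in>zeros_U k. measure \<nu> {x} = (2 * \<alpha> + 1) * measure \<nu> {y}) \<and>
        (\<forall>x\<in>zeros_T k. measure \<nu> {x} = (\<gamma> + 1) * measure \<nu> {y}))"

end

theory Submission
  imports Defs "HOL-Computational_Algebra.Fundamental_Theorem_Algebra"
begin

text \<open>
  Let \<open>g\<^sub>n\<close> be the orthogonal polynomials of \<open>\<mu>\<close> normalized by \<open>g\<^sub>n(1) = 1\<close>. The reversed continued
  fraction telescopes to \<open>(g\<^sub>n - z g\<^sub>n\<^sub>+\<^sub>1) / ((1 - z\<^sup>2) g\<^sub>n\<^sub>+\<^sub>1)\<close>, so \<open>\<mu>\<^sub>n\<^sup>R\<close> lives on the zeros of \<open>g\<^sub>n\<^sub>+\<^sub>1\<close> with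
  masses \<open>g\<^sub>n / ((1 - x\<^sup>2) g'\<^sub>n\<^sub>+\<^sub>1)\<close>. Sieved polynomials factor at the block ends as
  \<open>U\<^sub>k\<^sub>-\<^sub>1 r\<^sub>n(T\<^sub>k)\<close>, where \<open>r\<^sub>n\<close> has the coefficients \<open>A\<close>, \<open>B\<close>; hence the mass at \<open>x\<close> depends only on
  \<open>t = T\<^sub>k(x)\<close> and is proportional to \<open>r\<^sub>2\<^sub>m(t) / ((1 - t\<^sup>2) r'\<^sub>2\<^sub>m\<^sub>+\<^sub>1(t))\<close>. Equal masses with the given ratios
  amount to a first-order differential relation between \<open>r\<^sub>2\<^sub>m\<close> and \<open>r\<^sub>2\<^sub>m\<^sub>+\<^sub>1\<close>, which holds for the generalized
  Gegenbauer polynomials and, read off at \<open>0\<close>, \<open>1\<close> and \<open>\<infinity>\<close>, determines the coefficients. For the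
  weight \<open>w\<^sub>2\<close>, the substitution \<open>x = cos \<theta>\<close> and the invariance under \<open>\<theta> \<mapsto> \<theta> + 2 \<pi> / k\<close> reduce
  orthogonality to the Pearson equation of \<open>(1 - y\<^sup>2)\<^sup>\<alpha>\<^sup>-\<^sup>1\<^sup>/\<^sup>2 \<bar>y\<bar>\<^sup>\<gamma>\<close>.
\<close>

section \<open>Random walk polynomials and their zeros\<close>

text \<open>\<open>reversed_measure\<close> is a definite description over all measures and all
  parameter sequences, so no mass can be computed before both are known to be unique. Parameters are
  recovered one at a time from the Stieltjes transform at large real arguments, masses from its
  behaviour near the real axis. That the given \<mu> has parameters at all is Markov's theorem,
  obtained through Gauss quadrature. Equality of masses within the zeros of \<open>T_k\<close> and
  within those of \<open>U_(k-1)\<close> holds for all sieved random walk polynomials, so the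
  information sits in the remaining points and the ratios. At \<open>m = 0\<close> there are no
  remaining points and the ratios say nothing. Two consecutive levels \<open>m \<ge> 1\<close>
  therefore determine only the coefficients from index 3 on; the first three need the comparison at
  infinity, which involves all earlier coefficients. For the weight, orthogonality is reduced to the
  vanishing of means, and on the circle each mean is a combination of four Fourier modes.\<close>

fun rwp :: "(nat \<Rightarrow> real) \<Rightarrow> (nat \<Rightarrow> real) \<Rightarrow> nat \<Rightarrow> 'a::real_field poly" where
  "rwp a b 0 = 1"
| "rwp a b (Suc 0) = [:0, of_real (1 / a 0):]"
| "rwp a b (Suc (Suc n)) =
     smult (of_real (1 / a (Suc n)))
       ([:0, 1:] * rwp a b (Suc n) - smult (of_real (b (Suc n))) (rwp a b n))"

definition rwc :: "(nat \<Rightarrow> real) \<Rightarrow> (nat \<Rightarrow> real) \<Rightarrow> bool" where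
  "rwc a b \<longleftrightarrow> (\<forall>n. 0 < a n) \<and> (\<forall>n>0. 0 < b n) \<and> 0 \<le> b 0 \<and> (\<forall>n. a n + b n = 1)"

lemma rwcD:
  assumes "rwc a b"
  shows "0 < a n" "0 < n \<Longrightarrow> 0 < b n" "0 \<le> b n" "a n + b n = 1" "a n \<noteq> 0" "a n \<le> 1"
proof -
  show a: "0 < a n" "0 < n \<Longrightarrow> 0 < b n" "a n + b n = 1" using assms by (auto simp: rwc_def)
  show b: "0 \<le> b n" using assms by (cases n) (auto simp: rwc_def less_imp_le)
  show "a n \<noteq> 0" "a n \<le> 1" using a b by auto
qed

lemma rw_coeffs_rwc: "rw_coeffs A B \<Longrightarrow> rwc A B"
  by (auto simp: rw_coeffs_def rwc_def less_imp_le)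

lemma poly_rwp_rec:
  assumes "a (Suc n) \<noteq> 0"
  shows "x * poly (rwp a b (Suc n)) x =
     of_real (a (Suc n)) * poly (rwp a b (Suc (Suc n))) x + of_real (b (Suc n)) * poly (rwp a b n) x"
  using assms by simp

text \<open>Keeping \<open>rwp\<close> polymorphic allows zeros to be located over the complex
  numbers; as the coefficients are real, the complex instance extends the real one.\<close>

lemma poly_rwp_of_real:
  "poly (rwp a b n) (of_real x :: 'a::real_field) = of_real (poly (rwp a b n) x)"
  by (induction a b n rule: rwp.induct) simp_all

lemma poly_pderiv_rwp_of_real:
  "poly (pderiv (rwp a b n)) (of_real x :: 'a::real_field) = of_real (poly (pderiv (rwp a b n)) x)"
  by (induction a b n rule: rwp.induct)
    (simp_all add: pderiv_pCons pderiv_smult pderiv_diff pderiv_mult poly_rwp_of_real)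

lemma poly_rwp_minus:
  "poly (rwp a b n) (- x :: 'a::real_field) = (- 1) ^ n * poly (rwp a b n) x"
  by (induction a b n rule: rwp.induct) (simp_all add: algebra_simps)

lemma degree_coeff_rwp:
  assumes "\<And>n. 0 < a n"
  shows "degree (rwp a b n :: 'a::real_field poly) \<le> n \<and>
    poly.coeff (rwp a b n :: 'a poly) n = of_real (\<Prod>i<n. 1 / a i)"
  using assms
proof (induction a b n rule: rwp.induct)
  case (3 a b n)
  have "degree (rwp a b (Suc n) :: 'a poly) \<le> Suc n" "degree (rwp a b n :: 'a poly) \<le> n"
    using 3 by auto
  moreover from this have "poly.coeff (rwp a b n :: 'a poly) (Suc (Suc n)) = 0"
    by (intro coeff_eq_0) auto
  ultimately show ?case using 3
    by (auto simp: coeff_pCons intro!: degree_smult_le[THEN order_trans] degree_diff_le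
        degree_pCons_le[THEN order_trans])
qed (auto simp: degree_pCons_le)

lemma
  assumes "\<And>n. 0 < a n"
  shows degree_rwp: "degree (rwp a b n :: 'a::real_field poly) = n"
    and lead_coeff_rwp: "lead_coeff (rwp a b n :: 'a::real_field poly) = of_real (\<Prod>i<n. 1 / a i)"
    and rwp_nz: "(rwp a b n :: 'a::real_field poly) \<noteq> 0"
proof -
  note * = degree_coeff_rwp[OF assms, where b=b and n=n and 'a='a]
  have c: "poly.coeff (rwp a b n :: 'a poly) n \<noteq> 0"
    using * assms by (auto simp: less_le)
  show d: "degree (rwp a b n :: 'a::real_field poly) = n"
    using *[THEN conjunct1] le_degree[OF c] by (rule antisym)
  show "lead_coeff (rwp a b n :: 'a::real_field poly) = of_real (\<Prod>i<n. 1 / a i)"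
    using * d by simp
  show "(rwp a b n :: 'a::real_field poly) \<noteq> 0" using c by auto
qed

declare rwp.simps(3) [simp del]

text \<open>For consecutive values \<open>s \<le> s'\<close> and \<open>x \<ge> 1\<close> the
  recurrence gives \<open>a s'' = x s' - b s \<ge> (1 - b) s' = a s'\<close>. Besides confining the
  zeros to the open interval, positivity at 1 permits the normalization by values at 1.\<close>

lemma rwp_mono_ge_1:
  assumes "rwc a b" "1 \<le> (x::real)"
  shows "0 < poly (rwp a b n) x \<and> poly (rwp a b n) x \<le> poly (rwp a b (Suc n)) x"
proof (induction n)
  case 0
  have "a 0 \<le> x" using rwcD(6)[OF assms(1), of 0] assms(2) by linarith
  then show ?case using rwcD(1)[OF assms(1), of 0] by simp
next
  case (Suc n)
  let ?f = "\<lambda>n. poly (rwp a b n) x"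
  have r: "x * ?f (Suc n) = a (Suc n) * ?f (Suc (Suc n)) + b (Suc n) * ?f n"
    using poly_rwp_rec[of a n x b] rwcD[OF assms(1)] by simp
  have "b (Suc n) * ?f n \<le> b (Suc n) * ?f (Suc n)"
    using Suc rwcD[OF assms(1)] by (intro mult_left_mono) auto
  moreover have "1 * ?f (Suc n) \<le> x * ?f (Suc n)"
    using Suc assms by (intro mult_right_mono) auto
  moreover have "b (Suc n) = 1 - a (Suc n)" using rwcD(4)[OF assms(1), of "Suc n"] by simp
  ultimately have "a (Suc n) * ?f (Suc n) \<le> a (Suc n) * ?f (Suc (Suc n))"
    unfolding r by (simp add: algebra_simps)
  then have "?f (Suc n) \<le> ?f (Suc (Suc n))"
    using rwcD(1)[OF assms(1), of "Suc n"] by (rule mult_left_le_imp_le)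
  then show ?case using Suc by auto
qed

lemma rwp_pos_ge_1: "rwc a b \<Longrightarrow> 1 \<le> (x::real) \<Longrightarrow> 0 < poly (rwp a b n) x"
  using rwp_mono_ge_1 by blast

lemma rwp_root_abs_less_1:
  assumes "rwc a b" "poly (rwp a b n) (x::real) = 0"
  shows "\<bar>x\<bar> < 1"
proof (rule ccontr)
  assume "\<not> \<bar>x\<bar> < 1"
  then have "1 \<le> x \<or> 1 \<le> - x" by auto
  then show False
    using rwp_pos_ge_1[OF assms(1), of x n] rwp_pos_ge_1[OF assms(1), of "-x" n] assms(2)
    by (auto simp: poly_rwp_minus)
qed

text \<open>The reciprocals of the squared norms of the polynomials:
  \<open>w (n+1) b (n+1) = w n a n\<close> makes the recurrence symmetric.\<close>

fun cd_weight :: "(nat \<Rightarrow> real) \<Rightarrow> (nat \<Rightarrow> real) \<Rightarrow> nat \<Rightarrow> real" where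
  "cd_weight a b 0 = 1"
| "cd_weight a b (Suc n) = cd_weight a b n * a n / b (Suc n)"

lemma cd_weight_pos: "rwc a b \<Longrightarrow> 0 < cd_weight a b n"
  by (induction n) (auto simp: rwcD)

lemma christoffel_darboux:
  fixes x y :: "'a::real_field"
  assumes "rwc a b"
  shows "(x - y) * (\<Sum>j\<le>n. of_real (cd_weight a b j) * (poly (rwp a b j) x * poly (rwp a b j) y)) =
    of_real (cd_weight a b n * a n) *
      (poly (rwp a b (Suc n)) x * poly (rwp a b n) y - poly (rwp a b n) x * poly (rwp a b (Suc n)) y)"
proof (induction n)
  case 0
  then show ?case using rwcD(5)[OF assms, of 0] by (simp add: field_simps)
next
  case (Suc n)
  let ?w = "cd_weight a b"
  let ?f = "\<lambda>n. poly (rwp a b n :: 'a poly)"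
  have r: "of_real (a (Suc n)) * ?f (Suc (Suc n)) z = z * ?f (Suc n) z - of_real (b (Suc n)) * ?f n z" for z
    using poly_rwp_rec[of a n z b] rwcD[OF assms] by (metis add_diff_cancel_right')
  have "?w (Suc n) * b (Suc n) = ?w n * a n"
    using rwcD(2)[OF assms, of "Suc n"] by simp
  then have w: "of_real (?w (Suc n)) * of_real (b (Suc n)) = (of_real (?w n * a n) :: 'a)"
    by (metis of_real_mult)
  show ?case using r[of x] r[of y] w Suc by (simp del: cd_weight.simps) algebra
qed

text \<open>The case \<open>y = x\<close> of the kernel identity, with derivatives in place of
  difference quotients; it is proved afresh from the differentiated recurrence, which avoids a
  limit.\<close>

lemma christoffel_darboux_confluent:
  fixes x :: "'a::real_field"
  assumes "rwc a b"
  shows "(\<Sum>j\<le>n. of_real (cd_weight a b j) * (poly (rwp a b j) x)\<^sup>2) =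
    of_real (cd_weight a b n * a n) *
      (poly (pderiv (rwp a b (Suc n))) x * poly (rwp a b n) x - poly (pderiv (rwp a b n)) x * poly (rwp a b (Suc n)) x)"
proof (induction n)
  case 0
  then show ?case using rwcD[OF assms, of 0] by (simp add: pderiv_pCons)
next
  case (Suc n)
  let ?w = "cd_weight a b"
  let ?f = "\<lambda>n. poly (rwp a b n :: 'a poly) x"
  let ?d = "\<lambda>n. poly (pderiv (rwp a b n) :: 'a poly) x"
  have r: "of_real (a (Suc n)) * ?f (Suc (Suc n)) = x * ?f (Suc n) - of_real (b (Suc n)) * ?f n"
    using poly_rwp_rec[of a n x b] rwcD[OF assms] by (metis add_diff_cancel_right')
  have rd: "of_real (a (Suc n)) * ?d (Suc (Suc n)) = ?f (Suc n) + x * ?d (Suc n) - of_real (b (Suc n)) * ?d n"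
    using rwcD(5)[OF assms, of "Suc n"] by (simp add: rwp.simps(3) pderiv_smult pderiv_diff pderiv_pCons)
  have "?w (Suc n) * b (Suc n) = ?w n * a n"
    using rwcD(2)[OF assms, of "Suc n"] by simp
  then have w: "of_real (?w (Suc n)) * of_real (b (Suc n)) = (of_real (?w n * a n) :: 'a)"
    by (metis of_real_mult)
  show ?case using r rd w Suc by (simp del: cd_weight.simps) algebra
qed

text \<open>At a zero one of the two terms of the confluent kernel drops out, and the kernel is a
  positive sum. The sign gives simple zeros here and positive masses of the reversed measures
  later.\<close>

lemma rwp_deriv_mult_pos:
  assumes "rwc a b" "poly (rwp a b (Suc n)) (x::real) = 0"
  shows "0 < poly (pderiv (rwp a b (Suc n))) x * poly (rwp a b n) x"
proof -
  let ?S = "\<Sum>j\<le>n. cd_weight a b j * (poly (rwp a b j) x)\<^sup>2"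
  have "0 < cd_weight a b 0 * (poly (rwp a b 0) x)\<^sup>2" by simp
  also have "\<dots> \<le> ?S"
    using cd_weight_pos[OF assms(1)] by (intro member_le_sum) (auto simp: less_imp_le)
  also have "?S = cd_weight a b n * a n * (poly (pderiv (rwp a b (Suc n))) x * poly (rwp a b n) x)"
    using christoffel_darboux_confluent[OF assms(1), of x n] assms(2) by simp
  finally have "0 < cd_weight a b n * a n * (poly (pderiv (rwp a b (Suc n))) x * poly (rwp a b n) x)" .
  moreover have "0 < cd_weight a b n * a n"
    using cd_weight_pos[OF assms(1), of n] rwcD(1)[OF assms(1), of n] by simp
  ultimately show ?thesis by (rule zero_less_mult_pos)
qed

lemma rwp_pderiv_nz:
  assumes "rwc a b" "poly (rwp a b n) (x::real) = 0"
  shows "poly (pderiv (rwp a b n)) x \<noteq> 0"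
  using rwp_deriv_mult_pos[of a b _ x] assms by (cases n) fastforce+

lemma cnj_poly_rwp: "poly (rwp a b n) (cnj z) = cnj (poly (rwp a b n) z)"
  by (induction a b n rule: rwp.induct) (simp_all add: rwp.simps(3))

text \<open>At \<open>z\<close> and \<open>cnj z\<close> the right side of the kernel identity is 0,
  while the kernel is a positive sum of squared absolute values; hence
  \<open>z = cnj z\<close>.\<close>

lemma rwp_complex_root_real:
  assumes "rwc a b" "poly (rwp a b n) (z::complex) = 0"
  shows "z \<in> \<real>"
proof (cases n)
  case (Suc m)
  let ?S = "\<Sum>j\<le>m. of_real (cd_weight a b j) * (poly (rwp a b j) z * poly (rwp a b j) (cnj z))"
  have z: "poly (rwp a b (Suc m)) (cnj z) = 0" "poly (rwp a b (Suc m)) z = 0"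
    using assms(2) Suc by (simp_all only: cnj_poly_rwp complex_cnj_zero)
  have eq: "(z - cnj z) * ?S = 0"
    unfolding christoffel_darboux[OF assms(1)] z by simp
  have "?S = (\<Sum>j\<le>m. of_real (cd_weight a b j * (norm (poly (rwp a b j) z))\<^sup>2))"
    by (intro sum.cong refl) (simp add: cnj_poly_rwp complex_norm_square del: of_real_power)
  also have "\<dots> = of_real (\<Sum>j\<le>m. cd_weight a b j * (norm (poly (rwp a b j) z))\<^sup>2)"
    by simp
  finally have S: "?S = of_real (\<Sum>j\<le>m. cd_weight a b j * (norm (poly (rwp a b j) z))\<^sup>2)" .
  have "0 < cd_weight a b 0 * (norm (poly (rwp a b 0) z))\<^sup>2" by simp
  also have "\<dots> \<le> (\<Sum>j\<le>m. cd_weight a b j * (norm (poly (rwp a b j) z))\<^sup>2)"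
    using cd_weight_pos[OF assms(1)] by (intro member_le_sum) (auto simp: less_imp_le)
  finally have "?S \<noteq> 0" unfolding S by (metis less_irrefl of_real_eq_0_iff)
  then have "z = cnj z" using eq by simp
  then show ?thesis by (metis Reals_cnj_iff)
qed (use assms in simp)

text \<open>Over the complex numbers a squarefree polynomial has as many zeros as its degree; all of
  them are real, so none is lost by counting on the line.\<close>

lemma card_rwp_roots:
  assumes "rwc a b"
  shows "card {x::real. poly (rwp a b n) x = 0} = n"
proof -
  let ?F = "rwp a b n :: complex poly"
  have nz: "?F \<noteq> 0" by (rule rwp_nz) (rule rwcD(1)[OF assms])
  have roots: "{z. poly ?F z = 0} = of_real ` {x::real. poly (rwp a b n) x = 0}"
  proof (intro equalityI subsetI)
    fix z assume "z \<in> {z. poly ?F z = 0}"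
    moreover from this have "z \<in> \<real>" using rwp_complex_root_real[OF assms] by blast
    ultimately show "z \<in> of_real ` {x::real. poly (rwp a b n) x = 0}"
      by (auto elim!: Reals_cases simp: poly_rwp_of_real)
  qed (auto simp: poly_rwp_of_real)
  have "rsquarefree ?F"
    unfolding rsquarefree_roots
  proof safe
    fix z assume z: "poly ?F z = 0" "poly (pderiv ?F) z = 0"
    then obtain x where "z = of_real x" "poly (rwp a b n) x = 0" using roots by blast
    then show False using z(2) rwp_pderiv_nz[OF assms, of n x]
      by (simp add: poly_pderiv_rwp_of_real)
  qed
  then have "smult (lead_coeff ?F) (\<Prod>z|poly ?F z = 0. [:-z, 1:]) = ?F"
    by (rule complex_poly_decompose_rsquarefree)
  then have "degree ?F = degree (\<Prod>z|poly ?F z = 0. [:-z, 1:])"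
    by (metis degree_smult_eq leading_coeff_0_iff nz)
  also have "\<dots> = card {z. poly ?F z = 0}"
    by (subst degree_prod_eq_sum_degree) auto
  also have "\<dots> = card {x::real. poly (rwp a b n) x = 0}"
    unfolding roots by (rule card_image) (auto simp: inj_on_def)
  finally show ?thesis using degree_rwp[of a b n, where 'a=complex] rwcD(1)[OF assms] by simp
qed

text \<open>These turn out to be the parameters \<open>p\<^sub>2\<^sub>n\<close> of the continued fraction of the orthogonality measure.\<close>

definition canon :: "(nat \<Rightarrow> real) \<Rightarrow> (nat \<Rightarrow> real) \<Rightarrow> nat \<Rightarrow> real" where
  "canon a b n = (if n = 0 then 0 else b n * poly (rwp a b (n - 1)) 1 / poly (rwp a b n) 1)"

lemma canon_0 [simp]: "canon a b 0 = 0"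
  by (simp add: canon_def)

lemma one_minus_canon:
  assumes "rwc a b"
  shows "1 - canon a b (Suc n) = a (Suc n) * poly (rwp a b (Suc (Suc n))) 1 / poly (rwp a b (Suc n)) 1"
proof -
  have "poly (rwp a b (Suc n)) 1 = a (Suc n) * poly (rwp a b (Suc (Suc n))) 1 + b (Suc n) * poly (rwp a b n) (1::real)"
    using poly_rwp_rec[of a n "1::real" b] rwcD[OF assms, of "Suc n"] by simp
  moreover have "poly (rwp a b (Suc n)) (1::real) \<noteq> 0"
    using rwp_pos_ge_1[OF assms, of 1 "Suc n"] by simp
  ultimately show ?thesis
    unfolding canon_def by (simp add: divide_simps)
qed

lemma canon_bounds:
  assumes "rwc a b"
  shows "0 < n \<Longrightarrow> 0 < canon a b n" "canon a b n < 1"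
proof -
  note pos = rwp_pos_ge_1[OF assms, of 1]
  show "0 < n \<Longrightarrow> 0 < canon a b n"
    unfolding canon_def using pos rwcD(2)[OF assms, of n] by simp
  show "canon a b n < 1"
  proof (cases n)
    case (Suc m)
    have "0 < 1 - canon a b (Suc m)"
      unfolding one_minus_canon[OF assms] using pos rwcD(1)[OF assms, of "Suc m"]
      by (simp)
    then show ?thesis using Suc by simp
  qed simp
qed

lemma rwc_canon: "rwc a b \<Longrightarrow> rwc (\<lambda>n. 1 - canon a b n) (canon a b)"
  using canon_bounds[of a b] by (auto simp: rwc_def)

text \<open>Dividing each polynomial by its value at 1 changes the recurrence coefficients but not
  the zeros; in this normalization the coefficients are the parameters of the continued
  fraction.\<close>

lemma rwp_canon:
  assumes "rwc a b"
  shows "rwp (\<lambda>n. 1 - canon a b n) (canon a b) n = smult (1 / poly (rwp a b n) 1) (rwp a b n :: real poly)"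
proof (induction n rule: induct_nat_012)
  case (ge2 n)
  let ?f = "\<lambda>n. rwp a b n :: real poly"
  let ?e = "\<lambda>n. poly (rwp a b n) 1 :: real"
  note nz = less_imp_neq[OF rwp_pos_ge_1[OF assms, of 1], symmetric]
  have c: "canon a b (Suc n) = b (Suc n) * ?e n / ?e (Suc n)" by (simp add: canon_def)
  have "rwp (\<lambda>n. 1 - canon a b n) (canon a b) (Suc (Suc n))
    = smult (1 / (1 - canon a b (Suc n))) (smult (1 / ?e (Suc n)) ([:0,1:] * ?f (Suc n)) - smult (canon a b (Suc n) / ?e n) (?f n))"
    unfolding rwp.simps(3) ge2 by simp
  also have "canon a b (Suc n) / ?e n = (1 / ?e (Suc n)) * b (Suc n)"
    unfolding c using nz by simp
  also have "smult (1 / ?e (Suc n)) ([:0,1:] * ?f (Suc n)) - smult ((1 / ?e (Suc n)) * b (Suc n)) (?f n)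
     = smult (1 / ?e (Suc n)) ([:0,1:] * ?f (Suc n) - smult (b (Suc n)) (?f n))"
    by (simp add: smult_diff_right)
  also have "[:0,1:] * ?f (Suc n) - smult (b (Suc n)) (?f n) = smult (a (Suc n)) (?f (Suc (Suc n)))"
    using rwcD(5)[OF assms, of "Suc n"] by (simp add: rwp.simps(3))
  finally show ?case
    unfolding one_minus_canon[OF assms] using nz rwcD(5)[OF assms, of "Suc n"]
    by (simp)
qed (use rwcD(1,5)[OF assms, of 0] in \<open>simp_all add: one_pCons[symmetric]\<close>)

section \<open>Finite continued fractions\<close>

text \<open>A continued fraction with nonnegative coefficients maps each half plane into the
  opposite one; multiplying by \<open>Im z\<close> treats both together. The second conjunct keeps
  the denominators away from zero.\<close>

lemma Im_cfrac_sign: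
  assumes "\<And>i. 0 \<le> c i" "Im z \<noteq> 0"
  shows "Im z * Im (cfrac c n z) < 0 \<and> 0 < Im z * Im (z - complex_of_real (c 0) * cfrac (\<lambda>i. c (Suc i)) n z)"
  using assms(1)
proof (induction n arbitrary: c)
  case 0
  have inv: "Im z * Im (1 / z) < 0"
    using assms(2) by (simp add: Im_divide divide_simps sum_power2_gt_zero_iff
        flip: power2_eq_square)
  have "0 \<le> c 0 * - (Im z * Im (1 / z))" using 0 inv by (intro mult_nonneg_nonneg) auto
  moreover have "Im (complex_of_real (c 0) / z) = c 0 * Im (1 / z)" by (simp add: Im_divide)
  moreover have "0 < (Im z)\<^sup>2" using assms(2) by simp
  ultimately show ?case using inv by (simp add: algebra_simps power2_eq_square)
next
  case (Suc n)
  have inv: "Im (1 / w) = - Im w / (norm w)\<^sup>2" for w by (simp add: Im_divide cmod_power2)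
  have *: "Im z * Im (cfrac c (Suc n) z) < 0" if "\<And>i. 0 \<le> c i" for c
  proof -
    let ?d = "z - complex_of_real (c 0) * cfrac (\<lambda>i. c (Suc i)) n z"
    have "0 < Im z * Im ?d" using Suc.IH[of c] that by blast
    moreover from this have "?d \<noteq> 0" by (metis less_irrefl mult_zero_right zero_complex.sel(2))
    moreover have "Im z * Im (1 / ?d) = - (Im z * Im ?d) / (norm ?d)\<^sup>2"
      by (simp only: inv times_divide_eq_right mult_minus_right)
    ultimately show ?thesis by (simp add: divide_neg_pos)
  qed
  have "Im z * Im (cfrac (\<lambda>i. c (Suc i)) (Suc n) z) < 0" by (rule *) (use Suc.prems in auto)
  then have "0 \<le> c 0 * - (Im z * Im (cfrac (\<lambda>i. c (Suc i)) (Suc n) z))"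
    using Suc.prems by (intro mult_nonneg_nonneg) auto
  moreover have "0 < (Im z)\<^sup>2" using assms(2) by simp
  ultimately show ?case using *[OF Suc.prems]
    by (simp add: algebra_simps power2_eq_square del: cfrac.simps)
qed

lemma cfrac_minus: "cfrac c n (- z) = - cfrac c n z"
proof (induction n arbitrary: c)
  case (Suc n)
  have "- z + complex_of_real (c 0) * cfrac (\<lambda>i. c (Suc i)) n z =
    - (z - complex_of_real (c 0) * cfrac (\<lambda>i. c (Suc i)) n z)" by simp
  then show ?case
    by (simp only: cfrac.simps Suc mult_minus_right diff_minus_eq_add minus_divide_right)
qed simp

lemma cfrac_of_real: "cfrac c n (of_real x) = of_real (Re (cfrac c n (of_real x)))"
proof (induction n arbitrary: c)
  case (Suc n)
  define y where "y = Re (cfrac (\<lambda>i. c (Suc i)) n (of_real x))"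
  have C: "cfrac (\<lambda>i. c (Suc i)) n (of_real x) = of_real y" unfolding y_def by (rule Suc)
  have "cfrac c (Suc n) (of_real x) = of_real (1 / (x - c 0 * y))"
    by (simp add: C)
  then show ?case by (metis Re_complex_of_real)
next
  case 0
  have "cfrac c 0 (of_real x) = of_real (1 / x)" by simp
  then show ?case by (metis Re_complex_of_real)
qed

lemma Re_cfrac_Suc:
  "Re (cfrac c (Suc n) (of_real x)) = 1 / (x - c 0 * Re (cfrac (\<lambda>i. c (Suc i)) n (of_real x)))"
proof -
  define y where "y = Re (cfrac (\<lambda>i. c (Suc i)) n (of_real x))"
  have C: "cfrac (\<lambda>i. c (Suc i)) n (of_real x) = of_real y" unfolding y_def by (rule cfrac_of_real)
  have "cfrac c (Suc n) (of_real x) = of_real (1 / (x - c 0 * y))"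
    by (simp add: C)
  then show ?thesis unfolding y_def by (metis Re_complex_of_real)
qed

text \<open>On the real axis imaginary parts give nothing, and the chain form
  \<open>(1 - g i) * g (Suc i)\<close> is needed. The invariant is that \<open>g 0\<close> times the
  fraction is at most 1: the denominator one level further out is then at least
  \<open>x - (1 - g 0) > 0\<close>.\<close>

lemma cfrac_chain_real:
  assumes "\<And>i. 0 \<le> g i \<and> g i \<le> 1" "1 < x"
  shows "0 < Re (cfrac (\<lambda>i. (1 - g i) * g (Suc i)) n (of_real x)) \<and>
    g 0 * Re (cfrac (\<lambda>i. (1 - g i) * g (Suc i)) n (of_real x)) \<le> 1 \<and>
    0 < x - (1 - g 0) * g (Suc 0) * Re (cfrac (\<lambda>i. (1 - g (Suc i)) * g (Suc (Suc i))) n (of_real x))"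
  using assms(1)
proof (induction n arbitrary: g)
  case 0
  have g: "0 \<le> g 0" "g 0 \<le> 1" "0 \<le> g (Suc 0)" "g (Suc 0) \<le> 1" using 0 by auto
  have "1 < x * x" using assms(2) by (simp add: less_1_mult)
  moreover have "(1 - g 0) * g (Suc 0) \<le> 1 * 1" using g by (intro mult_mono) auto
  ultimately have "0 < x - (1 - g 0) * g (Suc 0) / x" using assms(2) by (simp add: field_simps)
  then show ?case using g assms(2) by (simp add: Re_divide_of_real)
next
  case (Suc n)
  have step: "0 < Re (cfrac (\<lambda>i. (1 - g i) * g (Suc i)) (Suc n) (of_real x)) \<and>
    g 0 * Re (cfrac (\<lambda>i. (1 - g i) * g (Suc i)) (Suc n) (of_real x)) \<le> 1"
    if "\<And>i. 0 \<le> g i \<and> g i \<le> 1" for g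
  proof -
    define y where "y = Re (cfrac (\<lambda>i. (1 - g (Suc i)) * g (Suc (Suc i))) n (of_real x))"
    have y: "g (Suc 0) * y \<le> 1"
      using Suc.IH[of "\<lambda>i. g (Suc i)"] that unfolding y_def by blast
    have "(1 - g 0) * (g (Suc 0) * y) \<le> (1 - g 0) * 1" using y that[of 0] by (intro mult_left_mono) auto
    then have d: "g 0 < x - (1 - g 0) * g (Suc 0) * y" using assms(2) by (simp add: mult.assoc)
    then have "0 < x - (1 - g 0) * g (Suc 0) * y" using that[of 0] by linarith
    then show ?thesis unfolding Re_cfrac_Suc y_def[symmetric] using d by simp
  qed
  define y where "y = Re (cfrac (\<lambda>i. (1 - g (Suc i)) * g (Suc (Suc i))) (Suc n) (of_real x))"
  have y: "g (Suc 0) * y \<le> 1"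
    using step[of "\<lambda>i. g (Suc i)"] Suc.prems unfolding y_def by blast
  have "(1 - g 0) * (g (Suc 0) * y) \<le> (1 - g 0) * 1"
    using y Suc.prems[of 0] by (intro mult_left_mono) auto
  then have "0 < x - (1 - g 0) * g (Suc 0) * y" using Suc.prems[of 0] assms(2) by (simp add: mult.assoc)
  then show ?case using step[of g] Suc.prems unfolding y_def by blast
qed

lemma cfrac_denominator_nz:
  assumes "\<And>i. 0 \<le> g i \<and> g i \<le> 1" "z \<notin> complex_of_real ` {-1..1}"
  shows "z - complex_of_real ((1 - g 0) * g (Suc 0)) * cfrac (\<lambda>i. (1 - g (Suc i)) * g (Suc (Suc i))) n z \<noteq> 0"
proof (cases "Im z = 0")
  case False
  have "0 < Im z * Im (z - complex_of_real ((1 - g 0) * g (Suc 0)) * cfrac (\<lambda>i. (1 - g (Suc i)) * g (Suc (Suc i))) n z)"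
    using Im_cfrac_sign[of "\<lambda>i. (1 - g i) * g (Suc i)" z n] assms False by (auto simp del: cfrac.simps)
  then show ?thesis by (metis less_irrefl mult_zero_right zero_complex.sel(2))
next
  case True
  have *: "complex_of_real x - complex_of_real ((1 - g 0) * g (Suc 0)) * cfrac (\<lambda>i. (1 - g (Suc i)) * g (Suc (Suc i))) n (of_real x) \<noteq> 0"
    if "1 < x" for x
  proof -
    define y where "y = Re (cfrac (\<lambda>i. (1 - g (Suc i)) * g (Suc (Suc i))) n (of_real x))"
    have y: "cfrac (\<lambda>i. (1 - g (Suc i)) * g (Suc (Suc i))) n (of_real x) = of_real y"
      unfolding y_def by (rule cfrac_of_real)
    have "0 < x - (1 - g 0) * g (Suc 0) * y"
      using cfrac_chain_real[of g x n] assms(1) that unfolding y_def by blast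
    then have "complex_of_real (x - (1 - g 0) * g (Suc 0) * y) \<noteq> 0" by (simp only: of_real_eq_0_iff)
    then show ?thesis unfolding y by (simp only: of_real_diff of_real_mult not_False_eq_True)
  qed
  obtain x where z: "z = of_real x" using True by (metis complex_eq_iff Re_complex_of_real Im_complex_of_real)
  have "1 < x \<or> 1 < - x" using assms(2) unfolding z by (auto simp: image_iff)
  then show ?thesis
  proof
    assume "1 < - x"
    from *[OF this] show ?thesis unfolding z of_real_minus cfrac_minus
      by (metis minus_diff_minus minus_equation_iff mult_minus_right neg_equal_0_iff_equal)
  qed (use * z in simp)
qed

section \<open>The reversed continued fraction in closed form\<close>

lemma outside_interval:
  assumes "z \<notin> complex_of_real ` {-1..1}"
  shows "z \<noteq> 0" "z \<noteq> 1" "z \<noteq> - 1" "z\<^sup>2 \<noteq> 1"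
proof -
  have "z \<noteq> complex_of_real x" if "x \<in> {-1..1}" for x using assms that by blast
  from this[of 0] this[of 1] this[of "-1"] show "z \<noteq> 0" "z \<noteq> 1" "z \<noteq> - 1" by auto
  then show "z\<^sup>2 \<noteq> 1" by (simp add: power2_eq_1_iff)
qed

lemma rwp_nz_outside:
  assumes "rwc a b" "z \<notin> complex_of_real ` {-1..1}"
  shows "poly (rwp a b n) z \<noteq> 0"
proof
  assume z: "poly (rwp a b n) z = 0"
  then obtain x where x: "z = of_real x" using rwp_complex_root_real[OF assms(1) z] by (auto elim: Reals_cases)
  then have "poly (rwp a b n) x = 0" using z by (simp add: poly_rwp_of_real)
  from rwp_root_abs_less_1[OF assms(1) this] have "x \<in> {-1..1}" by auto
  then show False using x assms(2) by blast
qed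

lemma rwp_chain_rec:
  fixes z :: "'a::real_field"
  assumes "rwc (\<lambda>n. 1 - p n) p"
  shows "of_real (1 - p (Suc n)) * poly (rwp (\<lambda>n. 1 - p n) p (Suc (Suc n))) z =
    z * poly (rwp (\<lambda>n. 1 - p n) p (Suc n)) z - of_real (p (Suc n)) * poly (rwp (\<lambda>n. 1 - p n) p n) z"
  using poly_rwp_rec[of "\<lambda>n. 1 - p n" n z p] rwcD(5)[OF assms, of "Suc n"] by simp

text \<open>The kernel polynomials \<open>g\<^sub>n - z g\<^sub>n\<^sub>+\<^sub>1\<close>, which belong to the measure \<open>(1 - x\<^sup>2) d\<mu>\<close>, obey the
  recurrence with the reversed coefficients.\<close>

lemma cfrac_reversed_tail:
  fixes p :: "nat \<Rightarrow> real" and z :: complex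
  defines "g \<equiv> \<lambda>n. poly (rwp (\<lambda>n. 1 - p n) p n) z"
  assumes p: "rwc (\<lambda>n. 1 - p n) p" "p 0 = 0" and z: "z \<notin> complex_of_real ` {-1..1}"
  shows "g (Suc n) - z * g (Suc (Suc n)) \<noteq> 0 \<and>
    cfrac (\<lambda>i. (1 - p (n - i + 1)) * p (n - i)) n z =
      (g n - z * g (Suc n)) / (of_real (1 - p (Suc n)) * (g (Suc n) - z * g (Suc (Suc n))))"
proof -
  define E where "E = (\<lambda>n. g n - z * g (Suc n))"
  have q: "complex_of_real (1 - p n) \<noteq> 0" for n using rwcD(5)[OF p(1), of n] by (metis of_real_eq_0_iff)
  have rec: "of_real (1 - p (Suc n)) * g (Suc (Suc n)) = z * g (Suc n) - of_real (p (Suc n)) * g n" for n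
    unfolding g_def by (rule rwp_chain_rec[OF p(1)])
  have z0: "z \<noteq> 0" "1 - z * z \<noteq> 0"
    using outside_interval[OF z] by (auto simp: power2_eq_square)
  have g01: "g 0 = 1" "g (Suc 0) = z" using p(2) by (simp_all add: g_def)
  have "E (Suc n) \<noteq> 0 \<and> cfrac (\<lambda>i. (1 - p (n - i + 1)) * p (n - i)) n z = E n / (of_real (1 - p (Suc n)) * E (Suc n))"
  proof (induction n)
    case 0
    have "of_real (1 - p (Suc 0)) * E (Suc 0) = z * (of_real (1 - p (Suc 0)) - of_real (1 - p (Suc 0)) * g (Suc (Suc 0)))"
      unfolding E_def g01 by (simp add: algebra_simps)
    also have "\<dots> = z * (1 - z * z)" unfolding rec g01 by simp
    finally have "of_real (1 - p (Suc 0)) * E (Suc 0) = z * (1 - z * z)" .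
    moreover have "E 0 = 1 - z * z" by (simp add: E_def g01)
    ultimately show ?case using z0 by auto
  next
    case (Suc n)
    define C where "C = cfrac (\<lambda>i. (1 - p (n - i + 1)) * p (n - i)) n z"
    have C: "C = E n / (of_real (1 - p (Suc n)) * E (Suc n))" and E1: "E (Suc n) \<noteq> 0"
      using Suc unfolding C_def by auto
    \<comment> \<open>The reversed coefficients have chain form again, for the sequence
      \<open>p (n + 2 - j)\<close>, so that \<open>cfrac_denominator_nz\<close> applies. Past index
      \<open>n\<close> the truncated subtraction leaves a factor \<open>p 0 = 0\<close> on both
      sides.\<close>
    have "(\<lambda>i. (1 - p (Suc (Suc n) - Suc i)) * p (Suc (Suc n) - Suc (Suc i))) = (\<lambda>i. (1 - p (n - i + 1)) * p (n - i))"
    proof (rule ext)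
      fix i show "(1 - p (Suc (Suc n) - Suc i)) * p (Suc (Suc n) - Suc (Suc i)) = (1 - p (n - i + 1)) * p (n - i)"
        using p(2) by (cases "i \<le> n") (auto simp: Suc_diff_le)
    qed
    then have nz: "z - of_real ((1 - p (Suc (Suc n))) * p (Suc n)) * C \<noteq> 0"
      using cfrac_denominator_nz[of "\<lambda>j. p (Suc (Suc n) - j)" z n] z rwcD(3,4,1)[OF p(1)]
      by (simp add: C_def less_imp_le)
    have CE: "C * (of_real (1 - p (Suc n)) * E (Suc n)) = E n" using E1 q[of "Suc n"] unfolding C by simp
    have "of_real (1 - p (Suc n)) * ((z - of_real ((1 - p (Suc (Suc n))) * p (Suc n)) * C) * E (Suc n)
       - of_real (1 - p (Suc (Suc n))) * E (Suc (Suc n))) = 0"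
      using CE rec[of n] rec[of "Suc n"] by (simp only: E_def of_real_mult of_real_diff of_real_1) algebra
    then have e: "(z - of_real ((1 - p (Suc (Suc n))) * p (Suc n)) * C) * E (Suc n) = of_real (1 - p (Suc (Suc n))) * E (Suc (Suc n))"
      using q[of "Suc n"] by simp
    have E2: "E (Suc (Suc n)) \<noteq> 0" using e nz E1 by auto
    have "cfrac (\<lambda>i. (1 - p (Suc n - i + 1)) * p (Suc n - i)) (Suc n) z = 1 / (z - of_real ((1 - p (Suc (Suc n))) * p (Suc n)) * C)"
      by (simp add: C_def)
    also have "\<dots> = E (Suc n) / (of_real (1 - p (Suc (Suc n))) * E (Suc (Suc n)))"
      unfolding e[symmetric] using nz E1 by simp
    finally show ?case using E2 by blast
  qed
  then show ?thesis unfolding E_def .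
qed

text \<open>The outermost coefficient is \<open>p n\<close> without a factor \<open>1 - p\<close>.
  Subtracting this last tail from \<open>z\<close> gives \<open>(1 - z^2) g (n+1)\<close> over a
  kernel polynomial, which creates both the factor \<open>1 - z^2\<close> and the poles at the zeros
  of \<open>g (n+1)\<close>.\<close>

lemma cfrac_reversed:
  fixes p :: "nat \<Rightarrow> real" and z :: complex
  defines "g \<equiv> \<lambda>n. poly (rwp (\<lambda>n. 1 - p n) p n) z"
  assumes p: "rwc (\<lambda>n. 1 - p n) p" "p 0 = 0" and z: "z \<notin> complex_of_real ` {-1..1}"
  shows "cfrac (reversed_coeff p n) n z = (g n - z * g (Suc n)) / ((1 - z\<^sup>2) * g (Suc n))"
proof (cases n)
  case 0
  show ?thesis using outside_interval[OF z] 0 p(2)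
    by (simp add: reversed_coeff_def g_def divide_simps power2_eq_square)
next
  case (Suc m)
  define C where "C = cfrac (\<lambda>i. (1 - p (m - i + 1)) * p (m - i)) m z"
  have E: "g (Suc m) - z * g (Suc (Suc m)) \<noteq> 0"
    and C: "C = (g m - z * g (Suc m)) / (of_real (1 - p (Suc m)) * (g (Suc m) - z * g (Suc (Suc m))))"
    using cfrac_reversed_tail[OF p z, of m] unfolding g_def C_def by auto
  have q: "complex_of_real (1 - p (Suc m)) \<noteq> 0" using rwcD(5)[OF p(1), of "Suc m"] by (metis of_real_eq_0_iff)
  have rec: "of_real (1 - p (Suc m)) * g (Suc (Suc m)) = z * g (Suc m) - of_real (p (Suc m)) * g m"
    unfolding g_def by (rule rwp_chain_rec[OF p(1)])
  then have "of_real (p (Suc m)) * (g m - z * g (Suc m)) = of_real (1 - p (Suc m)) * (z * g (Suc m) - g (Suc (Suc m)))"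
    by (simp add: algebra_simps)
  then have "of_real (p (Suc m)) * C = (z * g (Suc m) - g (Suc (Suc m))) / (g (Suc m) - z * g (Suc (Suc m)))"
    unfolding C using q by simp
  then have "z - of_real (p (Suc m)) * C = ((1 - z\<^sup>2) * g (Suc (Suc m))) / (g (Suc m) - z * g (Suc (Suc m)))"
    using E by (simp add: field_simps power2_eq_square)
  moreover have "cfrac (reversed_coeff p n) n z = 1 / (z - of_real (p (Suc m)) * C)"
    by (simp add: Suc C_def reversed_coeff_def)
  ultimately show ?thesis by (simp add: Suc)
qed

section \<open>Uniqueness of the parameters, from large real arguments\<close>

lemma cfrac_real_bounds:
  assumes "\<And>i. 0 \<le> c i \<and> c i \<le> 1" "3 \<le> x"
  shows "1 / (x + 1) \<le> Re (cfrac c n (of_real x)) \<and> Re (cfrac c n (of_real x)) \<le> 1 / (x - 1)"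
  using assms(1)
proof (induction n arbitrary: c)
  case 0
  then show ?case using assms(2) by (simp add: Re_divide_of_real divide_simps)
next
  case (Suc n)
  define y where "y = Re (cfrac (\<lambda>i. c (Suc i)) n (of_real x))"
  have "1 / (x + 1) \<le> y" "y \<le> 1 / (x - 1)"
    using Suc.IH[of "\<lambda>i. c (Suc i)"] Suc.prems unfolding y_def by auto
  moreover have "0 < 1 / (x + 1)" "1 / (x - 1) \<le> 1" using assms(2) by auto
  ultimately have "0 \<le> y" "y \<le> 1" by linarith+
  then have "0 \<le> c 0 * y" "c 0 * y \<le> 1" using Suc.prems[of 0] mult_le_one by auto
  then show ?case unfolding Re_cfrac_Suc y_def[symmetric] using assms(2)
    by (intro conjI divide_left_mono) auto
qed

lemma cfrac_tail_limit:
  assumes "\<And>i. 0 \<le> c i \<and> c i \<le> 1" "(\<lambda>n. Re (cfrac c n (of_real x))) \<longlonglongrightarrow> L x" "3 \<le> x"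
  shows "(\<lambda>n. c 0 * Re (cfrac (\<lambda>i. c (Suc i)) n (of_real x))) \<longlonglongrightarrow> x - 1 / L x"
proof -
  have "1 / (x + 1) \<le> L x"
    using cfrac_real_bounds[of c x] assms by (intro LIMSEQ_le_const[OF assms(2)]) blast
  moreover have "0 < 1 / (x + 1)" using assms(3) by simp
  ultimately have "L x \<noteq> 0" by linarith
  moreover have "(\<lambda>n. Re (cfrac c (Suc n) (of_real x))) \<longlonglongrightarrow> L x" using assms(2) by (rule LIMSEQ_Suc)
  ultimately have "(\<lambda>n. x - 1 / Re (cfrac c (Suc n) (of_real x))) \<longlonglongrightarrow> x - 1 / L x"
    by (intro tendsto_intros)
  then show ?thesis unfolding Re_cfrac_Suc by simp
qed

lemma cfrac_tail_bounds:
  assumes "\<And>i. 0 \<le> c i \<and> c i \<le> 1" "(\<lambda>n. Re (cfrac c n (of_real x))) \<longlonglongrightarrow> L x" "3 \<le> x"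
  shows "c 0 / (x + 1) \<le> x - 1 / L x \<and> x - 1 / L x \<le> c 0 / (x - 1)"
proof
  have b: "1 / (x + 1) \<le> Re (cfrac (\<lambda>i. c (Suc i)) n (of_real x)) \<and> Re (cfrac (\<lambda>i. c (Suc i)) n (of_real x)) \<le> 1 / (x - 1)" for n
    using cfrac_real_bounds[of "\<lambda>i. c (Suc i)" x] assms by blast
  have "c 0 * (1 / (x + 1)) \<le> x - 1 / L x"
    using b assms(1)[of 0]
    by (intro LIMSEQ_le_const[OF cfrac_tail_limit[where c=c and L=L, OF assms]] exI allI impI mult_left_mono) auto
  then show "c 0 / (x + 1) \<le> x - 1 / L x" by simp
  have "x - 1 / L x \<le> c 0 * (1 / (x - 1))"
    using b assms(1)[of 0]
    by (intro LIMSEQ_le_const2[OF cfrac_tail_limit[where c=c and L=L, OF assms]] exI allI impI mult_left_mono) auto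
  then show "x - 1 / L x \<le> c 0 / (x - 1)" by simp
qed

text \<open>\<open>x - 1 / L x\<close> behaves like \<open>c 0 / x\<close> for large
  \<open>x\<close>, so the limit function determines the first coefficient.\<close>

lemma cfrac_first_coeff_le:
  assumes "\<And>i. 0 \<le> c i \<and> c i \<le> 1" "\<And>i. 0 \<le> c' i \<and> c' i \<le> 1"
    and "\<And>x. 3 \<le> x \<Longrightarrow> (\<lambda>n. Re (cfrac c n (of_real x))) \<longlonglongrightarrow> L x"
    and "\<And>x. 3 \<le> x \<Longrightarrow> (\<lambda>n. Re (cfrac c' n (of_real x))) \<longlonglongrightarrow> L x"
  shows "c 0 \<le> c' 0"
proof (rule ccontr)
  assume "\<not> c 0 \<le> c' 0"
  then have d: "0 < c 0 - c' 0" by simp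
  \<comment> \<open>With this choice \<open>(c 0 - c' 0) * x\<close> exceeds 2, which is an upper
    bound of \<open>c 0 + c' 0\<close>.\<close>
  define x where "x = 3 + 2 / (c 0 - c' 0)"
  have x: "3 \<le> x" using d by (simp add: x_def)
  have "c 0 / (x + 1) \<le> c' 0 / (x - 1)"
    using cfrac_tail_bounds[where c=c and L=L, OF assms(1) assms(3)[OF x] x] cfrac_tail_bounds[where c=c' and L=L, OF assms(2) assms(4)[OF x] x] by linarith
  then have "c 0 * (x - 1) \<le> c' 0 * (x + 1)" using x by (simp add: divide_simps mult.commute)
  then have "(c 0 - c' 0) * x \<le> c 0 + c' 0" by (simp add: algebra_simps)
  moreover have "(c 0 - c' 0) * x = 3 * (c 0 - c' 0) + 2" using d by (simp add: x_def field_simps)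
  ultimately have "3 * (c 0 - c' 0) + 2 \<le> c 0 + c' 0" by (simp only:)
  then show False using d assms(1)[of 0, THEN conjunct2] assms(2)[of 0, THEN conjunct2] by argo
qed

text \<open>Stripping the first step from both fractions gives the same situation for the shifted
  coefficients. The positivity of \<open>c\<close> allows the division by \<open>c 0\<close>; of
  \<open>c'\<close> only membership in [0, 1] is known, because it comes from an arbitrary
  competitor in \<open>reversed_measure\<close>.\<close>

lemma cfrac_limit_coeff_unique:
  assumes "\<And>i. 0 < c i \<and> c i \<le> 1" "\<And>i. 0 \<le> c' i \<and> c' i \<le> 1"
    and "\<And>x. 3 \<le> x \<Longrightarrow> (\<lambda>n. Re (cfrac c n (of_real x))) \<longlonglongrightarrow> L x"
    and "\<And>x. 3 \<le> x \<Longrightarrow> (\<lambda>n. Re (cfrac c' n (of_real x))) \<longlonglongrightarrow> L x"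
  shows "c i = c' i"
  using assms
proof (induction i arbitrary: c c' L)
  case 0
  then have "\<And>i. 0 \<le> c i \<and> c i \<le> 1" by (simp add: less_imp_le)
  then show ?case using cfrac_first_coeff_le[of c c' L] cfrac_first_coeff_le[of c' c L] 0 by (intro antisym) blast+
next
  case (Suc i)
  have c: "\<And>i. 0 \<le> c i \<and> c i \<le> 1" using Suc.prems by (simp add: less_imp_le)
  have c0: "c 0 = c' 0" using cfrac_first_coeff_le[of c c' L] cfrac_first_coeff_le[of c' c L] Suc.prems c by (intro antisym) blast+
  have pos: "c 0 \<noteq> 0" using Suc.prems(1)[of 0] by simp
  show ?case
  proof (rule Suc.IH[where L="\<lambda>x. (x - 1 / L x) / c 0"])
    fix x :: real assume x: "3 \<le> x"
    show "(\<lambda>n. Re (cfrac (\<lambda>i. c (Suc i)) n (complex_of_real x))) \<longlonglongrightarrow> (x - 1 / L x) / c 0"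
      using tendsto_divide[OF cfrac_tail_limit[where c=c and L=L, OF c Suc.prems(3)[OF x] x] tendsto_const[of "c 0"]] pos by simp
    show "(\<lambda>n. Re (cfrac (\<lambda>i. c' (Suc i)) n (complex_of_real x))) \<longlonglongrightarrow> (x - 1 / L x) / c 0"
      using tendsto_divide[OF cfrac_tail_limit[where c=c' and L=L, OF Suc.prems(2) Suc.prems(4)[OF x] x] tendsto_const[of "c 0"]] pos c0 by simp
  qed (use Suc.prems in auto)
qed

text \<open>The limit yields the products \<open>(1 - p i) * p (Suc i)\<close>; starting from
  \<open>p 0 = 0\<close>, these determine \<open>p\<close> successively because no
  \<open>p i\<close> equals 1.\<close>

lemma stieltjes_params_unique:
  assumes p: "rwc (\<lambda>n. 1 - p n) p" "p 0 = 0" and "stieltjes_params \<mu> p" "stieltjes_params \<mu> p'"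
  shows "p' = p"
proof -
  have p': "p' 0 = 0" "\<And>i. 0 \<le> p' i \<and> p' i \<le> 1" using assms(4) by (auto simp: stieltjes_params_def)
  have out: "complex_of_real x \<notin> complex_of_real ` {-1..1}" if "3 \<le> x" for x
    using that by auto
  have lim: "(\<lambda>n. Re (cfrac (\<lambda>i. (1 - q i) * q (Suc i)) n (of_real x))) \<longlonglongrightarrow> Re (stieltjes \<mu> (of_real x))"
    if "stieltjes_params \<mu> q" "3 \<le> x" for q x
    using that out[of x] unfolding stieltjes_params_def by (auto intro!: tendsto_Re)
  have c: "(1 - p i) * p (Suc i) = (1 - p' i) * p' (Suc i)" for i
  proof (rule cfrac_limit_coeff_unique[where c="\<lambda>i. (1 - p i) * p (Suc i)" and c'="\<lambda>i. (1 - p' i) * p' (Suc i)"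
          and L="\<lambda>x. Re (stieltjes \<mu> (of_real x))"])
    fix i
    have "(1 - p i) * p (Suc i) \<le> 1 * 1"
      using rwcD(1,3)[OF p(1), of i] rwcD(1,3)[OF p(1), of "Suc i"] by (intro mult_mono) auto
    then show "0 < (1 - p i) * p (Suc i) \<and> (1 - p i) * p (Suc i) \<le> 1"
      using rwcD(1)[OF p(1), of i] rwcD(2)[OF p(1), of "Suc i"] by simp
    have "(1 - p' i) * p' (Suc i) \<le> 1 * 1"
      using p'(2)[of i] p'(2)[of "Suc i"] by (intro mult_mono) auto
    then show "0 \<le> (1 - p' i) * p' (Suc i) \<and> (1 - p' i) * p' (Suc i) \<le> 1"
      using p'(2)[of i] p'(2)[of "Suc i"] by simp
  qed (use lim assms(3,4) in auto)
  have "p' i = p i" for i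
  proof (induction i)
    case (Suc i)
    then show ?case using c[of i] rwcD(1)[OF p(1), of i] by simp
  qed (use p p' in simp)
  then show ?thesis by blast
qed

section \<open>Reversed measures\<close>

lemma synthetic_div_root:
  fixes D :: "'a::field poly"
  assumes "poly D y = 0"
  shows "poly D x = (x - y) * poly (synthetic_div D y) x"
    and "poly (pderiv D) y = poly (synthetic_div D y) y"
proof -
  have D: "D = [:- y, 1:] * synthetic_div D y"
    using synthetic_div_correct'[of y D] assms by simp
  show "poly D x = (x - y) * poly (synthetic_div D y) x"
    by (subst D) (simp add: algebra_simps)
  have "pderiv D = pderiv ([:- y, 1:] * synthetic_div D y)" using D by (rule arg_cong)
  then show "poly (pderiv D) y = poly (synthetic_div D y) y"
    unfolding pderiv_mult by (simp add: pderiv_pCons)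
qed

text \<open>\<open>synthetic_div D y\<close>, divided by its value \<open>D'(y)\<close> at
  \<open>y\<close>, is the Lagrange basis polynomial of the node \<open>y\<close>.\<close>

lemma lagrange_interpolation:
  fixes D N :: "'a::field poly"
  assumes Y: "card Y = degree D" "\<And>y. y \<in> Y \<Longrightarrow> poly D y = 0" "\<And>y. y \<in> Y \<Longrightarrow> poly (pderiv D) y \<noteq> 0"
    and deg: "degree N < degree D"
  shows "N = (\<Sum>y\<in>Y. smult (poly N y / poly (pderiv D) y) (synthetic_div D y))" (is "_ = ?M")
proof (rule poly_eqI_degree)
  have fin: "finite Y" using Y(1) deg by (intro card_ge_0_finite) simp
  fix y assume y: "y \<in> Y"
  have "poly (synthetic_div D x) y = 0" if "x \<in> Y - {y}" for x
    using synthetic_div_root(1)[OF Y(2), of x y] that Y(2)[OF y] by auto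
  then have "poly ?M y = poly N y / poly (pderiv D) y * poly (synthetic_div D y) y"
    unfolding poly_sum using fin y by (subst sum.remove[OF fin y]) (simp add: sum.neutral)
  then show "poly N y = poly ?M y" using synthetic_div_root(2)[OF Y(2)[OF y]] Y(3)[OF y] by simp
next
  have fin: "finite Y" using Y(1) deg by (intro card_ge_0_finite) simp
  show "degree N < card Y" using deg Y(1) by simp
  have "degree ?M \<le> degree D - 1"
    by (intro degree_sum_le fin degree_smult_le[THEN order_trans]) (simp add: degree_synthetic_div)
  then show "degree ?M < card Y" using deg Y(1) by simp
qed

lemma partial_fractions:
  fixes D N :: "'a::field poly"
  assumes Y: "card Y = degree D" "\<And>y. y \<in> Y \<Longrightarrow> poly D y = 0" "\<And>y. y \<in> Y \<Longrightarrow> poly (pderiv D) y \<noteq> 0"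
    and deg: "degree N < degree D" and z: "poly D z \<noteq> 0"
  shows "poly N z / poly D z = (\<Sum>y\<in>Y. poly N y / (poly (pderiv D) y * (z - y)))"
proof -
  have "poly N z = poly (\<Sum>y\<in>Y. smult (poly N y / poly (pderiv D) y) (synthetic_div D y)) z"
    by (rule arg_cong[OF lagrange_interpolation[OF Y deg]])
  also have "\<dots> = (\<Sum>y\<in>Y. poly N y / poly (pderiv D) y * poly (synthetic_div D y) z)"
    by (simp add: poly_sum)
  also have "\<dots> = (\<Sum>y\<in>Y. poly D z * (poly N y / (poly (pderiv D) y * (z - y))))"
  proof (intro sum.cong refl)
    fix y assume y: "y \<in> Y"
    have "z \<noteq> y" using Y(2)[OF y] z by auto
    then show "poly N y / poly (pderiv D) y * poly (synthetic_div D y) z = poly D z * (poly N y / (poly (pderiv D) y * (z - y)))"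
      unfolding synthetic_div_root(1)[OF Y(2)[OF y]] by simp
  qed
  finally have "poly N z = poly D z * (\<Sum>y\<in>Y. poly N y / (poly (pderiv D) y * (z - y)))"
    by (simp only: sum_distrib_left)
  then show ?thesis using z by simp
qed

text \<open>\<open>point_measure\<close> lives on the power set of \<open>X\<close>; pushing it
  forward along the identity gives a measure on the Borel sets of the line, as
  \<open>sym_prob_measure\<close> demands.\<close>

definition disc :: "real set \<Rightarrow> (real \<Rightarrow> real) \<Rightarrow> real measure" where
  "disc X w = distr (point_measure X (\<lambda>x. ennreal (w x))) borel (\<lambda>x. x)"

lemma sets_disc [simp, measurable_cong]: "sets (disc X w) = sets borel"
  and space_disc [simp]: "space (disc X w) = UNIV"
  by (simp_all add: disc_def)

lemma measurable_point_measure_id: "(\<lambda>x. x) \<in> point_measure X f \<rightarrow>\<^sub>M (borel :: real measure)"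
  by (rule measurableI) (auto simp: sets_point_measure space_point_measure)

lemma emeasure_disc:
  assumes "finite X" "A \<in> sets borel" "\<And>x. x \<in> X \<Longrightarrow> 0 \<le> w x"
  shows "emeasure (disc X w) A = ennreal (\<Sum>x\<in>X \<inter> A. w x)"
proof -
  have "emeasure (disc X w) A = emeasure (point_measure X (\<lambda>x. ennreal (w x))) (X \<inter> A)"
    unfolding disc_def using assms
    by (subst emeasure_distr[OF measurable_point_measure_id])
      (auto simp: space_point_measure Int_commute)
  also have "\<dots> = (\<Sum>x\<in>X \<inter> A. ennreal (w x))"
    using assms by (intro emeasure_point_measure_finite) auto
  also have "\<dots> = ennreal (\<Sum>x\<in>X \<inter> A. w x)"
    using assms by (intro sum_ennreal) auto
  finally show ?thesis .
qed

lemma measure_disc: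
  assumes "finite X" "A \<in> sets borel" "\<And>x. x \<in> X \<Longrightarrow> 0 \<le> w x"
  shows "measure (disc X w) A = (\<Sum>x\<in>X \<inter> A. w x)"
proof -
  have "0 \<le> (\<Sum>x\<in>X \<inter> A. w x)" using assms(3) by (intro sum_nonneg) auto
  moreover have "emeasure (disc X w) A = ennreal (\<Sum>x\<in>X \<inter> A. w x)" by (rule emeasure_disc[OF assms])
  ultimately show ?thesis by (simp add: measure_def)
qed

lemma measure_disc_singleton:
  assumes "finite X" "\<And>x. x \<in> X \<Longrightarrow> 0 \<le> w x"
  shows "measure (disc X w) {x} = (if x \<in> X then w x else 0)"
  by (subst measure_disc[OF assms(1) _ assms(2)]) auto

lemma integral_disc:
  fixes f :: "real \<Rightarrow> 'b::{banach, second_countable_topology}"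
  assumes "finite X" "\<And>x. x \<in> X \<Longrightarrow> 0 \<le> w x" "f \<in> borel_measurable borel"
  shows "(\<integral>x. f x \<partial>disc X w) = (\<Sum>x\<in>X. w x *\<^sub>R f x)"
proof -
  have "(\<integral>x. f x \<partial>disc X w) = (\<integral>x. f x \<partial>point_measure X (\<lambda>x. ennreal (w x)))"
    unfolding disc_def by (rule integral_distr[OF measurable_point_measure_id assms(3)])
  also have "\<dots> = (\<Sum>x\<in>X. w x *\<^sub>R f x)"
    using assms by (subst lebesgue_integral_point_measure_finite) auto
  finally show ?thesis .
qed

lemma AE_disc:
  assumes "finite X" "\<And>x. x \<in> X \<Longrightarrow> 0 \<le> w x"
  shows "AE x in disc X w. x \<in> X"
proof (rule AE_I)
  show "emeasure (disc X w) (- X) = 0"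
    using assms by (subst emeasure_disc) (auto simp: finite_imp_closed)
qed (use assms in \<open>auto simp: finite_imp_closed\<close>)

lemma sym_prob_measure_disc:
  assumes "finite X" "\<And>x. x \<in> X \<Longrightarrow> 0 \<le> w x" "(\<Sum>x\<in>X. w x) = 1" "X \<subseteq> {-1..1}"
    and "\<And>x. x \<in> X \<Longrightarrow> - x \<in> X \<and> w (- x) = w x"
  shows "sym_prob_measure (disc X w)"
  unfolding sym_prob_measure_def
proof (intro conjI)
  show "prob_space (disc X w)"
    by (rule prob_spaceI) (use assms in \<open>simp add: emeasure_disc\<close>)
  show "AE x in disc X w. x \<in> {-1..1}" 
  proof -
    have "AE x in disc X w. x \<in> X" by (rule AE_disc) (use assms in auto)
    then show ?thesis by eventually_elim (use assms(4) in blast)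
  qed
  show "distr (disc X w) borel uminus = disc X w"
  proof (rule measure_eqI)
    fix A assume "A \<in> sets (distr (disc X w) borel uminus)"
    then have A: "A \<in> sets borel" by simp
    have A': "uminus -` A \<in> sets borel" using measurable_sets[OF borel_measurable_uminus[OF measurable_ident] A] by simp
    have "emeasure (distr (disc X w) borel uminus) A = emeasure (disc X w) (uminus -` A)"
      using A by (subst emeasure_distr) auto
    also have "\<dots> = ennreal (\<Sum>x\<in>X \<inter> uminus -` A. w x)"
      using emeasure_disc[OF assms(1) A' assms(2)] .
    also have "(\<Sum>x\<in>X \<inter> uminus -` A. w x) = (\<Sum>x\<in>X \<inter> A. w x)"
      by (rule sum.reindex_bij_witness[where i=uminus and j=uminus]) (use assms(5) in force)+
    also have "ennreal \<dots> = emeasure (disc X w) A"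
      using emeasure_disc[OF assms(1) A assms(2)] by simp
    finally show "emeasure (distr (disc X w) borel uminus) A = emeasure (disc X w) A" .
  qed simp
qed simp

lemma finite_support_disc:
  assumes "prob_space \<nu>" "sets \<nu> = sets borel" "finite S" "AE x in \<nu>. x \<in> S"
  shows "\<nu> = disc S (\<lambda>x. measure \<nu> {x})"
proof (rule measure_eqI)
  interpret prob_space \<nu> by fact
  fix A assume "A \<in> sets \<nu>"
  then have A: "A \<in> sets borel" using assms(2) by simp
  have "emeasure \<nu> A = emeasure \<nu> (S \<inter> A)"
    using assms A by (intro emeasure_eq_AE) (auto simp: finite_imp_closed)
  also have "\<dots> = (\<Sum>x\<in>S \<inter> A. emeasure \<nu> {x})"
    using assms by (intro emeasure_eq_sum_singleton) auto
  also have "\<dots> = ennreal (\<Sum>x\<in>S \<inter> A. measure \<nu> {x})"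
    unfolding emeasure_eq_measure by (intro sum_ennreal) auto
  also have "\<dots> = emeasure (disc S (\<lambda>x. measure \<nu> {x})) A"
    using assms A by (subst emeasure_disc) auto
  finally show "emeasure \<nu> A = emeasure (disc S (\<lambda>x. measure \<nu> {x})) A" .
qed (use assms in simp)

lemma measurable_cauchy_kernel [measurable]: "(\<lambda>x. 1 / (z - complex_of_real x)) \<in> borel_measurable borel"
  by measurable

lemma stieltjes_disc:
  assumes "finite X" "\<And>x. x \<in> X \<Longrightarrow> 0 \<le> w x"
  shows "stieltjes (disc X w) z = (\<Sum>x\<in>X. of_real (w x) / (z - of_real x))"
  unfolding stieltjes_def
  by (subst integral_disc[OF assms measurable_cauchy_kernel])
    (auto intro!: sum.cong simp: scaleR_conv_of_real)

text \<open>The mass at \<open>x\<close> is the residue of the Stieltjes transform there, approached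
  vertically so that the path stays off the real axis.\<close>

lemma stieltjes_mass_limit:
  assumes "finite X"
  shows "((\<lambda>e. \<i> * of_real e * (\<Sum>t\<in>X. of_real (w t) / (of_real x + \<i> * of_real e - of_real t)))
    \<longlongrightarrow> (if x \<in> X then of_real (w x) else (0::complex))) (at_right (0::real))"
proof -
  have "((\<lambda>e. \<i> * of_real e * (of_real (w t) / (of_real x + \<i> * of_real e - of_real t)))
      \<longlongrightarrow> (if t = x then of_real (w x) else (0::complex))) (at_right (0::real))" for t
  proof (cases "t = x")
    case True
    have "eventually (\<lambda>e::real. \<i> * of_real e * (of_real (w t) / (of_real x + \<i> * of_real e - of_real t)) = of_real (w x)) (at_right 0)"
      using eventually_at_right_less[of 0] by eventually_elim (simp add: True)
    then show ?thesis unfolding if_P[OF True] by (rule tendsto_eventually)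
  next
    case False
    have "((\<lambda>e. \<i> * of_real e * (of_real (w t) / (of_real x + \<i> * of_real e - of_real t)))
      \<longlongrightarrow> \<i> * of_real 0 * (of_real (w t) / (of_real x + \<i> * of_real 0 - of_real t))) (at_right (0::real))"
      using False by (intro tendsto_intros) auto
    then show ?thesis using False by simp
  qed
  then have "((\<lambda>e. \<Sum>t\<in>X. \<i> * of_real e * (of_real (w t) / (of_real x + \<i> * of_real e - of_real t)))
      \<longlongrightarrow> (\<Sum>t\<in>X. if t = x then of_real (w x) else (0::complex))) (at_right (0::real))"
    by (intro tendsto_sum)
  then show ?thesis using assms by (simp add: sum_distrib_left)
qed

lemma disc_eqI:
  assumes X: "finite X" "\<And>x. x \<in> X \<Longrightarrow> 0 \<le> w x" and Y: "finite Y" "\<And>x. x \<in> Y \<Longrightarrow> 0 \<le> v x"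
    and eq: "\<And>z. z \<notin> complex_of_real ` {-1..1} \<Longrightarrow> stieltjes (disc X w) z = stieltjes (disc Y v) z"
  shows "disc X w = disc Y v"
proof (rule measure_eqI)
  have mass: "(if x \<in> X then w x else 0) = (if x \<in> Y then v x else 0)" for x
  proof -
    let ?S = "\<lambda>X w e. \<i> * of_real e * (\<Sum>t\<in>X. of_real (w t) / (of_real x + \<i> * of_real e - of_real t)) :: complex"
    have "of_real x + \<i> * of_real e \<notin> complex_of_real ` {-1..1}" if "0 < e" for e
      using that by (auto simp: complex_eq_iff)
    then have "\<forall>\<^sub>F e in at_right (0::real). ?S X w e = ?S Y v e"
      using eventually_at_right_less[of 0] eq
      by (auto elim!: eventually_mono simp flip: stieltjes_disc[OF X] stieltjes_disc[OF Y])
    then have "(?S Y v \<longlongrightarrow> (if x \<in> X then of_real (w x) else 0)) (at_right 0)"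
      using stieltjes_mass_limit[OF X(1), of w x] by (rule Lim_transform_eventually[rotated])
    then have "(if x \<in> X then of_real (w x) else 0) = (if x \<in> Y then of_real (v x) else (0::complex))"
      using stieltjes_mass_limit[OF Y(1), of v x] by (rule tendsto_unique[rotated]) simp
    then show ?thesis by (auto split: if_splits)
  qed
  fix A assume "A \<in> sets (disc X w)"
  then have A: "A \<in> sets borel" by simp
  have "(\<Sum>x\<in>X \<inter> A. w x) = (\<Sum>x\<in>(X \<union> Y) \<inter> A. if x \<in> X then w x else 0)"
    using X(1) Y(1) by (intro sum.mono_neutral_cong_left) auto
  also have "\<dots> = (\<Sum>x\<in>Y \<inter> A. v x)"
    unfolding mass using X(1) Y(1) by (intro sum.mono_neutral_cong_right) auto
  finally show "emeasure (disc X w) A = emeasure (disc Y v) A"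
    using emeasure_disc[OF X(1) A X(2)] emeasure_disc[OF Y(1) A Y(2)] by simp
qed simp

text \<open>Resolves the definite description: any competitor uses the same \<open>p\<close> by
  \<open>stieltjes_params_unique\<close>, is discrete because its support is finite, and has the
  same transform, hence the same masses.\<close>

lemma reversed_measure_eq_disc:
  assumes p: "rwc (\<lambda>n. 1 - p n) p" "p 0 = 0" "stieltjes_params \<mu> p"
    and X: "finite X" "\<And>x. x \<in> X \<Longrightarrow> 0 \<le> w x" "sym_prob_measure (disc X w)"
    and eq: "\<And>z. z \<notin> complex_of_real ` {-1..1} \<Longrightarrow> stieltjes (disc X w) z = cfrac (reversed_coeff p n) n z"
  shows "reversed_measure \<mu> n = disc X w"
  unfolding reversed_measure_def
proof (rule the_equality, intro conjI)
  show "\<exists>S. finite S \<and> (AE x in disc X w. x \<in> S)" by (rule exI[of _ X], intro conjI X(1) AE_disc X)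
  show "\<exists>p. stieltjes_params \<mu> p \<and> (\<forall>z. z \<notin> complex_of_real ` {-1..1} \<longrightarrow> stieltjes (disc X w) z = cfrac (reversed_coeff p n) n z)"
    using p(3) eq by blast
next
  fix \<nu> assume nu: "sym_prob_measure \<nu> \<and> (\<exists>S. finite S \<and> (AE x in \<nu>. x \<in> S)) \<and>
        (\<exists>p. stieltjes_params \<mu> p \<and>
           (\<forall>z. z \<notin> complex_of_real ` {-1..1} \<longrightarrow> stieltjes \<nu> z = cfrac (reversed_coeff p n) n z))"
  then obtain S p' where S: "finite S" "AE x in \<nu>. x \<in> S" and p': "stieltjes_params \<mu> p'"
    "\<And>z. z \<notin> complex_of_real ` {-1..1} \<Longrightarrow> stieltjes \<nu> z = cfrac (reversed_coeff p' n) n z" by blast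
  have [simp]: "p' = p" by (rule stieltjes_params_unique[OF p p'(1)])
  have nu': "\<nu> = disc S (\<lambda>x. measure \<nu> {x})"
    using nu S by (intro finite_support_disc) (auto simp: sym_prob_measure_def)
  have "disc S (\<lambda>x. measure \<nu> {x}) = disc X w"
    using S X p'(2) eq by (intro disc_eqI) (auto simp flip: nu')
  then show "\<nu> = disc X w" using nu' by simp
qed (fact X(3))

section \<open>Weights and support of the reversed measures\<close>

lemma rwp_chain_at_1: "rwc (\<lambda>n. 1 - p n) p \<Longrightarrow> p 0 = 0 \<Longrightarrow> poly (rwp (\<lambda>n. 1 - p n) p n) (1::'a::real_field) = 1"
proof (induction n rule: induct_nat_012)
  case (ge2 n)
  have "of_real (1 - p (Suc n)) * poly (rwp (\<lambda>n. 1 - p n) p (Suc (Suc n))) (1::'a) = of_real (1 - p (Suc n)) * 1"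
    using rwp_chain_rec[OF ge2.prems(1), of n "1::'a"] ge2 by simp
  moreover have "of_real (1 - p (Suc n)) \<noteq> (0::'a)" using rwcD(5)[OF ge2.prems(1), of "Suc n"] by (metis of_real_eq_0_iff)
  ultimately show ?case by (metis mult_left_cancel)
qed simp_all

text \<open>The residue of \<open>(g n - z g (n+1)) / ((1 - z^2) g (n+1))\<close> at a zero
  \<open>x\<close> of \<open>g (n+1)\<close>, with \<open>g\<close> normalized at 1.\<close>

definition rev_weight :: "(nat \<Rightarrow> real) \<Rightarrow> nat \<Rightarrow> real \<Rightarrow> real" where
  "rev_weight p n x = poly (rwp (\<lambda>n. 1 - p n) p n) x
     / ((1 - x\<^sup>2) * poly (pderiv (rwp (\<lambda>n. 1 - p n) p (Suc n))) x)"

lemma pderiv_rwp_minus: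
  "poly (pderiv (rwp a b n)) (- x :: real) = - ((- 1) ^ n * poly (pderiv (rwp a b n)) x)"
proof -
  have "pcompose (rwp a b n) [:0, -1:] = smult ((-1) ^ n) (rwp a b n :: real poly)"
    by (rule poly_ext) (simp add: poly_pcompose poly_rwp_minus)
  then have "pderiv (pcompose (rwp a b n) [:0, -1:]) = smult ((-1) ^ n) (pderiv (rwp a b n :: real poly))"
    by (simp add: pderiv_smult)
  then have "poly (pderiv (pcompose (rwp a b n) [:0, -1:])) x = (-1) ^ n * poly (pderiv (rwp a b n)) x"
    by simp
  then show ?thesis by (simp add: pderiv_pcompose poly_pcompose pderiv_pCons)
qed

lemma reversed_partial_fractions:
  assumes p: "rwc (\<lambda>n. 1 - p n) p" "p 0 = 0" and z: "z \<notin> complex_of_real ` {-1..1}"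
  shows "cfrac (reversed_coeff p n) n z =
    (\<Sum>x | poly (rwp (\<lambda>n. 1 - p n) p (Suc n)) x = 0. of_real (rev_weight p n x) / (z - of_real x))"
proof -
  let ?g = "rwp (\<lambda>n. 1 - p n) p"
  define X where "X = {x::real. poly (?g (Suc n)) x = 0}"
  define D where "D = ([:1, 0, -1:] * ?g (Suc n) :: complex poly)"
  define N where "N = (?g n - [:0, 1:] * ?g (Suc n) :: complex poly)"
  \<comment> \<open>The points 1 and -1 are needed as nodes to match the degree of \<open>D\<close>,
    but their residues vanish, because every \<open>g\<close> is 1 at 1 and the parity
    alternates.\<close>
  define Y where "Y = complex_of_real ` (insert 1 (insert (-1) X))"
  have X1: "\<bar>x\<bar> < 1" if "x \<in> X" for x using rwp_root_abs_less_1[OF p(1)] that unfolding X_def by blast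
  have finX: "finite X" unfolding X_def by (intro poly_roots_finite rwp_nz rwcD(1)[OF p(1)])
  have dg: "degree (?g m :: complex poly) = m" for m by (intro degree_rwp rwcD(1)[OF p(1)])
  have gnz: "(?g m :: complex poly) \<noteq> 0" for m by (intro rwp_nz rwcD(1)[OF p(1)])
  have dD: "degree D = n + 3" unfolding D_def using gnz by (subst degree_mult_eq) (auto simp: dg)
  have "1 \<notin> insert (-1) X" "-1 \<notin> X" using X1[of 1] X1[of "-1"] by auto
  then have "card (insert 1 (insert (-1) X)) = Suc (Suc (card X))" using finX by simp
  also have "card X = Suc n" unfolding X_def by (rule card_rwp_roots[OF p(1)])
  finally have cardY: "card Y = degree D" unfolding Y_def dD
    by (subst card_image) (auto simp: inj_on_def)
  have z1: "z\<^sup>2 \<noteq> 1" by (rule outside_interval[OF z])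
  have gz: "poly (?g (Suc n)) z \<noteq> 0" by (rule rwp_nz_outside[OF p(1) z])
  have D_nz: "poly D z \<noteq> 0" using z1 gz by (simp add: D_def power2_eq_square)
  have degN: "degree N < degree D"
  proof -
    have "degree ([:0, 1:] * ?g (Suc n) :: complex poly) \<le> n + 2"
      using degree_mult_le[of "[:0,1:] :: complex poly" "?g (Suc n)"] by (simp add: dg)
    then have "degree N \<le> n + 2" unfolding N_def by (intro degree_diff_le) (auto simp: dg)
    then show ?thesis using dD by simp
  qed
  have c1: "poly (?g m) (1::complex) = 1" for m by (rule rwp_chain_at_1[OF p])
  have N1: "poly N 1 = 0" "poly N (-1) = 0"
    by (simp_all add: N_def poly_rwp_minus c1)
  have g1: "poly (?g (Suc n)) (1::complex) = 1" "poly (?g (Suc n)) (-1::complex) = (-1) ^ (Suc n)"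
    by (simp_all add: poly_rwp_minus c1)
  have DX: "poly (pderiv D) (of_real x) = of_real ((1 - x\<^sup>2) * poly (pderiv (?g (Suc n))) x)" "poly D (of_real x) = 0"
    "poly N (of_real x) = of_real (poly (?g n) x)" "(1 - x\<^sup>2) * poly (pderiv (?g (Suc n))) x \<noteq> 0" if "x \<in> X" for x
  proof -
    have x: "poly (?g (Suc n)) x = 0" using that X_def by blast
    then have x': "poly (?g (Suc n)) (complex_of_real x) = 0" by (simp add: poly_rwp_of_real)
    show "poly D (of_real x) = 0" by (simp add: D_def x')
    show "poly N (of_real x) = of_real (poly (?g n) x)" by (simp add: N_def x poly_rwp_of_real)
    show "poly (pderiv D) (of_real x) = of_real ((1 - x\<^sup>2) * poly (pderiv (?g (Suc n))) x)"
      unfolding D_def pderiv_mult by (simp add: x x' poly_pderiv_rwp_of_real power2_eq_square pderiv_pCons algebra_simps)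
    show "(1 - x\<^sup>2) * poly (pderiv (?g (Suc n))) x \<noteq> 0"
      using rwp_pderiv_nz[OF p(1) x] X1[OF that] by (auto simp: power2_eq_1_iff)
  qed
  have D1: "poly (pderiv D) 1 \<noteq> 0" "poly (pderiv D) (-1) \<noteq> 0" "poly D 1 = 0" "poly D (-1) = 0"
    unfolding D_def pderiv_mult using g1 by (simp_all add: pderiv_pCons)
  have "cfrac (reversed_coeff p n) n z = poly N z / poly D z"
    unfolding cfrac_reversed[OF p z] by (simp add: N_def D_def power2_eq_square algebra_simps)
  also have "\<dots> = (\<Sum>y\<in>Y. poly N y / (poly (pderiv D) y * (z - y)))"
  proof (rule partial_fractions[OF cardY _ _ degN D_nz])
    fix y assume "y \<in> Y"
    then consider "y = 1" | "y = -1" | x where "x \<in> X" "y = of_real x" unfolding Y_def by auto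
    then show "poly D y = 0" "poly (pderiv D) y \<noteq> 0" using D1 DX
      by (metis, metis (no_types, lifting) of_real_eq_0_iff)
  qed
  also have "\<dots> = (\<Sum>x\<in>insert 1 (insert (-1) X). poly N (of_real x) / (poly (pderiv D) (of_real x) * (z - of_real x)))"
    unfolding Y_def by (subst sum.reindex) (auto simp: inj_on_def)
  also have "\<dots> = (\<Sum>x\<in>X. poly N (of_real x) / (poly (pderiv D) (of_real x) * (z - of_real x)))"
    using finX N1 by (intro sum.mono_neutral_right) auto
  also have "\<dots> = (\<Sum>x\<in>X. of_real (rev_weight p n x) / (z - of_real x))"
    by (intro sum.cong refl) (simp add: DX rev_weight_def)
  finally show ?thesis unfolding X_def .
qed

lemma le_const_all_imp_nonpos:
  fixes c d :: real
  assumes "\<And>x. 3 \<le> x \<Longrightarrow> c * x \<le> d"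
  shows "c \<le> 0"
proof (rule ccontr)
  assume "\<not> c \<le> 0"
  then have c: "0 < c" by simp
  have "c * (3 + (\<bar>d\<bar> + 1) / c) \<le> d" using c by (intro assms) simp
  moreover have "c * (3 + (\<bar>d\<bar> + 1) / c) = 3 * c + \<bar>d\<bar> + 1" using c by (simp add: field_simps)
  ultimately show False using c by linarith
qed

lemma reversed_measure_disc:
  assumes p: "rwc (\<lambda>n. 1 - p n) p" "p 0 = 0" "stieltjes_params \<mu> p"
  defines "X \<equiv> \<lambda>n. {x. poly (rwp (\<lambda>n. 1 - p n) p (Suc n)) x = 0}"
  shows "reversed_measure \<mu> n = disc (X n) (rev_weight p n)"
    and "x \<in> X n \<Longrightarrow> 0 < rev_weight p n x"
proof -
  let ?g = "\<lambda>n. rwp (\<lambda>n. 1 - p n) p n :: real poly"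
  have finX: "finite (X n)" unfolding X_def by (intro poly_roots_finite rwp_nz rwcD(1)[OF p(1)])
  have X1: "\<bar>x\<bar> < 1" if "x \<in> X n" for x using rwp_root_abs_less_1[OF p(1)] that unfolding X_def by blast
  have pos: "0 < rev_weight p n x" if "x \<in> X n" for x
  proof -
    have "x\<^sup>2 < 1" using X1[OF that] by (simp add: abs_square_less_1)
    moreover have "0 < poly (pderiv (?g (Suc n))) x * poly (?g n) x"
      using that by (intro rwp_deriv_mult_pos[OF p(1)]) (simp add: X_def)
    moreover from this have "poly (pderiv (?g (Suc n))) x \<noteq> 0" by auto
    then have "rev_weight p n x = poly (pderiv (?g (Suc n))) x * poly (?g n) x / ((1 - x\<^sup>2) * (poly (pderiv (?g (Suc n))) x)\<^sup>2)"
      by (simp add: rev_weight_def power2_eq_square)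
    ultimately show ?thesis using \<open>poly (pderiv (?g (Suc n))) x \<noteq> 0\<close> by simp
  qed
  show "x \<in> X n \<Longrightarrow> 0 < rev_weight p n x" by (rule pos)
  note ge = pos[THEN less_imp_le]
  define W where "W = (\<Sum>x\<in>X n. rev_weight p n x)"
  have W0: "0 \<le> W" unfolding W_def using ge by (rule sum_nonneg)
  \<comment> \<open>Total mass 1 follows without evaluating the sum of the weights: the transform at
    \<open>y\<close> lies between 1/(y+1) and 1/(y-1) as a continued fraction, and between the
    \<open>W\<close> multiples of these as a sum over the nodes. Growing \<open>y\<close> forces
    \<open>W = 1\<close>.\<close>
  have b: "(W - 1) * y \<le> W + 1 \<and> (1 - W) * y \<le> W + 1" if y: "3 \<le> y" for y :: real
  proof -
    have out: "complex_of_real y \<notin> complex_of_real ` {-1..1}" using y by auto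
    define S where "S = (\<Sum>x\<in>X n. rev_weight p n x / (y - x))"
    have "cfrac (reversed_coeff p n) n (of_real y) = of_real S"
      unfolding reversed_partial_fractions[OF p(1,2) out] S_def X_def by simp
    then have "Re (cfrac (reversed_coeff p n) n (of_real y)) = S" by simp
    moreover have "0 \<le> reversed_coeff p n i \<and> reversed_coeff p n i \<le> 1" for i
      unfolding reversed_coeff_def using rwcD(1,3)[OF p(1)]
      by (auto intro!: mult_le_one simp: less_imp_le)
    ultimately have S: "1 / (y + 1) \<le> S" "S \<le> 1 / (y - 1)"
      using cfrac_real_bounds[of "reversed_coeff p n" y n] y by auto
    have "S \<le> (\<Sum>x\<in>X n. rev_weight p n x / (y - 1))"
      unfolding S_def using X1 y ge by (intro sum_mono divide_left_mono mult_pos_pos) (auto simp: abs_less_iff dest: X1)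
    also have "\<dots> = W / (y - 1)" by (simp add: W_def sum_divide_distrib)
    finally have 1: "S \<le> W / (y - 1)" .
    have "(\<Sum>x\<in>X n. rev_weight p n x / (y + 1)) \<le> S"
      unfolding S_def using X1 y ge by (intro sum_mono divide_left_mono mult_pos_pos) (auto simp: abs_less_iff dest: X1)
    moreover have "(\<Sum>x\<in>X n. rev_weight p n x / (y + 1)) = W / (y + 1)" by (simp add: W_def sum_divide_distrib)
    ultimately have "W / (y + 1) \<le> 1 / (y - 1)" "1 / (y + 1) \<le> W / (y - 1)" using S 1 by linarith+
    then show ?thesis using y by (simp add: divide_simps algebra_simps)
  qed
  have "W = 1" using le_const_all_imp_nonpos[of "W - 1" "W + 1"] le_const_all_imp_nonpos[of "1 - W" "W + 1"] b by force
  show "reversed_measure \<mu> n = disc (X n) (rev_weight p n)"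
  proof (rule reversed_measure_eq_disc[OF p finX ge])
    show "sym_prob_measure (disc (X n) (rev_weight p n))"
    proof (rule sym_prob_measure_disc[OF finX ge])
      show "X n \<subseteq> {-1..1}" using X1 by (fastforce simp: abs_less_iff)
      show "- x \<in> X n \<and> rev_weight p n (- x) = rev_weight p n x" if "x \<in> X n" for x
        using that unfolding X_def rev_weight_def by (simp add: poly_rwp_minus pderiv_rwp_minus)
    qed (use \<open>W = 1\<close> W_def in auto)
    fix z assume z: "z \<notin> complex_of_real ` {-1..1}"
    show "stieltjes (disc (X n) (rev_weight p n)) z = cfrac (reversed_coeff p n) n z"
      using stieltjes_disc[of "X n" "rev_weight p n" z, OF finX ge] reversed_partial_fractions[OF p(1,2) z, of n]
      by (simp add: X_def)
  qed
qed

lemma reversed_measure_mass: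
  assumes "rwc (\<lambda>n. 1 - p n) p" "p 0 = 0" "stieltjes_params \<mu> p"
  shows "measure (reversed_measure \<mu> n) {x} =
    (if poly (rwp (\<lambda>n. 1 - p n) p (Suc n)) x = 0 then rev_weight p n x else 0)"
proof -
  have "finite {x::real. poly (rwp (\<lambda>n. 1 - p n) p (Suc n)) x = 0}"
    by (intro poly_roots_finite rwp_nz rwcD(1)[OF assms(1)])
  then show ?thesis
    unfolding reversed_measure_disc(1)[OF assms]
    by (subst measure_disc_singleton) (auto intro!: less_imp_le reversed_measure_disc(2)[OF assms])
qed

lemma support_points_reversed_measure:
  assumes "rwc (\<lambda>n. 1 - p n) p" "p 0 = 0" "stieltjes_params \<mu> p"
  shows "support_points (reversed_measure \<mu> n) = {x. poly (rwp (\<lambda>n. 1 - p n) p (Suc n)) x = 0}"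
  using reversed_measure_disc(2)[OF assms, of _ n]
  by (auto simp: support_points_def reversed_measure_mass[OF assms])

section \<open>Gauss quadrature and Markov's theorem\<close>

lemma sym_prob_measureD:
  assumes "sym_prob_measure \<mu>"
  shows "prob_space \<mu>" "sets \<mu> = sets borel" "AE x in \<mu>. x \<in> {-1..1}"
  using assms by (auto simp: sym_prob_measure_def)

lemma integrable_continuous_sym_prob:
  fixes f :: "real \<Rightarrow> 'b::{banach, second_countable_topology}"
  assumes \<mu>: "sym_prob_measure \<mu>" and "f \<in> borel_measurable borel" "continuous_on {-1..1} f"
  shows "integrable \<mu> f"
proof -
  interpret prob_space \<mu> by (rule sym_prob_measureD[OF \<mu>])
  have "compact (f ` {-1..1})" using assms(3) by (rule compact_continuous_image) simp
  then obtain B where B: "\<And>x. x \<in> {-1..1} \<Longrightarrow> norm (f x) \<le> B"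
    by (meson bounded_iff compact_imp_bounded image_eqI)
  show ?thesis
  proof (rule integrable_const_bound)
    show "AE x in \<mu>. norm (f x) \<le> B"
      using sym_prob_measureD(3)[OF \<mu>] by eventually_elim (rule B)
    show "f \<in> borel_measurable \<mu>"
      using assms(2) measurable_cong_sets[OF sym_prob_measureD(2)[OF \<mu>] refl] by blast
  qed
qed

lemma borel_measurable_poly [measurable]: "poly (q :: real poly) \<in> borel_measurable borel"
  by (intro borel_measurable_continuous_onI continuous_intros)

lemma integrable_poly_sym_prob: "sym_prob_measure \<mu> \<Longrightarrow> integrable \<mu> (poly q)"
  by (intro integrable_continuous_sym_prob borel_measurable_poly continuous_intros)

lemma rwp_span:
  fixes q :: "real poly"
  assumes "\<And>n. 0 < a n" "degree q \<le> n"
  shows "\<exists>c. q = (\<Sum>j\<le>n. smult (c j) (rwp a b j))"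
  using assms(2)
proof (induction n arbitrary: q)
  case 0
  then obtain k where "q = [:k:]" by (auto elim: degree_eq_zeroE)
  then show ?case by (intro exI[of _ "\<lambda>_. k"]) simp
next
  case (Suc n)
  define l where "l = poly.coeff (rwp a b (Suc n) :: real poly) (Suc n)"
  define c where "c = poly.coeff q (Suc n) / l"
  have d: "degree (rwp a b (Suc n) :: real poly) = Suc n" by (rule degree_rwp[OF assms(1)])
  then have "l \<noteq> 0" using rwp_nz[where a=a and b=b and n="Suc n" and 'a=real, OF assms(1)]
    unfolding l_def by (metis leading_coeff_0_iff)
  have "degree (q - smult c (rwp a b (Suc n))) \<le> n"
  proof (rule degree_le, intro allI impI)
    fix i assume "n < i"
    then consider "i = Suc n" | "Suc n < i" by linarith
    then show "poly.coeff (q - smult c (rwp a b (Suc n))) i = 0"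
      using Suc.prems d \<open>l \<noteq> 0\<close> by cases (auto simp: c_def l_def coeff_eq_0)
  qed
  from Suc.IH[OF this] obtain c' where c': "q - smult c (rwp a b (Suc n)) = (\<Sum>j\<le>n. smult (c' j) (rwp a b j))"
    by blast
  have "(\<Sum>j\<le>n. smult ((c'(Suc n := c)) j) (rwp a b j)) = (\<Sum>j\<le>n. smult (c' j) (rwp a b j))"
    by (intro sum.cong refl) auto
  then have "q = (\<Sum>j\<le>Suc n. smult ((c'(Suc n := c)) j) (rwp a b j))"
    using c' by (simp add: algebra_simps)
  then show ?case by blast
qed

text \<open>Orthogonality to all lower degrees instead of pairwise: it survives rescaling and is the
  form that quadrature uses.\<close>

definition orth_poly_seq :: "real measure \<Rightarrow> (nat \<Rightarrow> real poly) \<Rightarrow> bool" where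
  "orth_poly_seq \<mu> f \<longleftrightarrow> (\<forall>n q. degree q < n \<longrightarrow> (\<integral>x. poly q x * poly (f n) x \<partial>\<mu>) = 0)"

lemma orthogonality_measure_orth_poly_seq:
  assumes "orthogonality_measure (rwp a b) \<mu>" "\<And>n. 0 < a n"
  shows "orth_poly_seq \<mu> (rwp a b)"
  unfolding orth_poly_seq_def
proof (intro allI impI)
  fix n and q :: "real poly" assume n: "degree q < n"
  have \<mu>: "sym_prob_measure \<mu>" and o: "\<And>m. m \<noteq> n \<Longrightarrow> (\<integral>x. poly (rwp a b m) x * poly (rwp a b n) x \<partial>\<mu>) = 0"
    using assms(1) by (auto simp: orthogonality_measure_def)
  obtain c where c: "q = (\<Sum>j\<le>degree q. smult (c j) (rwp a b j))"
    using rwp_span[where a=a and b=b and q=q, OF assms(2) order_refl] by blast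
  have int: "integrable \<mu> (\<lambda>x. poly (rwp a b m) x * poly (rwp a b n) x)" for m
    unfolding poly_mult[symmetric] by (rule integrable_poly_sym_prob[OF \<mu>])
  have "(\<integral>x. poly q x * poly (rwp a b n) x \<partial>\<mu>) =
     (\<integral>x. (\<Sum>j\<le>degree q. c j * (poly (rwp a b j) x * poly (rwp a b n) x)) \<partial>\<mu>)"
    by (subst c) (simp add: poly_sum sum_distrib_right mult.assoc)
  also have "\<dots> = (\<Sum>j\<le>degree q. c j * (\<integral>x. poly (rwp a b j) x * poly (rwp a b n) x \<partial>\<mu>))"
    by (subst Bochner_Integration.integral_sum) (auto intro: int)
  also have "\<dots> = 0" using n by (intro sum.neutral) (auto intro: o)
  finally show "(\<integral>x. poly q x * poly (rwp a b n) x \<partial>\<mu>) = 0" .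
qed

lemma orth_poly_seq_smult:
  assumes "orth_poly_seq \<mu> f" "\<And>n. g n = smult (c n) (f n)"
  shows "orth_poly_seq \<mu> g"
  using assms(1) unfolding orth_poly_seq_def assms(2) by (simp add: mult.left_commute)

definition gauss_nodes :: "real poly \<Rightarrow> real set" where
  "gauss_nodes G = {x. poly G x = 0}"

text \<open>The Christoffel number, i.e. the integral of the Lagrange basis polynomial of the
  node.\<close>

definition gauss_weight :: "real measure \<Rightarrow> real poly \<Rightarrow> real \<Rightarrow> real" where
  "gauss_weight \<mu> G x = (\<integral>t. poly (synthetic_div G x) t \<partial>\<mu>) / poly (pderiv G) x"

text \<open>Division by \<open>f (Suc n)\<close> leaves a quotient of degree at most
  \<open>n\<close>, which is orthogonal to the divisor, and a remainder of degree at most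
  \<open>n\<close>, which interpolation at the nodes reproduces exactly.\<close>

lemma gauss_quadrature:
  assumes \<mu>: "sym_prob_measure \<mu>" and o: "orth_poly_seq \<mu> f" and G: "degree (f (Suc n)) = Suc n"
    "card (gauss_nodes (f (Suc n))) = Suc n" "\<And>x. x \<in> gauss_nodes (f (Suc n)) \<Longrightarrow> poly (pderiv (f (Suc n))) x \<noteq> 0"
    and q: "degree q \<le> 2 * n + 1"
  shows "(\<integral>x. poly q x \<partial>\<mu>) = (\<Sum>x\<in>gauss_nodes (f (Suc n)). gauss_weight \<mu> (f (Suc n)) x * poly q x)"
proof -
  let ?G = "f (Suc n)"
  let ?X = "gauss_nodes ?G"
  define r where "r = q mod ?G"
  have Gnz: "?G \<noteq> 0" using G(1) by auto
  have qr: "q = q div ?G * ?G + r" by (simp add: r_def)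
  have "degree (q div ?G) < Suc n"
  proof (cases "q div ?G = 0")
    case False
    have "degree (q div ?G * ?G) = degree (q - r)" by (simp add: qr[symmetric] r_def minus_mod_eq_div_mult)
    also have "\<dots> \<le> 2 * n + 1"
      using q G(1) degree_mod_less[OF Gnz, of q] by (intro degree_diff_le) (auto simp: r_def)
    finally show ?thesis using False Gnz G(1) by (simp add: degree_mult_eq)
  qed simp
  then have o0: "(\<integral>x. poly (q div ?G) x * poly ?G x \<partial>\<mu>) = 0" using o unfolding orth_poly_seq_def by blast
  have rx: "poly r x = poly q x" if "x \<in> ?X" for x
    using arg_cong[OF qr, of "\<lambda>p. poly p x"] that by (simp add: gauss_nodes_def)
  have "degree r < degree ?G"
    using degree_mod_less'[of ?G q] Gnz G(1) by (cases "r = 0") (auto simp: r_def)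
  then have "r = (\<Sum>y\<in>?X. smult (poly r y / poly (pderiv ?G) y) (synthetic_div ?G y))"
    using G by (intro lagrange_interpolation) (auto simp: gauss_nodes_def)
  then have "(\<integral>x. poly r x \<partial>\<mu>) = (\<integral>x. poly (\<Sum>y\<in>?X. smult (poly r y / poly (pderiv ?G) y) (synthetic_div ?G y)) x \<partial>\<mu>)"
    by (rule arg_cong)
  also have "\<dots> = (\<Sum>y\<in>?X. poly r y / poly (pderiv ?G) y * (\<integral>x. poly (synthetic_div ?G y) x \<partial>\<mu>))"
    by (simp add: poly_sum Bochner_Integration.integral_sum integrable_poly_sym_prob[OF \<mu>])
  also have "\<dots> = (\<Sum>y\<in>?X. gauss_weight \<mu> ?G y * poly q y)"
    by (intro sum.cong refl) (simp add: gauss_weight_def rx)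
  finally have r: "(\<integral>x. poly r x \<partial>\<mu>) = (\<Sum>y\<in>?X. gauss_weight \<mu> ?G y * poly q y)" .
  have "(\<integral>x. poly q x \<partial>\<mu>) = (\<integral>x. poly (q div ?G * ?G) x + poly r x \<partial>\<mu>)"
    by (intro Bochner_Integration.integral_cong refl) (metis poly_add qr)
  also have "\<dots> = (\<integral>x. poly (q div ?G * ?G) x \<partial>\<mu>) + (\<integral>x. poly r x \<partial>\<mu>)"
    by (intro Bochner_Integration.integral_add integrable_poly_sym_prob[OF \<mu>])
  also have "\<dots> = (\<Sum>y\<in>?X. gauss_weight \<mu> ?G y * poly q y)" using o0 r by simp
  finally show ?thesis .
qed

text \<open>The square of \<open>synthetic_div\<close> has degree \<open>2 n\<close>, so it is
  integrated exactly, and it vanishes at all nodes but one.\<close>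

lemma gauss_weight_nonneg:
  assumes \<mu>: "sym_prob_measure \<mu>" and o: "orth_poly_seq \<mu> f" and G: "degree (f (Suc n)) = Suc n"
    "card (gauss_nodes (f (Suc n))) = Suc n" "\<And>x. x \<in> gauss_nodes (f (Suc n)) \<Longrightarrow> poly (pderiv (f (Suc n))) x \<noteq> 0"
    and x: "x \<in> gauss_nodes (f (Suc n))"
  shows "0 \<le> gauss_weight \<mu> (f (Suc n)) x"
proof -
  let ?G = "f (Suc n)"
  let ?X = "gauss_nodes ?G"
  let ?L = "synthetic_div ?G x"
  have fin: "finite ?X" using G(2) by (intro card_ge_0_finite) simp
  have root: "poly ?G x = 0" using x by (simp add: gauss_nodes_def)
  have "degree (?L * ?L) \<le> 2 * n + 1"
    using degree_mult_le[of ?L ?L] G(1) by (simp add: degree_synthetic_div)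
  from gauss_quadrature[OF \<mu> o G this]
  have "(\<integral>t. poly (?L * ?L) t \<partial>\<mu>) = (\<Sum>y\<in>?X. gauss_weight \<mu> ?G y * poly (?L * ?L) y)" .
  also have "\<dots> = gauss_weight \<mu> ?G x * poly (?L * ?L) x"
  proof -
    have "poly ?L y = 0" if "y \<in> ?X - {x}" for y
      using synthetic_div_root(1)[OF root, of y] that by (auto simp: gauss_nodes_def)
    then show ?thesis by (subst sum.remove[OF fin x]) (simp add: sum.neutral)
  qed
  also have "\<dots> = gauss_weight \<mu> ?G x * (poly (pderiv ?G) x)\<^sup>2"
    using synthetic_div_root(2)[OF root] by (simp add: power2_eq_square)
  finally have "0 \<le> gauss_weight \<mu> ?G x * (poly (pderiv ?G) x)\<^sup>2"
    by (metis integral_nonneg_AE AE_I2 poly_mult zero_le_square)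
  then show ?thesis using G(3)[OF x] by (simp add: zero_le_mult_iff)
qed

text \<open>Nonnegative weights with sum 1 make the quadrature a contraction in the uniform norm; on
  an approximating polynomial of degree at most \<open>m\<close> it is exact from
  \<open>n = m\<close> on.\<close>

lemma gauss_convergence:
  fixes h :: "real \<Rightarrow> real"
  assumes \<mu>: "sym_prob_measure \<mu>" and o: "orth_poly_seq \<mu> f" and G: "\<And>n. degree (f (Suc n)) = Suc n"
    "\<And>n. card (gauss_nodes (f (Suc n))) = Suc n"
    "\<And>n x. x \<in> gauss_nodes (f (Suc n)) \<Longrightarrow> poly (pderiv (f (Suc n))) x \<noteq> 0 \<and> \<bar>x\<bar> < 1"
    and h: "h \<in> borel_measurable borel" "continuous_on {-1..1} h"
  shows "(\<lambda>n. \<Sum>x\<in>gauss_nodes (f (Suc n)). gauss_weight \<mu> (f (Suc n)) x * h x) \<longlonglongrightarrow> (\<integral>x. h x \<partial>\<mu>)"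
proof (rule LIMSEQ_I)
  fix e :: real assume e: "0 < e"
  interpret prob_space \<mu> by (rule sym_prob_measureD[OF \<mu>])
  obtain g where g: "real_polynomial_function g" "\<And>x. x \<in> {-1..1} \<Longrightarrow> \<bar>h x - g x\<bar> < e / 3"
    using Stone_Weierstrass_real_polynomial_function[of "{-1..1}" h "e/3"] h e by auto
  obtain a m where am: "g = (\<lambda>x. \<Sum>i\<le>m. a i * x ^ i)" using real_polynomial_function_imp_sum[OF g(1)] by blast
  define q where "q = (\<Sum>i\<le>m. monom (a i) i)"
  have gq: "g = poly q" by (auto simp: am q_def poly_sum poly_monom)
  have "degree q \<le> m" unfolding q_def
    by (intro degree_sum_le) (auto intro: degree_monom_le[THEN order_trans])
  note G' = G(1) G(2) G(3)[THEN conjunct1]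
  show "\<exists>no. \<forall>n\<ge>no. norm ((\<Sum>x\<in>gauss_nodes (f (Suc n)). gauss_weight \<mu> (f (Suc n)) x * h x) - (\<integral>x. h x \<partial>\<mu>)) < e"
  proof (intro exI allI impI)
    fix n assume n: "m \<le> n"
    let ?X = "gauss_nodes (f (Suc n))"
    let ?w = "gauss_weight \<mu> (f (Suc n))"
    have w0: "0 \<le> ?w x" if "x \<in> ?X" for x by (rule gauss_weight_nonneg[OF \<mu> o G' that])
    have "(\<integral>x. poly 1 x \<partial>\<mu>) = (\<Sum>x\<in>?X. ?w x * poly 1 x)" by (rule gauss_quadrature[OF \<mu> o G']) auto
    then have w1: "(\<Sum>x\<in>?X. ?w x) = 1" by (simp add: prob_space)
    have q: "(\<integral>x. poly q x \<partial>\<mu>) = (\<Sum>x\<in>?X. ?w x * poly q x)"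
      by (rule gauss_quadrature[OF \<mu> o G']) (use n \<open>degree q \<le> m\<close> in auto)
    have "\<bar>(\<Sum>x\<in>?X. ?w x * h x) - (\<Sum>x\<in>?X. ?w x * poly q x)\<bar> = \<bar>\<Sum>x\<in>?X. ?w x * (h x - g x)\<bar>"
      by (simp add: gq sum_subtractf algebra_simps)
    also have "\<dots> \<le> (\<Sum>x\<in>?X. ?w x * \<bar>h x - g x\<bar>)"
      by (rule order_trans[OF sum_abs]) (auto intro!: sum_mono simp: abs_mult w0)
    also have "\<dots> \<le> (\<Sum>x\<in>?X. ?w x * (e / 3))"
      using g(2) G(3) w0 by (intro sum_mono mult_left_mono) (auto simp: abs_less_iff less_imp_le)
    also have "\<dots> = e / 3" using w1 by (metis mult_1 sum_distrib_right)
    finally have 1: "\<bar>(\<Sum>x\<in>?X. ?w x * h x) - (\<Sum>x\<in>?X. ?w x * poly q x)\<bar> \<le> e / 3" .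
    have inth: "integrable \<mu> h" by (rule integrable_continuous_sym_prob[OF \<mu> h])
    have intq: "integrable \<mu> (poly q)" by (rule integrable_poly_sym_prob[OF \<mu>])
    have "\<bar>(\<integral>x. h x \<partial>\<mu>) - (\<integral>x. poly q x \<partial>\<mu>)\<bar> = \<bar>\<integral>x. h x - poly q x \<partial>\<mu>\<bar>"
      using inth intq by simp
    also have "\<dots> \<le> (\<integral>x. \<bar>h x - poly q x\<bar> \<partial>\<mu>)" by (rule integral_abs_bound)
    also have "\<dots> \<le> (\<integral>x. e / 3 \<partial>\<mu>)"
    proof (rule integral_mono_AE)
      show "AE x in \<mu>. \<bar>h x - poly q x\<bar> \<le> e / 3"
        using sym_prob_measureD(3)[OF \<mu>] by eventually_elim (use g(2) gq in \<open>auto intro: less_imp_le\<close>)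
    qed (use inth intq in auto)
    also have "\<dots> = e / 3" by (simp add: prob_space)
    finally have 2: "\<bar>(\<integral>x. h x \<partial>\<mu>) - (\<integral>x. poly q x \<partial>\<mu>)\<bar> \<le> e / 3" .
    show "norm ((\<Sum>x\<in>?X. ?w x * h x) - (\<integral>x. h x \<partial>\<mu>)) < e"
      using 1 2 e unfolding q real_norm_def by linarith
  qed
qed

text \<open>The sums \<open>\<Phi> j\<close> are the functions of the second kind of the quadrature
  measure. They satisfy the recurrence of \<open>g\<close>, with an inhomogeneous term only at
  \<open>j = 0\<close>, and vanish at \<open>j = n + 1\<close>, so ratios of neighbours are finite
  tails of the continued fraction.\<close>

lemma cfrac_gauss:
  fixes p :: "nat \<Rightarrow> real"
  defines "g \<equiv> rwp (\<lambda>n. 1 - p n) p"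
  assumes p: "rwc (\<lambda>n. 1 - p n) p" "p 0 = 0" and \<mu>: "sym_prob_measure \<mu>" and o: "orth_poly_seq \<mu> g"
    and z: "z \<notin> complex_of_real ` {-1..1}"
  shows "cfrac (\<lambda>i. (1 - p i) * p (Suc i)) n z =
    (\<Sum>x\<in>gauss_nodes (g (Suc n)). of_real (gauss_weight \<mu> (g (Suc n)) x) / (z - of_real x))"
proof -
  interpret prob_space \<mu> by (rule sym_prob_measureD[OF \<mu>])
  let ?X = "gauss_nodes (g (Suc n))"
  let ?w = "gauss_weight \<mu> (g (Suc n))"
  have G: "degree (g (Suc n)) = Suc n" "card ?X = Suc n" "\<And>x. x \<in> ?X \<Longrightarrow> poly (pderiv (g (Suc n))) x \<noteq> 0"
    unfolding g_def gauss_nodes_def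
    using degree_rwp[OF rwcD(1)[OF p(1)]] card_rwp_roots[OF p(1)] rwp_pderiv_nz[OF p(1)] by auto
  have zx: "z - of_real x \<noteq> 0" if "x \<in> ?X" for x
  proof -
    have "\<bar>x\<bar> < 1" using that rwp_root_abs_less_1[OF p(1)] by (auto simp: gauss_nodes_def g_def)
    then have "x \<in> {-1..1}" by auto
    then show ?thesis using z by (metis eq_iff_diff_eq_0 imageI)
  qed
  define \<Phi> where "\<Phi> j = (\<Sum>x\<in>?X. of_real (?w x * poly (g j) x) / (z - of_real x))" for j
  \<comment> \<open>By exactness of the quadrature the discrete mean of \<open>g j\<close> is its
    integral, which orthogonality to constants makes zero for \<open>j > 0\<close>.\<close>
  have mean: "(\<Sum>x\<in>?X. ?w x * poly (g j) x) = (if j = 0 then 1 else 0)" if "j \<le> n" for j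
  proof -
    have "degree (g j) \<le> 2 * n + 1"
      unfolding g_def using that by (subst degree_rwp[OF rwcD(1)[OF p(1)]]) simp
    then have "(\<Sum>x\<in>?X. ?w x * poly (g j) x) = (\<integral>x. poly (g j) x \<partial>\<mu>)"
      using gauss_quadrature[OF \<mu> o G] by simp
    also have "\<dots> = (if j = 0 then 1 else 0)"
    proof (cases "j = 0")
      case False
      then have "(\<integral>x. poly 1 x * poly (g j) x \<partial>\<mu>) = 0"
        using o[unfolded orth_poly_seq_def, rule_format, of 1 j] by simp
      then show ?thesis using False by simp
    qed (simp add: g_def prob_space)
    finally show ?thesis .
  qed
  have z\<Phi>: "z * \<Phi> j = of_real (if j = 0 then 1 else 0) + (\<Sum>x\<in>?X. of_real (?w x * (x * poly (g j) x)) / (z - of_real x))"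
    if "j \<le> n" for j
  proof -
    have "z * \<Phi> j = (\<Sum>x\<in>?X. of_real (?w x * poly (g j) x) + of_real (?w x * (x * poly (g j) x)) / (z - of_real x))"
      unfolding \<Phi>_def sum_distrib_left using zx by (intro sum.cong refl) (simp add: field_simps)
    also have "\<dots> = of_real (\<Sum>x\<in>?X. ?w x * poly (g j) x) + (\<Sum>x\<in>?X. of_real (?w x * (x * poly (g j) x)) / (z - of_real x))"
      by (simp add: sum.distrib)
    finally show ?thesis unfolding mean[OF that] .
  qed
  have rec0: "z * \<Phi> 0 = 1 + \<Phi> 1"
    using z\<Phi>[of 0] p(2) by (simp add: \<Phi>_def g_def)
  have rec: "z * \<Phi> (Suc j) = of_real (1 - p (Suc j)) * \<Phi> (Suc (Suc j)) + of_real (p (Suc j)) * \<Phi> j" if "Suc j \<le> n" for j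
  proof -
    have r: "x * poly (g (Suc j)) x = (1 - p (Suc j)) * poly (g (Suc (Suc j))) x + p (Suc j) * poly (g j) x" for x
      using rwp_chain_rec[OF p(1), of j x] unfolding g_def by simp
    have "z * \<Phi> (Suc j) = (\<Sum>x\<in>?X. of_real (1 - p (Suc j)) * (of_real (?w x * poly (g (Suc (Suc j))) x) / (z - of_real x))
        + of_real (p (Suc j)) * (of_real (?w x * poly (g j) x) / (z - of_real x)))"
      unfolding z\<Phi>[OF that] r by (auto intro!: sum.cong simp: algebra_simps add_divide_distrib diff_divide_distrib)
    then show ?thesis unfolding \<Phi>_def by (simp only: sum.distrib sum_distrib_left)
  qed
  have last: "\<Phi> (Suc n) = 0" unfolding \<Phi>_def by (intro sum.neutral) (simp add: gauss_nodes_def)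
  have nz: "z - of_real ((1 - p j) * p (Suc j)) * cfrac (\<lambda>i. (1 - p (i + Suc j)) * p (Suc (i + Suc j))) m z \<noteq> 0" for j m
    using cfrac_denominator_nz[of "\<lambda>i. p (i + j)" z m] z rwcD(1,3)[OF p(1)] by (simp add: less_imp_le)
  have tail: "\<Phi> (Suc j) = of_real (p (Suc j)) * \<Phi> j * cfrac (\<lambda>i. (1 - p (i + Suc j)) * p (Suc (i + Suc j))) m z"
    if "Suc j + m = n" for j m
    using that
  proof (induction m arbitrary: j)
    case 0
    then have "z * \<Phi> (Suc j) = of_real (p (Suc j)) * \<Phi> j" using rec[of j] last by auto
    then show ?case using outside_interval(1)[OF z] by (simp add: field_simps)
  next
    case (Suc m)
    define C where "C = cfrac (\<lambda>i. (1 - p (i + Suc (Suc j))) * p (Suc (i + Suc (Suc j)))) m z"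
    define d where "d = z - of_real ((1 - p (Suc j)) * p (Suc (Suc j))) * C"
    have d: "d \<noteq> 0" using nz[of "Suc j" m] by (simp add: d_def C_def)
    have "\<Phi> (Suc (Suc j)) = of_real (p (Suc (Suc j))) * \<Phi> (Suc j) * C"
      unfolding C_def using Suc.prems by (intro Suc.IH) simp
    then have e: "\<Phi> (Suc j) * d = of_real (p (Suc j)) * \<Phi> j"
      using rec[of j] Suc.prems by (simp add: d_def algebra_simps)
    have c: "cfrac (\<lambda>i. (1 - p (i + Suc j)) * p (Suc (i + Suc j))) (Suc m) z = 1 / d"
      by (simp add: d_def C_def)
    show ?case unfolding c e[symmetric] using d by simp
  qed
  have "\<Phi> 0 = cfrac (\<lambda>i. (1 - p i) * p (Suc i)) n z"
  proof (cases n)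
    case 0
    then show ?thesis using rec0 last outside_interval(1)[OF z] by (simp add: field_simps)
  next
    case (Suc m)
    define C where "C = cfrac (\<lambda>i. (1 - p (Suc i)) * p (Suc (Suc i))) m z"
    have "z - of_real (p (Suc 0)) * C \<noteq> 0" using nz[of 0 m] p(2) by (simp add: C_def)
    moreover have "\<Phi> 1 = of_real (p (Suc 0)) * \<Phi> 0 * C" using tail[of 0 m] Suc by (simp add: C_def)
    then have "\<Phi> 0 * (z - of_real (p (Suc 0)) * C) = 1" using rec0 by (simp add: algebra_simps)
    ultimately show ?thesis using p(2) Suc by (simp add: C_def field_simps)
  qed
  then show ?thesis by (simp add: \<Phi>_def g_def)
qed

text \<open>The approximants are Gauss sums of the Cauchy kernel, which is continuous on [-1, 1] for
  \<open>z\<close> outside. Convergence of the sums is known for real functions, hence the detour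
  through a real linear functional, taken to be \<open>Re\<close> and \<open>Im\<close>.\<close>

theorem markov_stieltjes_params:
  assumes p: "rwc (\<lambda>n. 1 - p n) p" "p 0 = 0" and \<mu>: "sym_prob_measure \<mu>"
    and o: "orth_poly_seq \<mu> (rwp (\<lambda>n. 1 - p n) p)"
  shows "stieltjes_params \<mu> p"
  unfolding stieltjes_params_def
proof (intro conjI allI impI)
  fix z assume z: "z \<notin> complex_of_real ` {-1..1}"
  let ?g = "rwp (\<lambda>n. 1 - p n) p :: nat \<Rightarrow> real poly"
  have cont: "continuous_on {-1..1} (\<lambda>x. 1 / (z - complex_of_real x))"
    using z by (intro continuous_intros) auto
  have int: "integrable \<mu> (\<lambda>x. 1 / (z - complex_of_real x))"
    by (rule integrable_continuous_sym_prob[OF \<mu> measurable_cauchy_kernel cont])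
  have conv: "(\<lambda>n. \<Sum>x\<in>gauss_nodes (?g (Suc n)). gauss_weight \<mu> (?g (Suc n)) x * h x) \<longlonglongrightarrow> (\<integral>x. h x \<partial>\<mu>)"
    if "h \<in> borel_measurable borel" "continuous_on {-1..1} h" for h
  proof (rule gauss_convergence[OF \<mu> o _ _ _ that])
    fix n
    show "degree (?g (Suc n)) = Suc n" by (rule degree_rwp[OF rwcD(1)[OF p(1)]])
    show "card (gauss_nodes (?g (Suc n))) = Suc n" unfolding gauss_nodes_def by (rule card_rwp_roots[OF p(1)])
    show "poly (pderiv (?g (Suc n))) x \<noteq> 0 \<and> \<bar>x\<bar> < 1" if "x \<in> gauss_nodes (?g (Suc n))" for x
      using that rwp_pderiv_nz[OF p(1)] rwp_root_abs_less_1[OF p(1)] unfolding gauss_nodes_def by blast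
  qed
  have part: "(\<lambda>n. \<phi> (cfrac (\<lambda>i. (1 - p i) * p (Suc i)) n z)) \<longlonglongrightarrow> \<phi> (stieltjes \<mu> z)"
    if \<phi>: "bounded_linear \<phi>" "\<phi> \<in> borel_measurable borel" for \<phi> :: "complex \<Rightarrow> real"
  proof -
    interpret \<phi>: bounded_linear \<phi> by fact
    have [measurable]: "\<phi> \<in> borel_measurable borel" by fact
    have "(\<lambda>n. \<Sum>x\<in>gauss_nodes (?g (Suc n)). gauss_weight \<mu> (?g (Suc n)) x * \<phi> (1 / (z - complex_of_real x)))
      \<longlonglongrightarrow> (\<integral>x. \<phi> (1 / (z - complex_of_real x)) \<partial>\<mu>)"
      by (intro conv \<phi>.continuous_on cont) measurable
    moreover have "\<phi> (of_real w / v) = w * \<phi> (1 / v)" for w v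
      using \<phi>.scaleR[of w "1 / v"] by (simp add: scaleR_conv_of_real)
    ultimately show ?thesis
      unfolding cfrac_gauss[OF p \<mu> o z] stieltjes_def integral_bounded_linear[OF \<phi>(1) int, symmetric] by (simp add: \<phi>.sum)
  qed
  show "(\<lambda>n. cfrac (\<lambda>i. (1 - p i) * p (Suc i)) n z) \<longlonglongrightarrow> stieltjes \<mu> z"
    unfolding tendsto_complex_iff by (intro conjI part bounded_linear_Re bounded_linear_Im) measurable
qed (use p rwcD(1,3)[OF p(1)] in \<open>auto simp: less_imp_le\<close>)

lemma stieltjes_params_canon:
  assumes "orthogonality_measure (rwp a b) \<mu>" "rwc a b"
  shows "stieltjes_params \<mu> (canon a b)"
proof (rule markov_stieltjes_params[OF rwc_canon[OF assms(2)] canon_0])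
  show "sym_prob_measure \<mu>" using assms(1) by (simp add: orthogonality_measure_def)
  show "orth_poly_seq \<mu> (rwp (\<lambda>n. 1 - canon a b n) (canon a b))"
    using orthogonality_measure_orth_poly_seq[OF assms(1) rwcD(1)[OF assms(2)]] rwp_canon[OF assms(2)]
    by (rule orth_poly_seq_smult)
qed

section \<open>Sieving\<close>

text \<open>\<open>cheb_V n\<close> is \<open>U_(n-1)\<close> with \<open>U_(-1) = 0\<close>: the
  shift gives \<open>sin t * V n (cos t) = sin (n t)\<close> and lets recurrences inside a block run
  down to index 0.\<close>

definition cheb_V :: "nat \<Rightarrow> real poly" where
  "cheb_V n = (case n of 0 \<Rightarrow> 0 | Suc m \<Rightarrow> cheb_U m)"

lemma cheb_V_simps [simp]:
  "cheb_V 0 = 0" "cheb_V (Suc 0) = 1"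
  "cheb_V (Suc (Suc n)) = [:0, 2:] * cheb_V (Suc n) - cheb_V n"
  by (simp_all add: cheb_V_def split: nat.split)

lemma cheb_V_Suc: "cheb_V (Suc n) = cheb_U n"
  by (simp add: cheb_V_def)

lemma cheb_T_conv_V: "cheb_T (Suc n) = [:0, 1:] * cheb_V (Suc n) - cheb_V n"
proof (induction n rule: induct_nat_012)
  case (ge2 n)
  have "[:0, 2:] * cheb_T (Suc (Suc n)) - cheb_T (Suc n) =
    [:0, 1:] * ([:0, 2:] * cheb_V (Suc (Suc n)) - cheb_V (Suc n)) - ([:0, 2:] * cheb_V (Suc n) - cheb_V n)"
    unfolding ge2 by (simp only: algebra_simps)
  then show ?case by (simp only: cheb_T.simps cheb_V_simps)
qed simp_all

lemma poly_cheb_V_rec: "poly (cheb_V (Suc (Suc n))) x = 2 * x * poly (cheb_V (Suc n)) x - poly (cheb_V n) x"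
  by simp

lemma poly_cheb_T_conv_V: "poly (cheb_T (Suc n)) x = x * poly (cheb_V (Suc n)) x - poly (cheb_V n) x"
  unfolding cheb_T_conv_V by simp

text \<open>This quadratic form in two neighbours is preserved by a step of the recurrence; with
  \<open>cheb_T\<close> expressed by \<open>cheb_V\<close> it becomes the Pell identity.\<close>

lemma cheb_V_quadratic:
  "(poly (cheb_V (Suc n)) x)\<^sup>2 - 2 * x * poly (cheb_V n) x * poly (cheb_V (Suc n)) x + (poly (cheb_V n) x)\<^sup>2 = 1"
proof (induction n)
  case (Suc n)
  then show ?case unfolding poly_cheb_V_rec by (simp add: power2_eq_square algebra_simps del: cheb_V_simps)
qed simp

lemma cheb_pell: "(1 - x\<^sup>2) * (poly (cheb_V n) x)\<^sup>2 + (poly (cheb_T n) x)\<^sup>2 = 1"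
proof (cases n)
  case (Suc m)
  show ?thesis unfolding Suc poly_cheb_T_conv_V using cheb_V_quadratic[of m x]
    by (simp add: power2_eq_square algebra_simps del: cheb_V_simps)
qed simp

lemma pderiv_cheb_T: "poly (pderiv (cheb_T n)) x = real n * poly (cheb_V n) x"
proof (induction n rule: induct_nat_012)
  case (ge2 n)
  have "poly (pderiv (cheb_T (Suc (Suc n)))) x =
    2 * poly (cheb_T (Suc n)) x + 2 * x * poly (pderiv (cheb_T (Suc n))) x - poly (pderiv (cheb_T n)) x"
    by (simp add: pderiv_mult pderiv_diff pderiv_pCons pderiv_smult)
  also have "\<dots> = real (Suc (Suc n)) * (2 * x * poly (cheb_V (Suc n)) x - poly (cheb_V n) x)"
    unfolding ge2 poly_cheb_T_conv_V by (simp add: algebra_simps del: cheb_V_simps)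
  finally show ?case unfolding poly_cheb_V_rec .
qed (simp_all add: pderiv_pCons)

text \<open>Viewed as random walk polynomials, the Chebyshev polynomials inherit their degree and
  parity from \<open>rwp\<close>.\<close>

lemma cheb_T_eq_rwp: "cheb_T n = rwp (\<lambda>n. if n = 0 then 1 else 1 / 2) (\<lambda>_. 1 / 2) n"
proof (induction n rule: induct_nat_012)
  case (ge2 n)
  then show ?case by (simp add: rwp.simps(3) smult_diff_right flip: smult_add_left)
qed simp_all

lemma cheb_U_eq_rwp: "cheb_U n = rwp (\<lambda>_. 1 / 2) (\<lambda>_. 1 / 2) n"
proof (induction n rule: induct_nat_012)
  case (ge2 n)
  then show ?case by (simp add: rwp.simps(3) smult_diff_right flip: smult_add_left)
qed simp_all

lemma degree_cheb_T: "degree (cheb_T n) = n"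
  unfolding cheb_T_eq_rwp by (rule degree_rwp) simp

lemma degree_cheb_U: "degree (cheb_U n) = n"
  unfolding cheb_U_eq_rwp by (rule degree_rwp) simp

lemma cheb_U_nz: "cheb_U n \<noteq> 0"
  unfolding cheb_U_eq_rwp by (rule rwp_nz) simp

lemma cheb_T_cos: "poly (cheb_T n) (cos t) = cos (real n * t)"
proof (induction n rule: induct_nat_012)
  case (ge2 n)
  have "cos (real (Suc (Suc n)) * t) + cos (real n * t) = 2 * cos t * cos (real (Suc n) * t)"
    using cos_add[of "real (Suc n) * t" t] cos_diff[of "real (Suc n) * t" t]
    by (simp add: algebra_simps)
  then show ?case using ge2 by simp
qed simp_all

lemma cheb_V_cos: "sin t * poly (cheb_V n) (cos t) = sin (real n * t)"
proof (induction n rule: induct_nat_012)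
  case (ge2 n)
  have "sin (real (Suc (Suc n)) * t) + sin (real n * t) = 2 * cos t * sin (real (Suc n) * t)"
    using sin_add[of "real (Suc n) * t" t] sin_diff[of "real (Suc n) * t" t]
    by (simp add: algebra_simps)
  moreover have "sin t * poly (cheb_V (Suc (Suc n))) (cos t) =
    2 * cos t * (sin t * poly (cheb_V (Suc n)) (cos t)) - sin t * poly (cheb_V n) (cos t)"
    unfolding poly_cheb_V_rec by (simp add: algebra_simps del: cheb_V_simps)
  ultimately show ?case unfolding ge2 by linarith
qed simp_all

lemma cheb_T_surj:
  assumes "0 < k" "\<bar>t\<bar> \<le> 1"
  shows "\<exists>x. \<bar>x\<bar> \<le> 1 \<and> poly (cheb_T k) x = t"
proof -
  have "poly (cheb_T k) (cos (arccos t / real k)) = t"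
    unfolding cheb_T_cos using assms by (simp add: cos_arccos_abs)
  then show ?thesis using abs_cos_le_one by blast
qed

text \<open>Obtained by differentiating the Pell identity and cancelling \<open>cheb_V k\<close>.\<close>

lemma pderiv_cheb_V_root:
  assumes "poly (cheb_V k) x = 0" "0 < k"
  shows "(1 - x\<^sup>2) * poly (pderiv (cheb_V k)) x = - real k * poly (cheb_T k) x"
proof -
  let ?V = "cheb_V k" and ?T = "cheb_T k"
  have "[:1, 0, -1:] * (?V * ?V) + ?T * ?T = 1"
    by (rule poly_ext) (use cheb_pell[of _ k] in \<open>simp add: power2_eq_square algebra_simps\<close>)
  then have d: "pderiv ([:1, 0, -1:] * (?V * ?V) + ?T * ?T) = pderiv 1" by (rule arg_cong)
  have T': "pderiv ?T = smult (real k) ?V"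
    by (rule poly_ext) (simp add: pderiv_cheb_T)
  have "?V * (smult 2 ([:1, 0, -1:] * pderiv ?V - [:0, 1:] * ?V + smult (real k) ?T)) = 0"
  proof (rule poly_ext)
    fix y
    have "poly (pderiv ([:1, 0, -1:] * (?V * ?V) + ?T * ?T)) y = 0" unfolding d by simp
    then show "poly (?V * (smult 2 ([:1, 0, -1:] * pderiv ?V - [:0, 1:] * ?V + smult (real k) ?T))) y = poly 0 y"
      unfolding pderiv_add pderiv_mult T' by (simp add: pderiv_pCons algebra_simps)
  qed
  moreover have "?V \<noteq> 0" using cheb_U_nz[of "k - 1"] cheb_V_Suc[of "k - 1"] assms(2) by simp
  ultimately have "smult 2 ([:1, 0, -1:] * pderiv ?V - [:0, 1:] * ?V + smult (real k) ?T) = 0" by simp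
  then have "poly (smult 2 ([:1, 0, -1:] * pderiv ?V - [:0, 1:] * ?V + smult (real k) ?T)) x = 0"
    by (metis poly_0)
  then show ?thesis using assms(1) by (simp add: power2_eq_square algebra_simps)
qed

section \<open>Factorization of the sieved polynomials through \<open>T_k\<close>\<close>

lemma rwc_sieve: "rw_coeffs A B \<Longrightarrow> rwc (sieve k A) (sieve k B)"
  unfolding rw_coeffs_def rwc_def by (auto simp: sieve_def less_imp_le)

lemma sieved_rw_poly_eq_rwp:
  assumes "2 \<le> k"
  shows "sieved_rw_poly k A B n = rwp (sieve k A) (sieve k B) n"
proof (induction n rule: induct_nat_012)
  case 1
  have "\<not> k dvd Suc 0" using assms by auto
  then show ?case by (simp add: sieve_def)
next
  case (ge2 n)
  then show ?case by (simp add: rwp.simps(3))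
qed simp_all

lemma poly_sieved_rwp_half:
  assumes "\<not> k dvd Suc (Suc n)"
  shows "poly (rwp (sieve k A) (sieve k B) (Suc (Suc n))) (x::real) =
    2 * x * poly (rwp (sieve k A) (sieve k B) (Suc n)) x - poly (rwp (sieve k A) (sieve k B) n) x"
  using assms by (simp add: rwp.simps(3) sieve_def algebra_simps)

text \<open>The two terms come from the Chebyshev recurrence inside a block; the block boundaries at
  the indices \<open>n k - 1\<close> turn into the recurrence of \<open>rwp A B\<close> in the variable \<open>T\<^sub>k\<close>.\<close>

lemma poly_sieved_rwp:
  fixes x :: real
  assumes k: "2 \<le> k" and A: "\<And>n. 0 < A n" "\<And>n. A n + B n = 1" and j: "j < k"
  defines "s \<equiv> \<lambda>n. poly (rwp (sieve k A) (sieve k B) n) x"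
    and "r \<equiv> \<lambda>n. poly (rwp A B n) (poly (cheb_T k) x)" and "V \<equiv> \<lambda>n. poly (cheb_V n) x"
  shows "s (n * k + j) = V (Suc j) * r n + V (k - 1 - j) * (if n = 0 then 0 else r (n - 1))"
proof -
  \<comment> \<open>\<open>R n\<close> is \<open>r (n - 1)\<close> with the convention
    \<open>r (-1) = 0\<close>, under which the recurrence of \<open>r\<close> holds at
    \<open>n = 0\<close> as well.\<close>
  define R where "R n = (if n = 0 then 0 else r (n - 1))" for n
  have Vrec: "V (Suc (Suc i)) = 2 * x * V (Suc i) - V i" for i by (simp add: V_def)
  have half: "s (Suc (Suc i)) = 2 * x * s (Suc i) - s i" if "\<not> k dvd Suc (Suc i)" for i
    unfolding s_def by (rule poly_sieved_rwp_half[OF that])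
  have rrec: "poly (cheb_T k) x * r n = A n * r (Suc n) + B n * R n" for n
    using A(1)[of 0] poly_rwp_rec[of A "n - 1" "poly (cheb_T k) x" B] A(1)[of n]
    by (cases n) (auto simp: r_def R_def)
  have block: "\<forall>j<k. s (n * k + j) = V (Suc j) * r n + V (k - 1 - j) * R n"
    if 0: "s (n * k) = r n + V (k - 1) * R n"
      and 1: "s (Suc (n * k)) = 2 * x * r n + V (k - 2) * R n" for n
  proof (intro allI impI)
    fix j assume "j < k"
    then show "s (n * k + j) = V (Suc j) * r n + V (k - 1 - j) * R n"
    proof (induction j rule: induct_nat_012)
      case 0
      then show ?case using that(1) by (simp add: V_def)
    next
      case 1
      then show ?case using that(2) by (simp add: V_def numeral_2_eq_2)
    next
      case (ge2 j)
      have "\<not> k dvd Suc (Suc (n * k + j))"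
        using ge2.prems k by (metis add_Suc_right dvd_add_right_iff dvd_triv_right nat_dvd_not_less zero_less_Suc)
      from half[OF this] have "s (n * k + Suc (Suc j)) = 2 * x * s (n * k + Suc j) - s (n * k + j)" by simp
      also have "\<dots> = (2 * x * V (Suc (Suc j)) - V (Suc j)) * r n + (2 * x * V (k - 1 - Suc j) - V (k - 1 - j)) * R n"
        using ge2 by (simp add: algebra_simps)
      also have "2 * x * V (Suc (Suc j)) - V (Suc j) = V (Suc (Suc (Suc j)))" using Vrec by simp
      also have "2 * x * V (k - 1 - Suc j) - V (k - 1 - j) = V (k - 1 - Suc (Suc j))"
      proof -
        define i where "i = k - 1 - Suc (Suc j)"
        have "k - 1 - Suc j = Suc i" "k - 1 - j = Suc (Suc i)" using ge2.prems by (auto simp: i_def)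
        then show ?thesis using Vrec[of i] unfolding i_def[symmetric] by simp
      qed
      finally show ?case .
    qed
  qed
  have "\<forall>j<k. s (n * k + j) = V (Suc j) * r n + V (k - 1 - j) * R n"
  proof (induction n)
    case 0
    have "\<not> k dvd Suc 0" using k by auto
    then show ?case using k by (intro block) (auto simp: s_def r_def R_def sieve_def)
  next
    case (Suc n)
    \<comment> \<open>\<open>Suc N = (n + 1) k - 1\<close> is the one index of the block at which
      the sieved coefficients are \<open>A n\<close> and \<open>B n\<close>.\<close>
    define N where "N = n * k + (k - 2)"
    have N: "Suc n * k = Suc (Suc N)" "Suc N = n * k + (k - 1)" using k by (auto simp: N_def)
    have V0: "V 0 = 0" "V (Suc 0) = 1" by (simp_all add: V_def)
    have s1: "s (Suc N) = V k * r n"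
      using Suc[rule_format, of "k - 1"] k N V0 by simp
    have "Suc (k - 2) = k - 1" "k - 1 - (k - 2) = Suc 0" using k by auto
    then have s0: "s N = V (k - 1) * r n + R n"
      using Suc[rule_format, of "k - 2"] k V0 unfolding N_def by simp
    have sv: "sieve k C (Suc N) = C n" for C
      using k N by (simp add: sieve_def flip: N(1))
    have *: "x * s (Suc N) = A n * s (Suc (Suc N)) + B n * s N"
      using poly_rwp_rec[of "sieve k A" N x "sieve k B"] A(1)[of n] unfolding s_def sv by simp
    have T: "poly (cheb_T k) x = x * V k - V (k - 1)"
      using poly_cheb_T_conv_V[of "k - 1" x] k by (simp add: V_def)
    \<comment> \<open>Since \<open>T_k = x V k - V (k-1)\<close>, crossing the boundary performs one
      step of the recurrence of \<open>r\<close> at \<open>T_k(x)\<close>;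
      \<open>A n + B n = 1\<close> collects the multiples of \<open>V (k-1) r n\<close>.\<close>
    have "A n * s (Suc (Suc N)) = A n * (r (Suc n) + V (k - 1) * r n)"
      using * s0 s1 rrec[of n] T A(2)[of n] by algebra
    then have "s (Suc (Suc N)) = r (Suc n) + V (k - 1) * r n" using A(1)[of n] by simp
    then have e0: "s (Suc n * k) = r (Suc n) + V (k - 1) * R (Suc n)" unfolding N by (simp add: R_def)
    have "\<not> k dvd Suc (Suc n * k)"
      using k by (metis dvd_add_right_iff dvd_triv_right nat_dvd_1_iff_1 One_nat_def Suc_eq_plus1 not_numeral_le_zero numeral_le_one_iff semiring_norm(69))
    then have "s (Suc (Suc n * k)) = 2 * x * s (Suc n * k) - s (Suc N)"
      using half[of "Suc N"] unfolding N by simp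
    also have "\<dots> = 2 * x * r (Suc n) + (2 * x * V (k - 1) - V k) * r n"
      unfolding e0 s1 by (simp add: R_def algebra_simps)
    also have "2 * x * V (k - 1) - V k = V (k - 2)"
    proof -
      define i where "i = k - 2"
      have "k = Suc (Suc i)" using k by (simp add: i_def)
      then show ?thesis using Vrec[of i] by simp
    qed
    finally show ?case using e0 by (intro block) (auto simp: R_def)
  qed
  then show ?thesis using j unfolding R_def by blast
qed

text \<open>At the end of a block the second term carries \<open>V 0 = 0\<close>, which leaves a
  product.\<close>

lemma sieved_rwp_last:
  assumes k: "2 \<le> k" and A: "\<And>n. 0 < A n" "\<And>n. A n + B n = 1"
  shows "rwp (sieve k A) (sieve k B) (n * k + (k - 1)) = cheb_V k * pcompose (rwp A B n) (cheb_T k)"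
proof (rule poly_ext)
  fix x
  show "poly (rwp (sieve k A) (sieve k B) (n * k + (k - 1))) x = poly (cheb_V k * pcompose (rwp A B n) (cheb_T k)) x"
    using poly_sieved_rwp[where j="k - 1" and n=n and x=x, OF k A] k by (simp add: poly_pcompose)
qed

text \<open>Up to the common factor \<open>c\<close> below, these are the masses of the reversed measure at the preimages
  of \<open>t\<close> under \<open>T\<^sub>k\<close> and at the zeros of \<open>U\<^sub>k\<^sub>-\<^sub>1\<close>.\<close>

definition mass_T :: "(nat \<Rightarrow> real) \<Rightarrow> (nat \<Rightarrow> real) \<Rightarrow> nat \<Rightarrow> real \<Rightarrow> real" where
  "mass_T A B m t = poly (rwp A B (2 * m)) t / ((1 - t\<^sup>2) * poly (pderiv (rwp A B (Suc (2 * m)))) t)"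

definition mass_U :: "(nat \<Rightarrow> real) \<Rightarrow> (nat \<Rightarrow> real) \<Rightarrow> nat \<Rightarrow> real" where
  "mass_U A B m = 1 - poly (rwp A B (2 * m)) 1 / poly (rwp A B (Suc (2 * m))) 1"

text \<open>The index makes \<open>Suc n\<close> the last one of block \<open>2 m + 1\<close>, where
  the polynomial factors. The constant \<open>c\<close> gathers two values at 1 and the factor
  \<open>k\<close> from \<open>T_k' = k U_(k-1)\<close>; being common to all points, it cancels in
  every comparison of masses.\<close>

lemma sieved_rwp_masses:
  fixes k m :: nat
  assumes k: "2 \<le> k" and A: "rw_coeffs A B"
  defines "a \<equiv> sieve k A" and "b \<equiv> sieve k B" and "n \<equiv> k * (2 * m + 2) - 2"
  defines "c \<equiv> poly (rwp a b (Suc n)) 1 / poly (rwp a b n) 1 / real k"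
  shows "0 < c"
    and "poly (rwp a b (Suc n)) x = poly (cheb_V k) x * poly (rwp A B (Suc (2 * m))) (poly (cheb_T k) x)"
    and "poly (rwp A B (Suc (2 * m))) (poly (cheb_T k) x) = 0 \<Longrightarrow>
           rev_weight (canon a b) n x = c * mass_T A B m (poly (cheb_T k) x)"
    and "poly (cheb_V k) x = 0 \<Longrightarrow> rev_weight (canon a b) n x = c * mass_U A B m"
proof -
  have A': "\<And>n. 0 < A n" "\<And>n. A n + B n = 1" "rwc A B" using A rw_coeffs_rwc by (auto simp: rw_coeffs_def)
  have ab: "rwc a b" unfolding a_def b_def by (rule rwc_sieve[OF A])
  have pos: "0 < poly (rwp a b i) (1::real)" for i by (rule rwp_pos_ge_1[OF ab]) simp
  then show c: "0 < c" unfolding c_def using k by simp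
  have nk: "Suc n = Suc (2 * m) * k + (k - 1)" "n = Suc (2 * m) * k + (k - 2)"
    using k unfolding n_def by (auto simp: algebra_simps)
  let ?r = "rwp A B (Suc (2 * m)) :: real poly"
  let ?T = "cheb_T k" let ?V = "cheb_V k"
  have sS: "rwp a b (Suc n) = ?V * pcompose ?r ?T"
    unfolding a_def b_def nk(1) by (rule sieved_rwp_last[OF k A'(1,2)])
  show "poly (rwp a b (Suc n)) x = poly ?V x * poly ?r (poly ?T x)"
    unfolding sS by (simp add: poly_pcompose)
  have "k - 2 < k" "k - 1 - (k - 2) = Suc 0" "Suc (k - 2) = k - 1" using k by auto
  then have sn: "poly (rwp a b n) x = poly (cheb_V (k - 1)) x * poly ?r (poly ?T x) + poly (rwp A B (2 * m)) (poly ?T x)"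
    using poly_sieved_rwp[where j="k - 2" and n="Suc (2 * m)" and x=x, OF k A'(1,2)] unfolding nk(2) a_def b_def by simp
  have ds: "poly (pderiv (rwp a b (Suc n))) x = poly (pderiv ?V) x * poly ?r (poly ?T x)
      + real k * (poly ?V x)\<^sup>2 * poly (pderiv ?r) (poly ?T x)"
    unfolding sS pderiv_mult pderiv_pcompose by (simp add: poly_pcompose pderiv_cheb_T power2_eq_square)
  have w: "rev_weight (canon a b) n x = real k * c * poly (rwp a b n) x / ((1 - x\<^sup>2) * poly (pderiv (rwp a b (Suc n))) x)"
    unfolding rev_weight_def rwp_canon[OF ab] pderiv_smult c_def using pos[of n] pos[of "Suc n"] k by simp
  show "rev_weight (canon a b) n x = c * mass_T A B m (poly ?T x)" if r0: "poly ?r (poly ?T x) = 0"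
  proof -
    have "(1 - x\<^sup>2) * poly (pderiv (rwp a b (Suc n))) x = real k * ((1 - (poly ?T x)\<^sup>2) * poly (pderiv ?r) (poly ?T x))"
    proof -
      \<comment> \<open>The Pell identity absorbs the factor \<open>(V k)^2\<close> of the
        derivative, so that only \<open>T_k(x)\<close> remains.\<close>
      have "1 - (poly ?T x)\<^sup>2 = (1 - x\<^sup>2) * (poly ?V x)\<^sup>2" using cheb_pell[of x k] by linarith
      then show ?thesis unfolding ds r0 by (simp only: mult_zero_right mult_zero_left add_0 mult_ac)
    qed
    then show ?thesis unfolding w mass_T_def using k by (simp add: sn r0)
  qed
  show "rev_weight (canon a b) n x = c * mass_U A B m" if V0: "poly ?V x = 0"
  proof -
    define t where "t = poly ?T x"
    have t2: "t\<^sup>2 = 1" using cheb_pell[of x k] V0 by (simp add: t_def)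
    then have t: "t = 1 \<or> t = - 1" by (simp add: power2_eq_1_iff)
    \<comment> \<open>At a zero of \<open>V k\<close> the value \<open>t\<close> of
      \<open>T_k\<close> is a sign. By parity it enters numerator and denominator only squared, so
      all zeros of \<open>V k\<close> get the same mass.\<close>
    have "t = - poly (cheb_V (k - 1)) x"
      using poly_cheb_T_conv_V[of "k - 1" x] k V0 by (simp add: t_def)
    then have sn': "poly (rwp a b n) x = poly (rwp A B (2 * m)) t - t * poly ?r t"
      unfolding sn t_def[symmetric] by simp
    have p0: "poly (rwp A B (2 * m)) t = poly (rwp A B (2 * m)) 1" and p1: "poly ?r t = t * poly ?r 1"
      using t by (auto simp: poly_rwp_minus)
    have r1: "poly ?r 1 \<noteq> (0::real)" using rwp_pos_ge_1[OF A'(3), of 1 "Suc (2 * m)"] by simp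
    have "(1 - x\<^sup>2) * poly (pderiv (rwp a b (Suc n))) x = ((1 - x\<^sup>2) * poly (pderiv ?V) x) * poly ?r t"
      unfolding ds V0 by (simp add: t_def)
    also have "\<dots> = - real k * t * (t * poly ?r 1)"
      unfolding pderiv_cheb_V_root[OF V0 less_le_trans[OF zero_less_numeral k]] p1 by (simp add: t_def)
    also have "\<dots> = - real k * poly ?r 1" using t2 by (simp add: power2_eq_square)
    finally have "rev_weight (canon a b) n x = real k * c * (poly (rwp A B (2 * m)) 1 - poly ?r 1) / (- real k * poly ?r 1)"
      unfolding w sn' p0 p1 using t2 by (simp add: power2_eq_square flip: mult.assoc)
    also have "\<dots> = c * ((poly (rwp A B (2 * m)) 1 - poly ?r 1) / - poly ?r 1)" using k by simp
    also have "\<dots> = c * mass_U A B m" using r1 by (simp add: mass_U_def field_simps)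
    finally show ?thesis .
  qed
qed

text \<open>The total number of zeros is known, and each of the three kinds has an upper bound from
  a degree: \<open>k\<close>, \<open>k - 1\<close> and \<open>2 m k\<close>. The bounds add up to
  the total, so all are attained.\<close>

lemma sieved_support_card:
  fixes k m :: nat
  assumes k: "2 \<le> k" and A: "rw_coeffs A B"
  defines "X \<equiv> {x. poly (cheb_V k) x * poly (rwp A B (Suc (2 * m))) (poly (cheb_T k) x) = 0}"
    and "R \<equiv> {x. poly (rwp A B (Suc (2 * m))) (poly (cheb_T k) x) = 0 \<and> poly (cheb_T k) x \<noteq> 0}"
  shows "card X = k * (2 * m + 2) - 1" "zeros_T k \<subseteq> X" "zeros_U k \<subseteq> X" "X - zeros_T k - zeros_U k = R"
    "card R = 2 * m * k \<and> zeros_T k \<noteq> {} \<and> zeros_U k \<noteq> {}"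
proof -
  have A': "\<And>n. 0 < A n" "rwc A B" using A rw_coeffs_rwc by (auto simp: rw_coeffs_def)
  let ?r = "rwp A B (Suc (2 * m)) :: real poly"
  let ?T = "cheb_T k" let ?V = "cheb_V k"
  have r0: "poly ?r 0 = 0" using poly_rwp_minus[of A B "Suc (2 * m)" "0::real"] by simp
  have V: "?V = cheb_U (k - 1)" using cheb_V_Suc[of "k - 1"] k by simp
  have ZU: "zeros_U k = {x. poly ?V x = 0}" by (simp add: zeros_U_def V)
  show TX: "zeros_T k \<subseteq> X" using r0 by (auto simp: zeros_T_def X_def)
  show UX: "zeros_U k \<subseteq> X" by (auto simp: ZU X_def)
  have rt: "\<bar>t\<bar> < 1" if "poly ?r t = 0" for t by (rule rwp_root_abs_less_1[OF A'(2) that])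
  have TU: "(poly ?T x)\<^sup>2 = 1" if "poly ?V x = 0" for x using cheb_pell[of x k] that by simp
  have RU: "poly ?V x \<noteq> 0" if "poly ?r (poly ?T x) = 0" for x
    using TU[of x] rt[OF that] by (auto simp: power2_eq_1_iff)
  show XR: "X - zeros_T k - zeros_U k = R"
    using RU by (auto simp: X_def R_def ZU zeros_T_def)
  let ?n = "k * (2 * m + 2) - 2"
  have "X = {x. poly (rwp (sieve k A) (sieve k B) (Suc ?n)) x = 0}"
    unfolding X_def sieved_rwp_masses(2)[OF k A] ..
  then show cX: "card X = k * (2 * m + 2) - 1"
    using card_rwp_roots[OF rwc_sieve[OF A], of k "Suc ?n"] k by simp
  then have finX: "finite X" using k by (intro card_ge_0_finite) simp
  have cU: "card (zeros_U k) \<le> k - 1"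
    unfolding zeros_U_def using card_poly_roots_bound[OF cheb_U_nz, of "k - 1"] by (simp add: degree_cheb_U)
  have fib: "card {x. poly ?T x = t} \<le> k" for t
  proof -
    have "degree (?T + [:- t:]) = k" using k by (subst degree_add_eq_left) (auto simp: degree_cheb_T)
    moreover from this have "?T + [:- t:] \<noteq> 0" using k by auto
    ultimately show ?thesis using card_poly_roots_bound[of "?T + [:- t:]"] by simp
  qed
  have cT: "card (zeros_T k) \<le> k" unfolding zeros_T_def by (rule fib)
  let ?Z = "{t. poly ?r t = 0} - {0}"
  have "card {t. poly ?r t = 0} = Suc (2 * m)" by (rule card_rwp_roots[OF A'(2)])
  then have cZ: "card ?Z = 2 * m" using r0 by (subst card_Diff_singleton) auto
  have "finite ?Z" by (intro finite_Diff poly_roots_finite rwp_nz A'(1))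
  have "R = (\<Union>t\<in>?Z. {x. poly ?T x = t})" by (auto simp: R_def)
  then have "card R \<le> (\<Sum>t\<in>?Z. card {x. poly ?T x = t})"
    using card_UN_le[OF \<open>finite ?Z\<close>] by simp
  also have "\<dots> \<le> 2 * m * k" using sum_bounded_above[of ?Z "\<lambda>t. card {x. poly ?T x = t}" k] fib cZ by simp
  finally have cR: "card R \<le> 2 * m * k" .
  have "X = zeros_T k \<union> (zeros_U k \<union> R)" using TX UX XR by blast
  then have "card X \<le> card (zeros_T k) + (card (zeros_U k) + card R)"
    by (metis card_Un_le add_le_mono le_refl order_trans)
  then have "card R = 2 * m * k \<and> card (zeros_T k) = k \<and> card (zeros_U k) = k - 1"
  proof -
    have "card X = 2 * m * k + (k + (k - 1))" unfolding cX using k by (simp add: algebra_simps)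
    then show ?thesis using \<open>card X \<le> _\<close> cR cT cU by linarith
  qed
  then show "card R = 2 * m * k \<and> zeros_T k \<noteq> {} \<and> zeros_U k \<noteq> {}" using k by auto
qed

text \<open>The mass at a support point depends only on its kind and on \<open>T_k(x)\<close>. Hence
  equality on the zeros of \<open>T_k\<close> and on those of \<open>U_(k-1)\<close> is automatic,
  and the rest compares masses at the nonzero zeros of \<open>rwp A B (2 m + 1)\<close>; that each
  of these has a preimage is due to \<open>cheb_T_surj\<close>.\<close>

lemma sieved_reversed_measure:
  assumes k: "2 \<le> k" and A: "rw_coeffs A B" and \<mu>: "orthogonality_measure (sieved_rw_poly k A B) \<mu>"
  defines "\<nu> \<equiv> \<lambda>m. reversed_measure \<mu> (k * (2 * m + 2) - 2)"
  shows "card (support_points (\<nu> m)) = k * (2 * m + 2) - 1 \<and> zeros_T k \<subseteq> support_points (\<nu> m) \<and>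
      zeros_U k \<subseteq> support_points (\<nu> m) \<and> card (remaining_points k (\<nu> m)) = 2 * m * k" (is ?S)
    and "equal_mass_property k (\<nu> m) \<longleftrightarrow>
      (\<forall>t u. t \<noteq> 0 \<and> u \<noteq> 0 \<and> poly (rwp A B (Suc (2 * m))) t = 0 \<and> poly (rwp A B (Suc (2 * m))) u = 0 \<longrightarrow>
        mass_T A B m t = mass_T A B m u)" (is "?E \<longleftrightarrow> ?E'")
    and "mass_ratios k \<alpha> \<gamma> (\<nu> m) \<longleftrightarrow>
      (\<forall>t. t \<noteq> 0 \<and> poly (rwp A B (Suc (2 * m))) t = 0 \<longrightarrow>
        mass_U A B m = (2 * \<alpha> + 1) * mass_T A B m t \<and> mass_T A B m 0 = (\<gamma> + 1) * mass_T A B m t)" (is "?M \<longleftrightarrow> ?M'")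
proof -
  let ?a = "sieve k A" and ?b = "sieve k B" and ?n = "k * (2 * m + 2) - 2"
  let ?r = "rwp A B (Suc (2 * m)) :: real poly"
  let ?T = "cheb_T k" let ?V = "cheb_V k"
  have ab: "rwc ?a ?b" by (rule rwc_sieve[OF A])
  have "sieved_rw_poly k A B = rwp ?a ?b" by (rule ext) (rule sieved_rw_poly_eq_rwp[OF k])
  then have "orthogonality_measure (rwp ?a ?b) \<mu>" using \<mu> by simp
  then have st: "stieltjes_params \<mu> (canon ?a ?b)" by (rule stieltjes_params_canon[OF _ ab])
  note cc = rwc_canon[OF ab] canon_0 st
  define X where "X = {x. poly ?V x * poly ?r (poly ?T x) = 0}"
  define R where "R = {x. poly ?r (poly ?T x) = 0 \<and> poly ?T x \<noteq> 0}"
  note card = sieved_support_card[OF k A, of m, folded X_def R_def]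
  have e: "poly (rwp ?a ?b i) (1::real) \<noteq> 0" for i using rwp_pos_ge_1[OF ab, of 1 i] by simp
  have roots: "poly (rwp (\<lambda>n. 1 - canon ?a ?b n) (canon ?a ?b) (Suc ?n)) x = 0 \<longleftrightarrow> x \<in> X" for x
  proof -
    have "poly (rwp ?a ?b (Suc ?n)) x = poly ?V x * poly ?r (poly ?T x)" by (rule sieved_rwp_masses(2)[OF k A])
    moreover have "1 / poly (rwp ?a ?b (Suc ?n)) (1::real) \<noteq> 0" using e by simp
    ultimately show ?thesis unfolding rwp_canon[OF ab] poly_smult X_def mem_Collect_eq by (simp only: mult_eq_0_iff) blast
  qed
  have supp: "support_points (\<nu> m) = X"
    unfolding \<nu>_def support_points_reversed_measure[OF cc] using roots by blast
  have rem: "remaining_points k (\<nu> m) = R" unfolding remaining_points_def supp by (rule card(4))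
  show ?S unfolding supp rem using card by blast
  obtain c where c: "0 < c"
    and cT: "\<And>x. poly ?r (poly ?T x) = 0 \<Longrightarrow> rev_weight (canon ?a ?b) ?n x = c * mass_T A B m (poly ?T x)"
    and cU: "\<And>x. poly ?V x = 0 \<Longrightarrow> rev_weight (canon ?a ?b) ?n x = c * mass_U A B m"
    by (rule that[OF sieved_rwp_masses(1,3,4)[OF k A, where m=m]])
  have mass: "measure (\<nu> m) {x} = rev_weight (canon ?a ?b) ?n x" if "x \<in> X" for x
    using that roots[of x] unfolding \<nu>_def reversed_measure_mass[OF cc] by simp
  have r0: "poly ?r 0 = 0" using poly_rwp_minus[of A B "Suc (2 * m)" "0::real"] by simp
  have V: "?V = cheb_U (k - 1)" using cheb_V_Suc[of "k - 1"] k by simp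
  have mR: "measure (\<nu> m) {x} = c * mass_T A B m (poly ?T x)" if "x \<in> R" for x
    using that mass[of x] cT[of x] unfolding X_def R_def by simp
  have mT: "measure (\<nu> m) {x} = c * mass_T A B m 0" if "x \<in> zeros_T k" for x
    using that mass[of x] cT[of x] r0 by (simp add: X_def zeros_T_def)
  have mU: "measure (\<nu> m) {x} = c * mass_U A B m" if "x \<in> zeros_U k" for x
    using that mass[of x] cU[of x] by (simp add: X_def zeros_U_def V)
  have pre: "\<exists>x\<in>R. poly ?T x = t" if "t \<noteq> 0" "poly ?r t = 0" for t
    using cheb_T_surj[of k t] rwp_root_abs_less_1[OF rw_coeffs_rwc[OF A] that(2)] that k
    by (auto simp: R_def)
  show "?E \<longleftrightarrow> ?E'"
  proof
    assume "equal_mass_property k (\<nu> m)"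
    then have eq: "measure (\<nu> m) {x} = measure (\<nu> m) {y}" if "x \<in> R" "y \<in> R" for x y
      using that unfolding equal_mass_property_def rem equal_masses_def by blast
    show ?E'
    proof (intro allI impI)
      fix t u assume tu: "t \<noteq> 0 \<and> u \<noteq> 0 \<and> poly ?r t = 0 \<and> poly ?r u = 0"
      obtain x y where "x \<in> R" "poly ?T x = t" "y \<in> R" "poly ?T y = u" using pre tu by metis
      then show "mass_T A B m t = mass_T A B m u" using eq[of x y] mR[of x] mR[of y] c by simp
    qed
  next
    assume ?E'
    then have "equal_masses (\<nu> m) R" unfolding equal_masses_def by (auto simp: mR) (auto simp: R_def)
    moreover have "equal_masses (\<nu> m) (zeros_T k)" "equal_masses (\<nu> m) (zeros_U k)"
      by (simp_all add: equal_masses_def mT mU)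
    ultimately show "equal_mass_property k (\<nu> m)" unfolding equal_mass_property_def rem by blast
  qed
  show "?M \<longleftrightarrow> ?M'"
  proof
    assume mr: "mass_ratios k \<alpha> \<gamma> (\<nu> m)"
    obtain xU xT where x: "xU \<in> zeros_U k" "xT \<in> zeros_T k" using card by blast
    show ?M'
    proof (intro allI impI)
      fix t assume "t \<noteq> 0 \<and> poly ?r t = 0"
      then obtain y where y: "y \<in> R" "poly ?T y = t" using pre by blast
      then have "measure (\<nu> m) {xU} = (2 * \<alpha> + 1) * measure (\<nu> m) {y}" "measure (\<nu> m) {xT} = (\<gamma> + 1) * measure (\<nu> m) {y}"
        using mr x unfolding mass_ratios_def rem by blast+
      then show "mass_U A B m = (2 * \<alpha> + 1) * mass_T A B m t \<and> mass_T A B m 0 = (\<gamma> + 1) * mass_T A B m t"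
        using mU[OF x(1)] mT[OF x(2)] mR[OF y(1)] y(2) c by (simp add: mult.left_commute)
    qed
  next
    assume r: ?M'
    show "mass_ratios k \<alpha> \<gamma> (\<nu> m)"
      unfolding mass_ratios_def rem
    proof (intro ballI conjI)
      fix y assume y: "y \<in> R"
      then have *: "mass_U A B m = (2 * \<alpha> + 1) * mass_T A B m (poly ?T y)" "mass_T A B m 0 = (\<gamma> + 1) * mass_T A B m (poly ?T y)"
        using r by (auto simp: R_def)
      show "measure (\<nu> m) {x} = (2 * \<alpha> + 1) * measure (\<nu> m) {y}" if "x \<in> zeros_U k" for x
        using *(1) mU[OF that] mR[OF y] by simp
      show "measure (\<nu> m) {x} = (\<gamma> + 1) * measure (\<nu> m) {y}" if "x \<in> zeros_T k" for x
        using *(2) mT[OF that] mR[OF y] by simp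
    qed
  qed
qed

section \<open>Characterization by the masses\<close>

lemma rw_coeffs_ultra:
  assumes "\<alpha> > - 1 / 2" "\<gamma> > - 1"
  shows "rw_coeffs (ultra_A \<alpha> \<gamma>) (\<lambda>n. 1 - ultra_A \<alpha> \<gamma> n)"
  unfolding rw_coeffs_def
proof (intro allI conjI)
  fix n
  have "0 < ultra_A \<alpha> \<gamma> n \<and> ultra_A \<alpha> \<gamma> n < 1"
  proof (cases "even n")
    case True
    then show ?thesis using assms by (simp add: ultra_A_def divide_simps)
  next
    case False
    then have "1 \<le> real n" by (cases n) auto
    then show ?thesis using assms False by (simp add: ultra_A_def divide_simps)
  qed
  then show "0 < ultra_A \<alpha> \<gamma> n" "0 < 1 - ultra_A \<alpha> \<gamma> n" by auto
qed simp

lemma pderiv_rwp_rec: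
  assumes "a (Suc n) \<noteq> 0"
  shows "poly (rwp a b (Suc n)) x + x * poly (pderiv (rwp a b (Suc n))) x =
     a (Suc n) * poly (pderiv (rwp a b (Suc (Suc n)))) x + b (Suc n) * poly (pderiv (rwp a b n)) (x::real)"
  using assms by (simp add: rwp.simps(3) pderiv_smult pderiv_diff pderiv_pCons)

text \<open>The structure relations of the generalized Gegenbauer polynomials, in a form that is preserved
  by the recurrence because both sides are linear in two consecutive polynomials.\<close>

lemma ultra_structure_relations:
  fixes \<alpha> \<gamma> y :: real
  assumes \<alpha>: "\<alpha> > - 1 / 2" and \<gamma>: "\<gamma> > - 1"
  defines "r \<equiv> \<lambda>n. poly (rwp (ultra_A \<alpha> \<gamma>) (\<lambda>n. 1 - ultra_A \<alpha> \<gamma> n) n) y"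
    and "r' \<equiv> \<lambda>n. poly (pderiv (rwp (ultra_A \<alpha> \<gamma>) (\<lambda>n. 1 - ultra_A \<alpha> \<gamma> n) n)) y"
  shows "(2 * real m + 2 * \<alpha> + \<gamma> + 2) * y * r (2 * m) =
      (1 - y\<^sup>2) * y * r' (Suc (2 * m)) + (\<gamma> + (2 * real m + 1) * y\<^sup>2) * r (Suc (2 * m)) \<and>
    (1 - y\<^sup>2) * r' (2 * m) = (2 * real m + 2 * \<alpha> + \<gamma> + 2) * y * r (2 * m) - (2 * real m + \<gamma> + 1) * r (Suc (2 * m))"
proof (induction m)
  case 0
  define q where "q = 1 / ultra_A \<alpha> \<gamma> 0"
  have q: "q * (\<gamma> + 1) = 2 * \<alpha> + \<gamma> + 2" using \<alpha> \<gamma> by (simp add: q_def ultra_A_def divide_simps)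
  have r: "r 0 = 1" "r (Suc 0) = q * y" "r' 0 = 0" "r' (Suc 0) = q"
    by (simp_all add: r_def r'_def pderiv_pCons q_def)
  have "(2 * \<alpha> + \<gamma> + 2) * y * 1 = (1 - y\<^sup>2) * y * q + (\<gamma> + 1 * y\<^sup>2) * (q * y)"
    unfolding q[symmetric] by (simp add: power2_eq_square algebra_simps)
  moreover have "(1 - y\<^sup>2) * 0 = (2 * \<alpha> + \<gamma> + 2) * y * 1 - (\<gamma> + 1) * (q * y)"
    unfolding q[symmetric] by simp
  ultimately show ?case using r by simp
next
  case (Suc m)
  let ?A = "ultra_A \<alpha> \<gamma>"
  define K g where "K = 2 * real m + 2 * \<alpha> + \<gamma> + 2" and "g = 2 * real m + \<gamma> + 1"
  define a A where "a = ?A (Suc (2 * m))" and "A = ?A (Suc (Suc (2 * m)))"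
  have apos: "0 < ?A n" for n using rw_coeffs_ultra[OF \<alpha> \<gamma>] by (simp add: rw_coeffs_def)
  have a0: "a \<noteq> 0" "A \<noteq> 0" using apos by (auto simp: a_def A_def less_imp_neq[symmetric])
  have den: "K + 2 * real m + 2 > 0" "K + 2 * real m + 4 > 0" using \<alpha> \<gamma> by (auto simp: K_def)
  have a: "a * (K + 2 * real m + 2) = 2 * real m + 2"
  proof -
    have "a = (2 * real m + 2) / (K + 2 * real m + 2)" by (simp add: a_def ultra_A_def K_def algebra_simps)
    then show ?thesis using den by simp
  qed
  have A: "A * (K + 2 * real m + 4) = g + 2"
  proof -
    have "A = (g + 2) / (K + 2 * real m + 4)" by (simp add: A_def ultra_A_def K_def g_def algebra_simps)
    then show ?thesis using den by simp
  qed
  define R u u1 R1 dR du du1 dR1 where d: "R = r (Suc (2 * m))" "u = r (2 * m)" "u1 = r (Suc (Suc (2 * m)))"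
    "R1 = r (Suc (Suc (Suc (2 * m))))" "dR = r' (Suc (2 * m))" "du = r' (2 * m)" "du1 = r' (Suc (Suc (2 * m)))"
    "dR1 = r' (Suc (Suc (Suc (2 * m))))"
  have E: "K * y * u = (1 - y\<^sup>2) * y * dR + (\<gamma> + (2 * real m + 1) * y\<^sup>2) * R"
    and F: "(1 - y\<^sup>2) * du = K * y * u - g * R"
    using Suc unfolding K_def g_def d by auto
  have 1: "y * R = a * u1 + (1 - a) * u" "y * u1 = A * R1 + (1 - A) * R"
    using poly_rwp_rec[of ?A "2 * m" y "\<lambda>n. 1 - ?A n"] poly_rwp_rec[of ?A "Suc (2 * m)" y "\<lambda>n. 1 - ?A n"] apos
    unfolding d r_def a_def A_def by (auto simp: less_imp_neq[symmetric])
  have 2: "R + y * dR = a * du1 + (1 - a) * du" "u1 + y * du1 = A * dR1 + (1 - A) * dR"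
    using pderiv_rwp_rec[of ?A "2 * m" "\<lambda>n. 1 - ?A n" y] pderiv_rwp_rec[of ?A "Suc (2 * m)" "\<lambda>n. 1 - ?A n" y] apos
    unfolding d r_def r'_def a_def A_def by (auto simp: less_imp_neq[symmetric])
  \<comment> \<open>This order is forced: the first relation on the next level needs the derivative
    \<open>du1\<close> of the even polynomial in between, which \<open>F1\<close> provides.\<close>
  have F1: "(1 - y\<^sup>2) * du1 = (K + 2) * y * u1 - (g + 2) * R1"
  proof -
    have "a * ((1 - y\<^sup>2) * du1 - ((K + 2) * y * u1 - (g + 2) * R1)) = 0"
      using E F 1 2(1) a A g_def by algebra
    then show ?thesis using a0 by simp
  qed
  have E1: "(K + 2) * y * u1 = (1 - y\<^sup>2) * y * dR1 + (\<gamma> + (2 * real m + 3) * y\<^sup>2) * R1"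
  proof -
    have "(K + 2 * real m + 4) * A * ((K + 2) * y * u1 - ((1 - y\<^sup>2) * y * dR1 + (\<gamma> + (2 * real m + 3) * y\<^sup>2) * R1)) = 0"
      using E F1 1 2(2) a A g_def by algebra
    then show ?thesis using a0 den by simp
  qed
  show ?case using E1 F1 unfolding d K_def g_def by (simp add: algebra_simps)
qed

lemma rwp_odd_at_0: "poly (rwp A B (Suc (2 * m))) (0::real) = 0"
  using poly_rwp_minus[of A B "Suc (2 * m)" "0::real"] by simp

text \<open>At a nonzero zero the term with \<open>?R\<close> drops out of the structure relation,
  and at 1 the derivative term does; \<open>2 * \<alpha> + 1\<close> is the difference of
  \<open>K\<close> and \<open>2 * m + \<gamma> + 1\<close>.\<close>

lemma ultra_masses:
  fixes \<alpha> \<gamma> :: real and m :: nat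
  assumes \<alpha>: "\<alpha> > - 1 / 2" and \<gamma>: "\<gamma> > - 1"
  defines "A \<equiv> ultra_A \<alpha> \<gamma>" and "K \<equiv> 2 * real m + 2 * \<alpha> + \<gamma> + 2"
  shows "t \<noteq> 0 \<Longrightarrow> poly (rwp A (\<lambda>n. 1 - A n) (Suc (2 * m))) t = 0 \<Longrightarrow> mass_T A (\<lambda>n. 1 - A n) m t = 1 / K"
    and "mass_T A (\<lambda>n. 1 - A n) m 0 = (\<gamma> + 1) / K"
    and "mass_U A (\<lambda>n. 1 - A n) m = (2 * \<alpha> + 1) / K"
proof -
  let ?u = "rwp A (\<lambda>n. 1 - A n) (2 * m) :: real poly" and ?R = "rwp A (\<lambda>n. 1 - A n) (Suc (2 * m)) :: real poly"
  have rwc: "rwc A (\<lambda>n. 1 - A n)" unfolding A_def by (intro rw_coeffs_rwc rw_coeffs_ultra \<alpha> \<gamma>)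
  have E: "K * y * poly ?u y = (1 - y\<^sup>2) * y * poly (pderiv ?R) y + (\<gamma> + (2 * real m + 1) * y\<^sup>2) * poly ?R y" for y
    using ultra_structure_relations[OF \<alpha> \<gamma>, of m y] unfolding A_def K_def by blast
  have K: "0 < K" using \<alpha> \<gamma> by (simp add: K_def)
  show "mass_T A (\<lambda>n. 1 - A n) m t = 1 / K" if t: "t \<noteq> 0" "poly ?R t = 0"
  proof -
    have "K * poly ?u t = (1 - t\<^sup>2) * poly (pderiv ?R) t" using E[of t] t by simp
    moreover have "poly (pderiv ?R) t \<noteq> 0" by (rule rwp_pderiv_nz[OF rwc t(2)])
    moreover have "t\<^sup>2 \<noteq> 1" using rwp_root_abs_less_1[OF rwc t(2)] by (auto simp: power2_eq_1_iff)
    ultimately show ?thesis using K by (simp add: mass_T_def divide_simps mult.commute)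
  qed
  \<comment> \<open>At 0 both sides vanish, so the relation is differentiated before it is evaluated
    there.\<close>
  have "smult K ([:0, 1:] * ?u) = [:1, 0, -1:] * ([:0, 1:] * pderiv ?R) + [:\<gamma>, 0, 2 * real m + 1:] * ?R"
    by (rule poly_ext) (use E in \<open>simp add: power2_eq_square algebra_simps\<close>)
  then have "poly (pderiv (smult K ([:0, 1:] * ?u))) 0 = poly (pderiv ([:1, 0, -1:] * ([:0, 1:] * pderiv ?R) + [:\<gamma>, 0, 2 * real m + 1:] * ?R)) 0"
    by (rule arg_cong)
  then have "K * poly ?u 0 = (\<gamma> + 1) * poly (pderiv ?R) 0"
    unfolding pderiv_smult pderiv_add pderiv_mult by (simp add: pderiv_pCons rwp_odd_at_0 algebra_simps)
  moreover have "poly (pderiv ?R) 0 \<noteq> 0" by (rule rwp_pderiv_nz[OF rwc rwp_odd_at_0])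
  ultimately show "mass_T A (\<lambda>n. 1 - A n) m 0 = (\<gamma> + 1) / K" using K by (simp add: mass_T_def field_simps)
  have "K * poly ?u 1 = (\<gamma> + 2 * real m + 1) * poly ?R 1" using E[of 1] by simp
  moreover have "poly ?R 1 \<noteq> 0" using rwp_pos_ge_1[OF rwc, of 1 "Suc (2 * m)"] by simp
  ultimately have "poly ?u 1 / poly ?R 1 = (\<gamma> + 2 * real m + 1) / K" using K by (simp add: field_simps)
  then show "mass_U A (\<lambda>n. 1 - A n) m = (2 * \<alpha> + 1) / K" unfolding mass_U_def using K by (simp add: field_simps K_def)
qed

section \<open>Recovering the coefficients from the masses\<close>

lemma rwp_leading_coeffs:
  assumes "\<And>n. 0 < A n"
  shows "poly.coeff (rwp A B n :: real poly) n = A n * poly.coeff (rwp A B (Suc n)) (Suc n)"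
    and "poly.coeff (rwp A B (Suc (Suc n)) :: real poly) n =
      - (\<Sum>i=1..Suc n. A (i - 1) * B i) * poly.coeff (rwp A B (Suc (Suc n))) (Suc (Suc n))"
proof -
  have lead: "poly.coeff (rwp A B n :: real poly) n = A n * poly.coeff (rwp A B (Suc n)) (Suc n)" for n
    using degree_coeff_rwp[OF assms, where b=B and n=n and 'a=real] degree_coeff_rwp[OF assms, where b=B and n="Suc n" and 'a=real]
      assms[of n] by simp
  then show "poly.coeff (rwp A B n :: real poly) n = A n * poly.coeff (rwp A B (Suc n)) (Suc n)" .
  show "poly.coeff (rwp A B (Suc (Suc n)) :: real poly) n =
      - (\<Sum>i=1..Suc n. A (i - 1) * B i) * poly.coeff (rwp A B (Suc (Suc n))) (Suc (Suc n))"
  proof (induction n)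
    case 0
    have "A 1 * poly.coeff (rwp A B (Suc (Suc 0)) :: real poly) 0 = - B 1"
      using assms[of 1] by (simp add: rwp.simps(3))
    moreover have "poly.coeff (rwp A B 0 :: real poly) 0 = 1" by simp
    ultimately have "A 1 * (poly.coeff (rwp A B (Suc (Suc 0)) :: real poly) 0
       + (A 0 * B 1) * poly.coeff (rwp A B (Suc (Suc 0)) :: real poly) (Suc (Suc 0))) = 0"
      using lead[of 0] lead[of 1] unfolding One_nat_def by algebra
    then show ?case using assms[of 1] by (simp add: eq_neg_iff_add_eq_0)
  next
    case (Suc n)
    let ?c = "\<lambda>n i. poly.coeff (rwp A B n :: real poly) i"
    \<comment> \<open>In the monic normalization the recurrence coefficients are the products
      \<open>A (i - 1) * B i\<close>, and each step subtracts one of them from the second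
      coefficient.\<close>
    define \<sigma> where "\<sigma> = (\<Sum>i=1..Suc n. A (i - 1) * B i)"
    have "A (Suc (Suc n)) * ?c (Suc (Suc (Suc n))) (Suc n) = ?c (Suc (Suc n)) n - B (Suc (Suc n)) * ?c (Suc n) (Suc n)"
      using assms[of "Suc (Suc n)"] by (subst (1) rwp.simps(3)) simp
    moreover have "?c (Suc (Suc n)) n = - \<sigma> * ?c (Suc (Suc n)) (Suc (Suc n))" unfolding \<sigma>_def by (rule Suc)
    ultimately have "A (Suc (Suc n)) * ?c (Suc (Suc (Suc n))) (Suc n) =
      A (Suc (Suc n)) * (- (\<sigma> + A (Suc n) * B (Suc (Suc n))) * ?c (Suc (Suc (Suc n))) (Suc (Suc (Suc n))))"
      using lead[of "Suc n"] lead[of "Suc (Suc n)"] by algebra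
    then have "?c (Suc (Suc (Suc n))) (Suc n) = - (\<sigma> + A (Suc n) * B (Suc (Suc n))) * ?c (Suc (Suc (Suc n))) (Suc (Suc (Suc n)))"
      using assms[of "Suc (Suc n)"] by simp
    then show ?case by (simp add: \<sigma>_def)
  qed
qed

text \<open>\<open>M\<close> is the mass of the remaining points up to the common factor. It is
  quantified because at \<open>m = 0\<close> no such point exists to define it, although both ratios
  still make sense.\<close>

definition mass_prop :: "real \<Rightarrow> real \<Rightarrow> (nat \<Rightarrow> real) \<Rightarrow> (nat \<Rightarrow> real) \<Rightarrow> nat \<Rightarrow> bool" where
  "mass_prop \<alpha> \<gamma> A B m \<longleftrightarrow> (\<exists>M. mass_T A B m 0 = (\<gamma> + 1) * M \<and> mass_U A B m = (2 * \<alpha> + 1) * M \<and>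
     (\<forall>t. t \<noteq> 0 \<and> poly (rwp A B (Suc (2 * m))) t = 0 \<longrightarrow> mass_T A B m t = M))"

text \<open>Interpolation at the \<open>2 m\<close> nonzero roots and at \<open>0, 1, -1\<close>, where the masses enter.\<close>

lemma mass_prop_identity:
  fixes \<alpha> \<gamma> :: real
  assumes \<alpha>: "\<alpha> > - 1 / 2" and \<gamma>: "\<gamma> > - 1" and A: "rw_coeffs A B" and mp: "mass_prop \<alpha> \<gamma> A B m"
    and R: "rwp A B (Suc (2 * m)) = [:0, 1:] * V"
  shows "smult (2 * real m + 2 * \<alpha> + \<gamma> + 2) (rwp A B (2 * m)) =
    [:1, 0, -1:] * ([:0, 1:] * pderiv V) + [:\<gamma> + 1, 0, 2 * real m:] * V"
proof -
  have rwc: "rwc A B" and A0: "\<And>n. 0 < A n" using A rw_coeffs_rwc by (auto simp: rw_coeffs_def)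
  obtain M where M: "mass_T A B m 0 = (\<gamma> + 1) * M" "mass_U A B m = (2 * \<alpha> + 1) * M"
    "\<And>t. t \<noteq> 0 \<Longrightarrow> poly (rwp A B (Suc (2 * m))) t = 0 \<Longrightarrow> mass_T A B m t = M"
    using mp unfolding mass_prop_def by blast
  let ?u = "rwp A B (2 * m) :: real poly" and ?R = "rwp A B (Suc (2 * m)) :: real poly"
  \<comment> \<open>Chosen so that \<open>P\<close> and \<open>?u\<close> agree at 1, where the
    first summand of \<open>P\<close> vanishes.\<close>
  define c where "c = 1 - (2 * \<alpha> + 1) * M - (\<gamma> + 1) * M"
  define P where "P = smult M ([:1, 0, -1:] * ([:0, 1:] * pderiv V)) + [:(\<gamma> + 1) * M, 0, c:] * V"
  have V: "poly ?R t = t * poly V t" for t unfolding R by simp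
  have V': "poly (pderiv ?R) t = poly V t + t * poly (pderiv V) t" for t
    unfolding R pderiv_mult by (simp add: pderiv_pCons)
  have degR: "degree ?R = Suc (2 * m)" by (rule degree_rwp[OF A0])
  have Vnz: "V \<noteq> 0" using R rwp_nz[where a=A and b=B and n="Suc (2 * m)" and 'a=real, OF A0] by auto
  then have degV: "degree V = 2 * m" using degR unfolding R by (simp add: degree_mult_eq)
  let ?Z = "{t. poly ?R t = 0}"
  have cZ: "card ?Z = Suc (2 * m)" by (rule card_rwp_roots[OF rwc])
  have finZ: "finite ?Z" using cZ by (intro card_ge_0_finite) simp
  have Z1: "1 \<notin> ?Z" "-1 \<notin> ?Z" using rwp_root_abs_less_1[OF rwc, of "Suc (2 * m)" 1] rwp_root_abs_less_1[OF rwc, of "Suc (2 * m)" "-1"] by auto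
  have u1: "poly ?u 1 = (1 - (2 * \<alpha> + 1) * M) * poly V 1"
  proof -
    have "poly ?R 1 \<noteq> 0" using rwp_pos_ge_1[OF rwc, of 1 "Suc (2 * m)"] by simp
    then show ?thesis using M(2) V[of 1] unfolding mass_U_def by (simp add: field_simps)
  qed
  have um: "poly ?u (-1) = poly ?u 1" "poly V (-1) = poly V 1"
    using poly_rwp_minus[of A B "2 * m" "1::real"] poly_rwp_minus[of A B "Suc (2 * m)" "1::real"] V[of 1] V[of "-1"] by auto
  have uP: "?u = P"
  proof (rule poly_eqI_degree)
    have "degree ([:1, 0, -1:] * ([:0, 1:] * pderiv V)) \<le> 2 * m + 2"
    proof (cases "pderiv V = 0")
      case False
      then have "0 < degree V" by (metis gr0I pderiv_eq_0_iff)
      then show ?thesis using False by (simp add: degree_mult_eq degree_pderiv degV del: mult_pCons_left)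
    qed simp
    moreover have "degree ([:(\<gamma> + 1) * M, 0, c:] * V) \<le> 2 * m + 2"
      using degree_mult_le[of "[:(\<gamma> + 1) * M, 0, c:]" V] degV by (simp split: if_splits del: mult_pCons_left)
    ultimately have "degree P \<le> 2 * m + 2" unfolding P_def
      by (intro degree_add_le degree_smult_le[THEN order_trans])
    moreover have "card (insert 1 (insert (-1) ?Z)) = 2 * m + 3" using Z1 finZ cZ by simp
    ultimately show "degree P < card (insert 1 (insert (-1) ?Z))" by simp
    show "degree ?u < card (insert 1 (insert (-1) ?Z))"
      using degree_rwp[where a=A and b=B and n="2 * m" and 'a=real, OF A0] \<open>card _ = 2 * m + 3\<close> by simp
    fix t assume "t \<in> insert 1 (insert (-1) ?Z)"
    then consider "t = 1" | "t = -1" | "t = 0" | "t \<noteq> 0" "poly ?R t = 0" by blast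
    then show "poly ?u t = poly P t"
    proof cases
      case 3
      have "poly (pderiv ?R) 0 \<noteq> 0" by (rule rwp_pderiv_nz[OF rwc rwp_odd_at_0])
      then have "poly ?u 0 = (\<gamma> + 1) * M * poly V 0" using M(1) V'[of 0] unfolding mass_T_def by (simp add: field_simps)
      then show ?thesis using 3 by (simp add: P_def)
    next
      case 4
      have "poly (pderiv ?R) t \<noteq> 0" by (rule rwp_pderiv_nz[OF rwc 4(2)])
      moreover have "t\<^sup>2 \<noteq> 1" using rwp_root_abs_less_1[OF rwc 4(2)] by (auto simp: power2_eq_1_iff)
      ultimately have "poly ?u t = M * ((1 - t\<^sup>2) * poly (pderiv ?R) t)"
        using M(3)[OF 4] unfolding mass_T_def by (simp add: field_simps)
      moreover have "poly V t = 0" using V[of t] 4 by simp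
      ultimately show ?thesis unfolding V' by (simp add: P_def power2_eq_square algebra_simps)
    qed (use u1 um in \<open>simp_all add: P_def c_def algebra_simps\<close>)
  qed
  define v where "v = poly.coeff V (2 * m)"
  have v: "v \<noteq> 0" using Vnz degV unfolding v_def by (metis leading_coeff_0_iff)
  \<comment> \<open>Since \<open>?u\<close> has degree \<open>2 m\<close>, the coefficient of degree
    \<open>2 m + 2\<close> in \<open>P\<close> vanishes; with the definition of \<open>c\<close>
    this fixes \<open>M\<close> as \<open>1 / K\<close>.\<close>
  have cM: "c = 2 * real m * M"
  proof -
    have "poly.coeff ?u (2 * m + 2) = 0" using degree_rwp[where a=A and b=B and n="2 * m" and 'a=real, OF A0] by (intro coeff_eq_0) simp
    moreover have "poly.coeff V (Suc (2 * m)) = 0" "poly.coeff V (Suc (Suc (2 * m))) = 0" using degV by (auto intro!: coeff_eq_0)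
    then have "poly.coeff P (2 * m + 2) = (c - 2 * real m * M) * v"
      by (cases m) (simp_all add: P_def v_def coeff_pderiv algebra_simps)
    ultimately show ?thesis using uP v by simp
  qed
  define K where "K = 2 * real m + 2 * \<alpha> + \<gamma> + 2"
  have KM: "K * M = 1" using cM unfolding c_def K_def by (simp add: algebra_simps)
  have Kc: "K * c = 2 * real m" unfolding cM using KM by (simp add: mult.left_commute)
  have Kg: "K * ((\<gamma> + 1) * M) = \<gamma> + 1" using KM by (simp add: mult.left_commute)
  have "smult K ?u = smult (K * M) ([:1, 0, -1:] * ([:0, 1:] * pderiv V)) + [:K * ((\<gamma> + 1) * M), 0, K * c:] * V"
    unfolding uP P_def by (simp add: smult_add_right)
  then show ?thesis unfolding KM Kc Kg by (simp only: smult_1_left K_def)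
qed

text \<open>The third equation is the comparison at infinity. The top coefficients cancel
  identically, so it concerns degree \<open>2 m\<close> and brings in the second coefficient of
  \<open>rwp A B (2 m + 1)\<close>, hence the sum over all earlier products.\<close>

lemma mass_prop_equations:
  fixes \<alpha> \<gamma> :: real and m :: nat
  assumes \<alpha>: "\<alpha> > - 1 / 2" and \<gamma>: "\<gamma> > - 1" and A: "rw_coeffs A B" and mp: "mass_prop \<alpha> \<gamma> A B m"
  defines "K \<equiv> 2 * real m + 2 * \<alpha> + \<gamma> + 2"
  shows "K * poly (rwp A B (2 * m)) 0 = (\<gamma> + 1) * poly (pderiv (rwp A B (Suc (2 * m)))) 0"
    and "K * poly (rwp A B (2 * m)) 1 = (\<gamma> + 1 + 2 * real m) * poly (rwp A B (Suc (2 * m))) 1"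
    and "0 < m \<Longrightarrow> K * A (2 * m) = 2 * real m + \<gamma> + 1 - 2 * (\<Sum>i=1..2 * m. A (i - 1) * B i)"
proof -
  have A0: "\<And>n. 0 < A n" using A by (auto simp: rw_coeffs_def)
  let ?u = "rwp A B (2 * m) :: real poly" and ?R = "rwp A B (Suc (2 * m)) :: real poly"
  obtain V where R: "?R = [:0, 1:] * V"
    using rwp_odd_at_0[of A B m] by (auto simp: poly_eq_0_iff_dvd dvd_def)
  note E = mass_prop_identity[OF \<alpha> \<gamma> A mp R, folded K_def]
  have V: "poly ?R t = t * poly V t" for t unfolding R by simp
  have V': "poly (pderiv ?R) t = poly V t + t * poly (pderiv V) t" for t
    unfolding R pderiv_mult by (simp add: pderiv_pCons)
  show "K * poly ?u 0 = (\<gamma> + 1) * poly (pderiv ?R) 0"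
    using arg_cong[OF E, of "\<lambda>p. poly p 0"] V'[of 0] by simp
  show "K * poly ?u 1 = (\<gamma> + 1 + 2 * real m) * poly ?R 1"
    using arg_cong[OF E, of "\<lambda>p. poly p 1"] V[of 1] by (simp add: algebra_simps)
  assume "0 < m"
  then obtain j where j: "m = Suc j" by (cases m) auto
  have cV: "poly.coeff V i = poly.coeff ?R (Suc i)" for i unfolding R by simp
  define l where "l = poly.coeff ?R (Suc (2 * m))"
  have l0: "l \<noteq> 0" using degree_coeff_rwp[OF A0, where b=B and n="Suc (2 * m)" and 'a=real] A0
    unfolding l_def by (auto simp: less_le)
  have "K * poly.coeff ?u (2 * m) = (2 * real m + \<gamma> + 1) * poly.coeff V (2 * m) + 2 * poly.coeff V (2 * j)"
    using arg_cong[OF E, of "\<lambda>p. poly.coeff p (2 * m)"] unfolding j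
    by (cases j) (simp_all add: coeff_pderiv algebra_simps)
  also have "poly.coeff V (2 * m) = l" by (simp add: cV l_def)
  also have "poly.coeff V (2 * j) = - (\<Sum>i=1..2 * m. A (i - 1) * B i) * l"
    using rwp_leading_coeffs(2)[where A=A and B=B and n="Suc (2 * j)", OF A0] unfolding cV l_def j by simp
  also have "poly.coeff ?u (2 * m) = A (2 * m) * l"
    unfolding l_def by (rule rwp_leading_coeffs(1)[OF A0])
  finally have "(K * A (2 * m)) * l = (2 * real m + \<gamma> + 1 - 2 * (\<Sum>i=1..2 * m. A (i - 1) * B i)) * l"
    by (simp add: algebra_simps)
  then show "K * A (2 * m) = 2 * real m + \<gamma> + 1 - 2 * (\<Sum>i=1..2 * m. A (i - 1) * B i)" using l0 by simp
qed

text \<open>Eliminating \<open>a\<close> leaves the factors \<open>A * (K + n) - g\<close> and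
  \<open>K - g\<close>. In the application \<open>K - g = 2 * \<alpha> + 1\<close>, which is
  positive, so the equation is linear in \<open>A\<close>, and \<open>a\<close> follows.\<close>

lemma solve_two_coeffs:
  fixes a A K g h n :: real
  assumes I: "(1 - a) * (K * A - h) = (K - 2) * a * (1 - A)"
    and II: "(g - K * A) * (K - 2 - (1 - a) * (g - 2)) = g * (1 - A) * (K - 2) * a"
    and g: "g = h + n" and pos: "0 < g" "2 < K" "2 \<le> n" "0 < A" and ne: "K \<noteq> g" and L: "0 < K + n - 2"
  shows "A = g / (K + n)" and "a = n / (K + n - 2)"
proof -
  have "K * (K - 2) * ((A * (K + n) - g) * (K - g)) = 0" using I II g by algebra
  then have A: "A * (K + n) = g" using pos ne by simp
  then show "A = g / (K + n)" using pos by (simp add: field_simps)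
  have "(K - 2) * n * g * (K + n) * (a * (K + n - 2) - n) = 0" using I II g A by algebra
  then have "a * (K + n - 2) = n" using pos by simp
  then show "a = n / (K + n - 2)" using L by (simp add: field_simps)
qed

text \<open>At 0 and at 1 the relations of two neighbouring levels, linked by two recurrence steps,
  form a homogeneous linear system. The polynomials give a nontrivial solution, so both determinants
  vanish: two equations for the two coefficients between the levels.\<close>

lemma mass_prop_tail_coeffs:
  fixes \<alpha> \<gamma> :: real
  assumes \<alpha>: "\<alpha> > - 1 / 2" and \<gamma>: "\<gamma> > - 1" and AB: "rw_coeffs A B"
    and mp: "mass_prop \<alpha> \<gamma> A B (Suc m)" "mass_prop \<alpha> \<gamma> A B (Suc (Suc m))"
  shows "A (2 * m + 4) = ultra_A \<alpha> \<gamma> (2 * m + 4)" and "A (2 * m + 3) = ultra_A \<alpha> \<gamma> (2 * m + 3)"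
proof -
  have rwc: "rwc A B" using AB by (rule rw_coeffs_rwc)
  \<comment> \<open>\<open>K\<close>, and \<open>g\<close> further down, are the constants of the
    upper level \<open>m + 2\<close>; the lower level has \<open>K - 2\<close> and
    \<open>g - 2\<close>.\<close>
  define K where "K = 2 * real m + 2 * \<alpha> + \<gamma> + 6"
  define a A' where "a = A (2 * m + 3)" and "A' = A (2 * m + 4)"
  have pos: "0 < a" "0 < A'" "a < 1" "A' < 1"
    using AB unfolding a_def A'_def rw_coeffs_def by (metis add_less_same_cancel1 less_add_same_cancel1)+
  have B: "B (2 * m + 3) = 1 - a" "B (2 * m + 4) = 1 - A'"
    using AB unfolding a_def A'_def rw_coeffs_def by (metis add_diff_cancel_left')+
  let ?r = "\<lambda>n. rwp A B n :: real poly"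
  have ix: "2 * Suc m = 2 * m + 2" "2 * Suc (Suc m) = 2 * m + 4" by simp_all
  note e1 = mass_prop_equations(1,2)[OF \<alpha> \<gamma> AB mp(1), unfolded ix]
  note e2 = mass_prop_equations(1,2)[OF \<alpha> \<gamma> AB mp(2), unfolded ix]
  have rec3: "x * poly (?r (2 * m + 3)) x = a * poly (?r (2 * m + 4)) x + (1 - a) * poly (?r (2 * m + 2)) x" for x
    using poly_rwp_rec[of A "2 * m + 2" x B] pos(1) B(1) unfolding a_def by (simp add: eval_nat_numeral)
  have rec4: "x * poly (?r (2 * m + 4)) x = A' * poly (?r (2 * m + 5)) x + (1 - A') * poly (?r (2 * m + 3)) x" for x
    using poly_rwp_rec[of A "2 * m + 3" x B] pos(2) B(2) unfolding A'_def by (simp add: eval_nat_numeral)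
  have drec4: "poly (?r (2 * m + 4)) 0 = A' * poly (pderiv (?r (2 * m + 5))) 0 + (1 - A') * poly (pderiv (?r (2 * m + 3))) 0"
    using pderiv_rwp_rec[of A "2 * m + 3" B 0] pos(2) B(2) unfolding A'_def by (simp add: eval_nat_numeral)
  have s: "Suc (2 * m + 2) = 2 * m + 3" "Suc (2 * m + 4) = 2 * m + 5" by simp_all
  define u0 v0 U0 V0 where d0: "u0 = poly (?r (2 * m + 2)) 0" "v0 = poly (pderiv (?r (2 * m + 3))) 0"
    "U0 = poly (?r (2 * m + 4)) 0" "V0 = poly (pderiv (?r (2 * m + 5))) 0"
  have z0: "(K - 2) * u0 = (\<gamma> + 1) * v0" "K * U0 = (\<gamma> + 1) * V0" "a * U0 + (1 - a) * u0 = 0"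
    "U0 = A' * V0 + (1 - A') * v0"
    using e1(1) e2(1) rec3[of 0] drec4 unfolding d0 K_def s by (simp_all add: algebra_simps)
  have "poly (rwp A B (Suc (2 * Suc (Suc m)))) (0::real) = 0" by (rule rwp_odd_at_0)
  then have "V0 \<noteq> 0" using rwp_pderiv_nz[OF rwc, of "2 * m + 5" 0] unfolding d0 by (simp add: eval_nat_numeral)
  then have U0: "U0 \<noteq> 0" using z0(2) \<gamma> by auto
  \<comment> \<open>The determinant condition at 0. The factor \<open>U0\<close> is nonzero because
    it is proportional to \<open>V0\<close>, the derivative at a simple zero.\<close>
  have "((1 - a) * (K * A' - (\<gamma> + 1)) - (K - 2) * a * (1 - A')) * U0 = 0" using z0 by algebra
  then have I: "(1 - a) * (K * A' - (\<gamma> + 1)) = (K - 2) * a * (1 - A')" using U0 by simp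
  define g where "g = 2 * real m + \<gamma> + 5"
  define u1 v1 U1 V1 where d1: "u1 = poly (?r (2 * m + 2)) 1" "v1 = poly (?r (2 * m + 3)) 1"
    "U1 = poly (?r (2 * m + 4)) 1" "V1 = poly (?r (2 * m + 5)) 1"
  have z1: "(K - 2) * u1 = (g - 2) * v1" "K * U1 = g * V1" "v1 = a * U1 + (1 - a) * u1"
    "U1 = A' * V1 + (1 - A') * v1"
    using e1(2) e2(2) rec3[of 1] rec4[of 1] unfolding d1 K_def s g_def by (simp_all add: algebra_simps)
  have U1: "U1 \<noteq> 0" using rwp_pos_ge_1[OF rwc, of 1 "2 * m + 4"] unfolding d1 by simp
  have "v1 * (K - 2 - (1 - a) * (g - 2)) = (K - 2) * a * U1" using z1(1,3) by algebra
  moreover have "U1 * (g - A' * K) = g * (1 - A') * v1" using z1(2,4) by algebra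
  ultimately have "((g - K * A') * (K - 2 - (1 - a) * (g - 2)) - g * (1 - A') * (K - 2) * a) * U1 = 0" by algebra
  then have II: "(g - K * A') * (K - 2 - (1 - a) * (g - 2)) = g * (1 - A') * (K - 2) * a" using U1 by simp
  have sol: "A' = g / (K + (2 * real m + 4))" "a = (2 * real m + 4) / (K + (2 * real m + 4) - 2)"
    by (rule solve_two_coeffs[OF I II]; use \<alpha> \<gamma> pos in \<open>simp add: g_def K_def\<close>)+
  show "A (2 * m + 4) = ultra_A \<alpha> \<gamma> (2 * m + 4)"
    unfolding A'_def[symmetric] sol(1) ultra_A_def by (simp add: g_def K_def algebra_simps)
  show "A (2 * m + 3) = ultra_A \<alpha> \<gamma> (2 * m + 3)"
    unfolding a_def[symmetric] sol(2) ultra_A_def by (simp add: K_def algebra_simps)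
qed

text \<open>Level 0 supplies no equation, so the pairs of levels determine the coefficients from
  index 3 on. For the first three, the comparison at infinity on levels 1 and 2 and the value at 0
  on level 1 take over.\<close>

lemma mass_prop_unique:
  fixes \<alpha> \<gamma> :: real
  assumes \<alpha>: "\<alpha> > - 1 / 2" and \<gamma>: "\<gamma> > - 1"
    and A: "rw_coeffs A B" "\<And>m. 0 < m \<Longrightarrow> mass_prop \<alpha> \<gamma> A B m"
    and A': "rw_coeffs A' B'" "\<And>m. 0 < m \<Longrightarrow> mass_prop \<alpha> \<gamma> A' B' m"
  shows "A = A'"
proof
  fix n :: nat
  have B: "B i = 1 - A i" for i using A(1) unfolding rw_coeffs_def by (metis add_diff_cancel_left')
  have B': "B' i = 1 - A' i" for i using A'(1) unfolding rw_coeffs_def by (metis add_diff_cancel_left')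
  have pos: "0 < A i" "0 < B i" "0 < A' i" "0 < B' i" for i using A(1) A'(1) by (auto simp: rw_coeffs_def)
  have tail: "A n = A' n" if "3 \<le> n" for n
  proof (cases "even n")
    case True
    define m where "m = (n - 4) div 2"
    have "n = 2 * m + 4" using True that unfolding m_def by presburger
    then show ?thesis using mass_prop_tail_coeffs(1)[OF \<alpha> \<gamma> A(1), of m] mass_prop_tail_coeffs(1)[OF \<alpha> \<gamma> A'(1), of m] A(2) A'(2) by simp
  next
    case False
    define m where "m = (n - 3) div 2"
    have "n = 2 * m + 3" using False that unfolding m_def by presburger
    then show ?thesis using mass_prop_tail_coeffs(2)[OF \<alpha> \<gamma> A(1), of m] mass_prop_tail_coeffs(2)[OF \<alpha> \<gamma> A'(1), of m] A(2) A'(2) by simp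
  qed
  define K where "K = 2 * \<alpha> + \<gamma> + 4"
  have K: "2 < K" using \<alpha> \<gamma> by (simp add: K_def)
  have eq2: "(K + 2) * C 4 = \<gamma> + 5 - 2 * (C 0 * D 1 + C 1 * D 2 + C 2 * D 3 + C 3 * D 4)"
    and eq1: "K * C 2 = \<gamma> + 3 - 2 * (C 0 * D 1 + C 1 * D 2)"
    and eq0: "K * C 2 * (C 0 * D 1) = (\<gamma> + 1) * (C 0 * D 1 + C 1 * D 2)"
    if "rw_coeffs C D" "\<And>m. 0 < m \<Longrightarrow> mass_prop \<alpha> \<gamma> C D m" for C D
  proof -
    have mp: "mass_prop \<alpha> \<gamma> C D 1" "mass_prop \<alpha> \<gamma> C D 2" using that(2) by auto
    show "(K + 2) * C 4 = \<gamma> + 5 - 2 * (C 0 * D 1 + C 1 * D 2 + C 2 * D 3 + C 3 * D 4)"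
      using mass_prop_equations(3)[OF \<alpha> \<gamma> that(1) mp(2)]
      by (simp add: K_def numeral_eq_Suc algebra_simps)
    show "K * C 2 = \<gamma> + 3 - 2 * (C 0 * D 1 + C 1 * D 2)"
      using mass_prop_equations(3)[OF \<alpha> \<gamma> that(1) mp(1)]
      by (simp add: K_def numeral_eq_Suc algebra_simps)
    have C: "C i \<noteq> 0" for i using that(1) unfolding rw_coeffs_def by (metis less_irrefl)
    have "K * poly (rwp C D 2) 0 = (\<gamma> + 1) * poly (pderiv (rwp C D 3)) 0"
      using mass_prop_equations(1)[OF \<alpha> \<gamma> that(1) mp(1)] by (simp add: K_def numeral_eq_Suc algebra_simps)
    moreover have "poly (rwp C D 2) 0 = - D 1 / C 1" by (simp add: numeral_eq_Suc rwp.simps(3))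
    moreover have "poly (pderiv (rwp C D 3)) 0 = (- D 1 / C 1 - D 2 / C 0) / C 2"
      using C by (simp add: numeral_eq_Suc rwp.simps(3) pderiv_smult pderiv_diff pderiv_pCons)
    ultimately show "K * C 2 * (C 0 * D 1) = (\<gamma> + 1) * (C 0 * D 1 + C 1 * D 2)"
      using C[of 0] C[of 1] C[of 2] by (simp add: field_simps)
  qed
  have t34: "A 3 = A' 3" "A 4 = A' 4" using tail by auto
  \<comment> \<open>Subtracting the level 1 equation from that of level 2 removes the products with
    \<open>A 0\<close> and \<open>A 1\<close> and leaves \<open>A 2\<close> against the known
    \<open>A 3\<close> and \<open>A 4\<close>.\<close>
  have "A 2 * (K - 2 * B 3) = A' 2 * (K - 2 * B 3)"
    using eq2[OF A] eq1[OF A] eq2[OF A'] eq1[OF A'] t34 unfolding B B' by (simp add: algebra_simps)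
  moreover have "B 3 < 1" using pos(1)[of 3] B[of 3] by simp
  ultimately have A2: "A 2 = A' 2" using K by auto
  have s1: "A 0 * B 1 + A 1 * B 2 = A' 0 * B' 1 + A' 1 * B' 2" using eq1[OF A] eq1[OF A'] A2 by simp
  then have "K * A 2 * (A 0 * B 1) = K * A 2 * (A' 0 * B' 1)" using eq0[OF A] eq0[OF A'] A2 by simp
  then have s0: "A 0 * B 1 = A' 0 * B' 1" using K pos(1)[of 2] by simp
  then have "A 1 * B 2 = A' 1 * B 2" using s1 A2 B B' by simp
  then have A1: "A 1 = A' 1" using pos(2)[of 2] by simp
  then have A0: "A 0 = A' 0" using s0 pos(2)[of 1] B B' by simp
  consider "n = 0" | "n = 1" | "n = 2" | "3 \<le> n" by linarith
  then show "A n = A' n" using A0 A1 A2 tail by cases auto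
qed

lemma mass_prop_ultra:
  assumes "\<alpha> > - 1 / 2" "\<gamma> > - 1"
  shows "mass_prop \<alpha> \<gamma> (ultra_A \<alpha> \<gamma>) (\<lambda>n. 1 - ultra_A \<alpha> \<gamma> n) m"
  unfolding mass_prop_def
  by (rule exI[of _ "1 / (2 * real m + 2 * \<alpha> + \<gamma> + 2)"]) (simp add: ultra_masses[OF assms])

section \<open>The weight on the circle\<close>

text \<open>Negative exponents make the weight unbounded, so a continuous multiple is dominated by a
  constant times the weight.\<close>

lemma absolutely_integrable_continuous_mult:
  fixes F K :: "real \<Rightarrow> real"
  assumes F: "continuous_on {a..b} F" and K: "K absolutely_integrable_on {a..b}"
  shows "(\<lambda>x. F x * K x) absolutely_integrable_on {a..b}"
proof -
  have "compact (F ` {a..b})" using F by (rule compact_continuous_image) simp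
  then obtain B where B: "\<And>x. x \<in> {a..b} \<Longrightarrow> norm (F x) \<le> B"
    by (meson bounded_iff compact_imp_bounded image_eqI)
  have iK: "integrable lebesgue (\<lambda>x. indicator {a..b} x *\<^sub>R K x)" using K by (simp add: set_integrable_def)
  have mF: "(\<lambda>x. indicator {a..b} x *\<^sub>R F x) \<in> borel_measurable lebesgue"
    by (intro measurable_completion) (use borel_measurable_continuous_on_indicator[OF _ F] in simp)
  have "integrable lebesgue (\<lambda>x. (indicator {a..b} x *\<^sub>R F x) * (indicator {a..b} x *\<^sub>R K x))"
  proof (rule Bochner_Integration.integrable_bound)
    show "integrable lebesgue (\<lambda>x. B * (indicator {a..b} x *\<^sub>R K x))" using iK by (rule integrable_mult_right)
    show "(\<lambda>x. (indicator {a..b} x *\<^sub>R F x) * (indicator {a..b} x *\<^sub>R K x)) \<in> borel_measurable lebesgue"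
      using mF borel_measurable_integrable[OF iK] by (rule borel_measurable_times)
    show "AE x in lebesgue. norm ((indicator {a..b} x *\<^sub>R F x) * (indicator {a..b} x *\<^sub>R K x))
      \<le> norm (B * (indicator {a..b} x *\<^sub>R K x))"
      using B by (intro AE_I2) (auto simp: indicator_def abs_mult intro!: mult_right_mono intro: order_trans[OF _ abs_ge_self])
  qed
  moreover have "(\<lambda>x. (indicator {a..b} x *\<^sub>R F x) * (indicator {a..b} x *\<^sub>R K x)) = (\<lambda>x. indicator {a..b} x *\<^sub>R (F x * K x))"
    by (auto simp: indicator_def)
  ultimately show ?thesis by (simp add: set_integrable_def)
qed

section \<open>Affine substitution and periodic integrands\<close>

lemma absolutely_integrable_affine:
  fixes f :: "real \<Rightarrow> real"
  assumes c: "0 < c" and ab: "a \<le> b" and f: "f absolutely_integrable_on {c * a + t..c * b + t}"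
  shows "(\<lambda>x. f (c * x + t)) absolutely_integrable_on {a..b}"
    and "integral {a..b} (\<lambda>x. f (c * x + t)) = integral {c * a + t..c * b + t} f / c"
proof -
  let ?g = "\<lambda>x. c * x + t"
  have im: "?g ` {a..b} = {c * a + t..c * b + t}" using c ab by (simp add: image_affinity_atLeastAtMost)
  have der: "(?g has_field_derivative c) (at x within {a..b})" for x by (auto intro!: derivative_eq_intros)
  have inj: "inj_on ?g {a..b}" using c by (simp add: inj_on_def)
  have "(\<lambda>x. \<bar>c\<bar> * f (?g x)) absolutely_integrable_on {a..b} \<and>
    integral {a..b} (\<lambda>x. \<bar>c\<bar> * f (?g x)) = integral {c * a + t..c * b + t} f"
    using has_absolute_integral_change_of_variables_1'[OF _ der inj, of f "integral {c * a + t..c * b + t} f"] f im by simp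
  then show "(\<lambda>x. f (?g x)) absolutely_integrable_on {a..b}"
    "integral {a..b} (\<lambda>x. f (?g x)) = integral {c * a + t..c * b + t} f / c"
    using c by (auto simp: field_simps)
qed

lemma absolutely_integrable_join:
  fixes f :: "real \<Rightarrow> real"
  assumes "a \<le> c" "c \<le> b" "f absolutely_integrable_on {a..c}" "f absolutely_integrable_on {c..b}"
  shows "f absolutely_integrable_on {a..b}" "integral {a..b} f = integral {a..c} f + integral {c..b} f"
proof -
  have "{a..b} = {a..c} \<union> {c..b}" using assms(1,2) by auto
  then show *: "f absolutely_integrable_on {a..b}" using absolutely_integrable_Un[OF assms(3,4)] by simp
  show "integral {a..b} f = integral {a..c} f + integral {c..b} f"
    by (rule Henstock_Kurzweil_Integration.integral_combine[OF assms(1,2), symmetric])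
      (use * in \<open>simp add: absolutely_integrable_on_def\<close>)
qed

lemma absolutely_integrable_subinterval:
  fixes f :: "real \<Rightarrow> real"
  assumes "f absolutely_integrable_on {a..b}" "a \<le> c" "d \<le> b"
  shows "f absolutely_integrable_on {c..d}"
  using absolutely_integrable_on_subcbox[where f=f and S="{a..b}" and a=c and b=d] assms by auto

lemma integral_periodic:
  fixes f :: "real \<Rightarrow> real"
  assumes T: "0 < T" and f: "f absolutely_integrable_on {0..T}" "\<And>x. f (x + T) = f x"
  shows "f absolutely_integrable_on {0..real n * T} \<and> integral {0..real n * T} f = real n * integral {0..T} f"
proof (induction n)
  case (Suc n)
  have per: "f (x + real n * T) = f x" for x n
  proof (induction n)
    case (Suc n)
    have "f (x + real (Suc n) * T) = f ((x + real n * T) + T)" by (simp add: algebra_simps)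
    then show ?case using f(2) Suc by simp
  qed simp
  have *: "(\<lambda>x. f (1 * x + - (real n * T))) = f"
    using per[of "x - real n * T" n for x] by (auto simp: fun_eq_iff)
  have "f absolutely_integrable_on {1 * (real n * T) + - (real n * T)..1 * (real (Suc n) * T) + - (real n * T)}"
    using f(1) by (simp add: algebra_simps)
  note aff = absolutely_integrable_affine[OF zero_less_one _ this, unfolded *]
  have le: "real n * T \<le> real (Suc n) * T" using T by (simp add: mult_right_mono)
  have "f absolutely_integrable_on {real n * T..real (Suc n) * T}"
    "integral {real n * T..real (Suc n) * T} f = integral {0..T} f"
    using aff[OF le] by (simp_all add: algebra_simps)
  moreover have "0 \<le> real n * T" using T by simp
  ultimately show ?case
    using absolutely_integrable_join[of 0 "real n * T" "real (Suc n) * T" f] le Suc by (simp add: algebra_simps)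
next
  case 0
  then show ?case using absolutely_integrable_subinterval[OF f(1), of 0 0] T by simp
qed

lemma integral_periodic_shift:
  fixes f :: "real \<Rightarrow> real"
  assumes T: "0 < T" and f: "f absolutely_integrable_on {0..T}" "\<And>x. f (x + T) = f x" and a: "0 \<le> a" "a \<le> T"
  shows "integral {0..T} (\<lambda>x. f (x + a)) = integral {0..T} f"
proof -
  have "f absolutely_integrable_on {0..real 2 * T}" using integral_periodic[OF T f] by blast
  then have f2: "f absolutely_integrable_on {0..2 * T}" by simp
  have sub: "f absolutely_integrable_on {c..d}" if "0 \<le> c" "d \<le> 2 * T" for c d
    using absolutely_integrable_subinterval[OF f2] that by auto
  have "integral {0..T} (\<lambda>x. f (1 * x + a)) = integral {1 * 0 + a..1 * T + a} f / 1"
    using T a by (intro absolutely_integrable_affine(2) sub) auto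
  then have "integral {0..T} (\<lambda>x. f (x + a)) = integral {a..T + a} f" by simp
  also have "\<dots> = integral {a..T} f + integral {T..T + a} f"
    using a T by (intro absolutely_integrable_join(2) sub) auto
  also have "integral {0..a} (\<lambda>x. f (1 * x + T)) = integral {1 * 0 + T..1 * a + T} f / 1"
    using T a by (intro absolutely_integrable_affine(2) sub) auto
  then have "integral {T..T + a} f = integral {0..a} f" by (simp add: f(2) add.commute)
  also have "integral {a..T} f + integral {0..a} f = integral {0..T} f"
    using absolutely_integrable_join(2)[of 0 a T f] a T sub by simp
  finally show ?thesis .
qed

text \<open>Under \<open>x = cos t\<close> the measure \<open>w2 dx\<close> becomes
  \<open>(sin t)^2\<close> times this function at \<open>k t\<close>. As a weight in
  \<open>y = cos t\<close> it is \<open>(1 - y^2)^(\<alpha> - 1/2) |y|^\<gamma>\<close>.\<close>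

definition ang_weight :: "real \<Rightarrow> real \<Rightarrow> real \<Rightarrow> real" where
  "ang_weight \<alpha> \<gamma> t = \<bar>sin t\<bar> powr (2 * \<alpha>) * \<bar>cos t\<bar> powr \<gamma>"

lemma ang_weight_pi [simp]: "ang_weight \<alpha> \<gamma> (t + pi) = ang_weight \<alpha> \<gamma> t"
  by (simp add: ang_weight_def)

text \<open>The substitution \<open>y = (cos t)^2\<close> turns the moment into a Beta integral. It
  is injective only on half of [0, pi], and open intervals avoid the points where sine or cosine
  vanishes.\<close>

lemma ang_weight_moment_piece:
  fixes \<alpha> \<gamma> :: real
  assumes \<alpha>: "\<alpha> > - 1 / 2" and \<gamma>: "\<gamma> > - 1" and S: "S = {0<..<pi / 2} \<or> S = {pi / 2<..<pi}"
  shows "(\<lambda>t. cos t ^ (2 * j) * ang_weight \<alpha> \<gamma> t) absolutely_integrable_on S \<and>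
    integral S (\<lambda>t. cos t ^ (2 * j) * ang_weight \<alpha> \<gamma> t) = Beta (real j + (\<gamma> + 1) / 2) (\<alpha> + 1 / 2) / 2"
proof -
  define a b where "a = real j + (\<gamma> + 1) / 2" and "b = \<alpha> + 1 / 2"
  have ab: "0 < a" "0 < b" using \<alpha> \<gamma> by (auto simp: a_def b_def add_nonneg_pos)
  let ?f = "\<lambda>t::real. t powr (a - 1) * (1 - t) powr (b - 1)"
  let ?g = "\<lambda>t. (cos t)\<^sup>2"
  have f01: "(?f has_integral Beta a b) {0..1}" by (rule has_integral_Beta_real[OF ab])
  have "?f absolutely_integrable_on {0..1}"
    using f01 by (intro nonnegative_absolutely_integrable_1) (auto simp: has_integral_integrable_integral)
  then have f1: "?f absolutely_integrable_on {0<..<1}" by (simp add: absolutely_integrable_on_Icc_iff_Ioo)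
  have f2: "integral {0<..<1} ?f = Beta a b" using f01 integral_open_interval_real[of 0 1 ?f] by (simp add: has_integral_iff)
  have S0: "0 < sin t" "cos t \<noteq> 0" "0 < t" "t < pi" if "t \<in> S" for t
  proof -
    show t: "0 < t" "t < pi" using that S pi_gt_zero by auto
    then show "0 < sin t" by (rule sin_gt_zero)
    show "cos t \<noteq> 0" using that S cos_gt_zero[of t] cos_lt_zero_pi[of t] by (elim disjE) auto
  qed
  have inj: "inj_on ?g S"
  proof (rule inj_onI)
    fix x y assume xy: "x \<in> S" "y \<in> S" "?g x = ?g y"
    then have "cos x = cos y \<or> cos x = - cos y" by (simp add: power2_eq_iff)
    moreover have "cos x \<noteq> - cos y"
      using S xy cos_gt_zero[of x] cos_gt_zero[of y] cos_lt_zero_pi[of x] cos_lt_zero_pi[of y] by (elim disjE) auto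
    ultimately have c: "cos x = cos y" by blast
    have "0 \<le> x" "x \<le> pi" "0 \<le> y" "y \<le> pi" using S0(3,4)[OF xy(1)] S0(3,4)[OF xy(2)] by simp_all
    then show "x = y" using c by (rule cos_inj_pi)
  qed
  have im: "?g ` S = {0<..<1}"
  proof (intro equalityI subsetI)
    fix y assume "y \<in> ?g ` S"
    then obtain t where t: "t \<in> S" "y = (cos t)\<^sup>2" by blast
    have "0 < (sin t)\<^sup>2" "0 < (cos t)\<^sup>2" using S0[OF t(1)] by auto
    then show "y \<in> {0<..<1}" unfolding t(2) greaterThanLessThan_iff using sin_cos_squared_add[of t] by linarith
  next
    fix y :: real assume y: "y \<in> {0<..<1}"
    define s where "s = sqrt y"
    have s: "0 < s" "s < 1" "s\<^sup>2 = y" using y by (auto simp: s_def)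
    from S show "y \<in> ?g ` S"
    proof
      assume S1: "S = {0<..<pi / 2}"
      have "arccos s < pi / 2" using s arccos_less_arccos[of 0 s] by (simp add: arccos_0)
      moreover have "0 < arccos s" using s arccos_lt_bounded[of s] by simp
      ultimately have "arccos s \<in> S" using S1 by simp
      then show ?thesis using s by (intro image_eqI[of _ _ "arccos s"]) (auto simp: cos_arccos)
    next
      assume S1: "S = {pi / 2<..<pi}"
      have "pi / 2 < arccos (- s)" using s arccos_less_arccos[of "-s" 0] by (simp add: arccos_0)
      moreover have "arccos (- s) < pi" using s arccos_lt_bounded[of "-s"] by simp
      ultimately have "arccos (- s) \<in> S" using S1 by simp
      then show ?thesis using s by (intro image_eqI[of _ _ "arccos (- s)"]) (auto simp: cos_arccos)
    qed
  qed
  have der: "(?g has_field_derivative (- 2 * cos t * sin t)) (at t within S)" for t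
    by (auto intro!: derivative_eq_intros)
  have "S \<in> sets lebesgue" using S by auto
  from has_absolute_integral_change_of_variables_1'[OF this der inj, of ?f "Beta a b"]
  have i: "(\<lambda>t. \<bar>- 2 * cos t * sin t\<bar> * ?f (?g t)) absolutely_integrable_on S"
    "integral S (\<lambda>t. \<bar>- 2 * cos t * sin t\<bar> * ?f (?g t)) = Beta a b"
    using f1 f2 im by auto
  have eq: "\<bar>- 2 * cos t * sin t\<bar> * ?f (?g t) = 2 * (cos t ^ (2 * j) * ang_weight \<alpha> \<gamma> t)" if "t \<in> S" for t
  proof -
    have s: "0 < \<bar>sin t\<bar>" and c: "0 < \<bar>cos t\<bar>" using S0[OF that] by auto
    have sq: "x\<^sup>2 powr e = \<bar>x\<bar> powr (2 * e)" if "0 < \<bar>x\<bar>" for x e :: real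
    proof -
      have "x\<^sup>2 = \<bar>x\<bar> powr 2" using that by (simp add: powr_numeral)
      then show ?thesis by (simp only: powr_powr)
    qed
    have "(cos t)\<^sup>2 powr (a - 1) = \<bar>cos t\<bar> powr (2 * (a - 1))"
      by (rule sq[OF c])
    moreover have "1 - (cos t)\<^sup>2 = (sin t)\<^sup>2" by (simp add: sin_squared_eq)
    moreover have "(sin t)\<^sup>2 powr (b - 1) = \<bar>sin t\<bar> powr (2 * (b - 1))"
      by (rule sq[OF s])
    ultimately have "\<bar>- 2 * cos t * sin t\<bar> * ?f (?g t)
      = 2 * ((\<bar>cos t\<bar> powr 1 * \<bar>cos t\<bar> powr (2 * (a - 1))) * (\<bar>sin t\<bar> powr 1 * \<bar>sin t\<bar> powr (2 * (b - 1))))"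
      using s c by (simp add: abs_mult)
    also have "\<dots> = 2 * (\<bar>cos t\<bar> powr (real (2 * j) + \<gamma>) * \<bar>sin t\<bar> powr (2 * \<alpha>))"
    proof -
      have e: "1 + 2 * (a - 1) = real (2 * j) + \<gamma>" "1 + 2 * (b - 1) = 2 * \<alpha>" by (simp_all add: a_def b_def field_simps)
      show ?thesis unfolding powr_add[symmetric] e ..
    qed
    also have "\<bar>cos t\<bar> powr (real (2 * j) + \<gamma>) = cos t ^ (2 * j) * \<bar>cos t\<bar> powr \<gamma>"
      using c unfolding powr_add by (subst powr_realpow) (simp_all add: power_mult)
    finally show ?thesis by (simp add: ang_weight_def mult_ac)
  qed
  have "(\<lambda>t. 2 * (cos t ^ (2 * j) * ang_weight \<alpha> \<gamma> t)) absolutely_integrable_on S"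
    using i(1) eq by (subst (asm) set_integrable_cong[OF refl refl eq]) auto
  moreover have "integral S (\<lambda>t. 2 * (cos t ^ (2 * j) * ang_weight \<alpha> \<gamma> t)) = Beta a b"
    using i(2) eq by (subst (asm) Henstock_Kurzweil_Integration.integral_cong[OF eq]) auto
  ultimately show ?thesis unfolding a_def b_def by simp
qed

lemma ang_weight_moment:
  fixes \<alpha> \<gamma> :: real
  assumes "\<alpha> > - 1 / 2" "\<gamma> > - 1"
  shows "(\<lambda>t. cos t ^ (2 * j) * ang_weight \<alpha> \<gamma> t) absolutely_integrable_on {0..pi}"
    and "integral {0..pi} (\<lambda>t. cos t ^ (2 * j) * ang_weight \<alpha> \<gamma> t) = Beta (real j + (\<gamma> + 1) / 2) (\<alpha> + 1 / 2)"
  using absolutely_integrable_join[of 0 "pi / 2" pi "\<lambda>t. cos t ^ (2 * j) * ang_weight \<alpha> \<gamma> t"]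
    ang_weight_moment_piece[OF assms, of "{0<..<pi / 2}" j] ang_weight_moment_piece[OF assms, of "{pi / 2<..<pi}" j]
  by (auto simp: absolutely_integrable_on_Icc_iff_Ioo integral_open_interval_real)

section \<open>The weighted functional on the circle\<close>

context
  fixes k :: nat and \<alpha> \<gamma> :: real
  assumes k: "2 \<le> k" and \<alpha>: "\<alpha> > - 1 / 2" and \<gamma>: "\<gamma> > - 1"
begin

definition Phi :: "(real \<Rightarrow> real) \<Rightarrow> real" where
  "Phi F = integral {0..2 * pi} (\<lambda>t. F t * ang_weight \<alpha> \<gamma> (real k * t))"

text \<open>Up to a positive factor, the moment functional of
  \<open>(1 - y^2)^(\<alpha> - 1/2) |y|^\<gamma>\<close> on [-1, 1], kept on the circle for direct
  comparison with \<open>Phi\<close>.\<close>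

definition ell :: "real poly \<Rightarrow> real" where
  "ell q = Phi (\<lambda>t. poly q (cos (real k * t)))"

lemma ang_weight_k_moment:
  "(\<lambda>t. cos (real k * t) ^ (2 * j) * ang_weight \<alpha> \<gamma> (real k * t)) absolutely_integrable_on {0..2 * pi}"
  "integral {0..2 * pi} (\<lambda>t. cos (real k * t) ^ (2 * j) * ang_weight \<alpha> \<gamma> (real k * t)) =
    2 * Beta (real j + (\<gamma> + 1) / 2) (\<alpha> + 1 / 2)"
proof -
  let ?f = "\<lambda>t. cos t ^ (2 * j) * ang_weight \<alpha> \<gamma> t"
  have "?f (t + pi) = ?f t" for t by (simp add: power_mult)
  then have p: "?f absolutely_integrable_on {0..real (2 * k) * pi} \<and> integral {0..real (2 * k) * pi} ?f = real (2 * k) * integral {0..pi} ?f"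
    by (intro integral_periodic ang_weight_moment(1)[OF \<alpha> \<gamma>] pi_gt_zero)
  have "?f absolutely_integrable_on {real k * 0 + 0..real k * (2 * pi) + 0}" using p by (simp add: mult_ac)
  note aff = absolutely_integrable_affine[OF _ _ this]
  have "0 < real k" using k by simp
  note aff = aff[OF this]
  show "(\<lambda>t. cos (real k * t) ^ (2 * j) * ang_weight \<alpha> \<gamma> (real k * t)) absolutely_integrable_on {0..2 * pi}"
    using aff(1) by simp
  show "integral {0..2 * pi} (\<lambda>t. cos (real k * t) ^ (2 * j) * ang_weight \<alpha> \<gamma> (real k * t)) =
    2 * Beta (real j + (\<gamma> + 1) / 2) (\<alpha> + 1 / 2)"
    using aff(2) p ang_weight_moment(2)[OF \<alpha> \<gamma>, of j] k by (simp add: mult_ac)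
qed

lemma ang_weight_k_absint: "(\<lambda>t. ang_weight \<alpha> \<gamma> (real k * t)) absolutely_integrable_on {0..2 * pi}"
  using ang_weight_k_moment(1)[of 0] by simp

lemma Phi_integrable:
  assumes "continuous_on {0..2 * pi} F"
  shows "(\<lambda>t. F t * ang_weight \<alpha> \<gamma> (real k * t)) absolutely_integrable_on {0..2 * pi}"
  by (rule absolutely_integrable_continuous_mult[OF assms ang_weight_k_absint])

lemma Phi_add:
  assumes "continuous_on {0..2 * pi} F" "continuous_on {0..2 * pi} G"
  shows "Phi (\<lambda>t. F t + G t) = Phi F + Phi G"
  unfolding Phi_def distrib_right using Phi_integrable[OF assms(1)] Phi_integrable[OF assms(2)]
  by (intro Henstock_Kurzweil_Integration.integral_add) (auto simp: absolutely_integrable_on_def)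

lemma Phi_cmult: "Phi (\<lambda>t. c * F t) = c * Phi F"
  unfolding Phi_def mult.assoc by simp

lemma Phi_diff:
  assumes "continuous_on {0..2 * pi} F" "continuous_on {0..2 * pi} G"
  shows "Phi (\<lambda>t. F t - G t) = Phi F - Phi G"
  using Phi_add[of F "\<lambda>t. - 1 * G t"] Phi_cmult[of "- 1" G] assms by (auto intro!: continuous_intros)

text \<open>The weight has period \<open>pi / k\<close> and \<open>F\<close> has period
  \<open>2 * pi\<close>, so shifting by a multiple of \<open>pi / k\<close> only moves the interval
  of integration.\<close>

lemma Phi_shift:
  assumes F: "continuous_on UNIV F" "\<And>t. F (t + 2 * pi) = F t" and n: "n \<le> k"
  shows "Phi (\<lambda>t. F (t + real n * pi / real k)) = Phi F"
proof -
  let ?f = "\<lambda>t. F t * ang_weight \<alpha> \<gamma> (real k * t)"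
  have per: "ang_weight \<alpha> \<gamma> (t + real m * pi) = ang_weight \<alpha> \<gamma> t" for t m
  proof (induction m)
    case (Suc m)
    have "t + real (Suc m) * pi = (t + real m * pi) + pi" by (simp add: algebra_simps)
    then show ?case using Suc by (simp only: ang_weight_pi)
  qed simp
  have "real k * (t + real n * pi / real k) = real k * t + real n * pi" for t using k by (simp add: field_simps)
  then have "Phi (\<lambda>t. F (t + real n * pi / real k)) = integral {0..2 * pi} (\<lambda>t. ?f (t + real n * pi / real k))"
    unfolding Phi_def by (simp only: per)
  also have "\<dots> = integral {0..2 * pi} ?f"
  proof (rule integral_periodic_shift)
    show "?f absolutely_integrable_on {0..2 * pi}" using F(1) by (intro Phi_integrable) (rule continuous_on_subset, auto)
    show "?f (t + 2 * pi) = ?f t" for t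
      using per[of "real k * t" "2 * k"] F(2)[of t] by (simp add: algebra_simps)
    have "real n * pi / real k \<le> real k * pi / real k" using n k by (intro divide_right_mono mult_right_mono) auto
    then have "real n * pi / real k \<le> pi" using k by simp
    then show "real n * pi / real k \<le> 2 * pi" using pi_gt_zero by linarith
  qed (use k in auto)
  finally show ?thesis by (simp add: Phi_def)
qed

lemma cos_int_periodic: "cos (real_of_int l * (t + 2 * pi)) = cos (real_of_int l * t)"
  "sin (real_of_int l * (t + 2 * pi)) = sin (real_of_int l * t)"
proof -
  have e: "real_of_int l * (t + 2 * pi) = real_of_int l * t + 2 * pi * real_of_int l" by (simp add: algebra_simps)
  show "cos (real_of_int l * (t + 2 * pi)) = cos (real_of_int l * t)"
    "sin (real_of_int l * (t + 2 * pi)) = sin (real_of_int l * t)"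
    unfolding e cos_add sin_add by (simp_all add: cos_int_2pin sin_int_2pin)
qed

lemma cos_nat_periodic: "cos (real n * (t + 2 * pi)) = cos (real n * t)"
  using cos_int_periodic(1)[of "int n" t] by simp

text \<open>Only the Fourier modes divisible by \<open>k\<close> survive, since the weight has period \<open>2 \<pi> / k\<close>.\<close>

lemma Phi_mode_vanish:
  assumes l: "\<not> int k dvd l"
  shows "Phi (\<lambda>t. cos (real_of_int l * t) * poly q (cos (real k * t))) = 0"
proof -
  \<comment> \<open>The shift by \<open>2 pi / k\<close> fixes \<open>cos (k t)\<close> and rotates
    the pair of cosine and sine integrals by the angle \<open>l * \<delta>\<close>. This is no
    multiple of \<open>2 pi\<close>, so the invariant pair must be zero.\<close>
  define \<delta> where "\<delta> = real 2 * pi / real k"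
  let ?G = "\<lambda>t. poly q (cos (real k * t))"
  let ?C = "\<lambda>t. cos (real_of_int l * t) * ?G t" and ?S = "\<lambda>t. sin (real_of_int l * t) * ?G t"
  have cont: "continuous_on A ?C" "continuous_on A ?S" for A by (auto intro!: continuous_intros)
  have G: "?G (t + \<delta>) = ?G t" for t
  proof -
    have "real k * (t + \<delta>) = real k * t + 2 * pi" using k by (simp add: \<delta>_def field_simps)
    then show ?thesis by simp
  qed
  have perC: "?C (t + 2 * pi) = ?C t" and perS: "?S (t + 2 * pi) = ?S t" for t
    by (simp_all only: cos_int_periodic cos_nat_periodic)
  define c s where "c = Phi ?C" and "s = Phi ?S"
  define C S where "C = cos (real_of_int l * \<delta>)" and "S = sin (real_of_int l * \<delta>)"
  have "c = Phi (\<lambda>t. ?C (t + \<delta>))" unfolding c_def \<delta>_def by (rule Phi_shift[symmetric]) (use cont perC k in auto)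
  also have "\<dots> = Phi (\<lambda>t. C * ?C t - S * ?S t)"
    unfolding G by (simp add: C_def S_def distrib_left cos_add algebra_simps)
  also have "\<dots> = C * c - S * s"
    using cont by (subst Phi_diff) (auto intro!: continuous_intros simp: Phi_cmult c_def s_def)
  finally have 1: "c = C * c - S * s" .
  have "s = Phi (\<lambda>t. ?S (t + \<delta>))" unfolding s_def \<delta>_def by (rule Phi_shift[symmetric]) (use cont perS k in auto)
  also have "\<dots> = Phi (\<lambda>t. S * ?C t + C * ?S t)"
    unfolding G by (simp add: C_def S_def distrib_left sin_add algebra_simps)
  also have "\<dots> = S * c + C * s"
    using cont by (subst Phi_add) (auto intro!: continuous_intros simp: Phi_cmult c_def s_def)
  finally have 2: "s = S * c + C * s" .
  have "C \<noteq> 1"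
  proof
    assume "C = 1"
    then obtain n :: int where "real_of_int l * \<delta> = real_of_int n * 2 * pi" unfolding C_def cos_one_2pi_int by blast
    then have "real_of_int l = real_of_int n * real k" using k by (simp add: \<delta>_def field_simps)
    then have "l = n * int k" by (metis of_int_eq_iff of_int_mult of_int_of_nat_eq)
    then show False using l by simp
  qed
  have "((1 - C)\<^sup>2 + S\<^sup>2) * c = 0" using 1 2 by algebra
  moreover have "0 < (1 - C)\<^sup>2 + S\<^sup>2" using \<open>C \<noteq> 1\<close> by (intro add_pos_nonneg) auto
  ultimately have "c = 0" by (metis less_irrefl mult_eq_0_iff)
  then show ?thesis by (simp add: c_def)
qed

section \<open>The moment functional and its Pearson equation\<close>

lemma ell_add: "ell (p + q) = ell p + ell q"
  unfolding ell_def poly_add by (rule Phi_add) (auto intro!: continuous_intros)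

lemma ell_diff: "ell (p - q) = ell p - ell q"
  unfolding ell_def poly_diff by (rule Phi_diff) (auto intro!: continuous_intros)

lemma ell_smult: "ell (smult c p) = c * ell p"
  unfolding ell_def poly_smult by (rule Phi_cmult)

lemma ell_0 [simp]: "ell 0 = 0"
  by (simp add: ell_def Phi_def)

lemma ell_sum: "ell (\<Sum>i\<in>I. f i) = (\<Sum>i\<in>I. ell (f i))"
  by (induction I rule: infinite_finite_induct) (auto simp: ell_add)

text \<open>A shift by \<open>pi / k\<close> reverses the sign of \<open>cos (k t)\<close> and
  preserves the weight.\<close>

lemma ell_odd:
  assumes "\<And>x. poly q (- x) = - poly q x"
  shows "ell q = 0"
proof -
  let ?G = "\<lambda>t. poly q (cos (real k * t))"
  have G: "?G (t + real 1 * pi / real k) = - 1 * ?G t" for t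
  proof -
    have "real k * (t + real 1 * pi / real k) = real k * t + pi" using k by (simp add: field_simps)
    then show ?thesis by (simp add: assms)
  qed
  have "ell q = Phi (\<lambda>t. ?G (t + real 1 * pi / real k))"
    unfolding ell_def using k by (intro Phi_shift[symmetric]) (auto intro!: continuous_intros simp only: cos_nat_periodic)
  also have "\<dots> = - ell q" unfolding G Phi_cmult ell_def by simp
  finally show ?thesis by simp
qed

lemma ell_pos: "0 < ell 1"
proof -
  have "ell 1 = 2 * Beta ((\<gamma> + 1) / 2) (\<alpha> + 1 / 2)"
    using ang_weight_k_moment(2)[of 0] by (simp add: ell_def Phi_def)
  moreover have "0 < Beta ((\<gamma> + 1) / 2) (\<alpha> + 1 / 2)"
  proof -
    have "0 < (\<gamma> + 1) / 2" "0 < \<alpha> + 1 / 2" using \<alpha> \<gamma> by simp_all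
    moreover from this have "0 < (\<gamma> + 1) / 2 + (\<alpha> + 1 / 2)" by (rule add_pos_pos)
    ultimately show ?thesis unfolding Beta_def
      by (rule divide_pos_pos[OF mult_pos_pos[OF Gamma_real_pos Gamma_real_pos] Gamma_real_pos])
  qed
  ultimately show ?thesis by simp
qed

text \<open>Even moments are Beta values with first argument \<open>(i + \<gamma> + 1) / 2\<close>,
  and the functional equation of Beta links consecutive ones; odd moments vanish by
  symmetry.\<close>

lemma ell_monom_rec:
  "(2 * \<alpha> + \<gamma> + 2 + real i) * ell (monom 1 (i + 2)) = (real i + \<gamma> + 1) * ell (monom 1 i)"
proof (cases "even i")
  case True
  then obtain j where j: "i = 2 * j" by (auto elim: evenE)
  define x y where "x = real j + (\<gamma> + 1) / 2" and "y = \<alpha> + 1 / 2"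
  have m: "ell (monom 1 (2 * j)) = 2 * Beta (real j + (\<gamma> + 1) / 2) (\<alpha> + 1 / 2)" for j
    using ang_weight_k_moment(2)[of j] by (simp add: ell_def Phi_def poly_monom)
  have "0 < x" using \<gamma> by (auto simp: x_def add_nonneg_pos)
  then have "x \<notin> \<int>\<^sub>\<le>\<^sub>0" by (auto elim!: nonpos_Ints_cases)
  then have B: "(x + y) * Beta (x + 1) y = x * Beta x y" by (rule Beta_plus1_left)
  have "2 * (x + y) * (2 * Beta (x + 1) y) = 4 * ((x + y) * Beta (x + 1) y)" by (simp only: mult_ac)
  also have "\<dots> = 2 * x * (2 * Beta x y)" unfolding B by simp
  finally have "2 * (x + y) * (2 * Beta (x + 1) y) = 2 * x * (2 * Beta x y)" .
  moreover have "ell (monom 1 i) = 2 * Beta x y" using m[of j] by (simp add: j x_def y_def)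
  moreover have "ell (monom 1 (i + 2)) = 2 * Beta (x + 1) y" using m[of "Suc j"] by (simp add: j x_def y_def add_ac)
  moreover have "2 * \<alpha> + \<gamma> + 2 + real i = 2 * (x + y)" "real i + \<gamma> + 1 = 2 * x" by (auto simp: j x_def y_def)
  ultimately show ?thesis by (simp only:)
next
  case False
  then have "ell (monom 1 i) = 0" "ell (monom 1 (i + 2)) = 0"
    by (auto intro!: ell_odd simp: poly_monom)
  then show ?thesis by simp
qed

text \<open>The Pearson equation of the weight \<open>(1 - y\<^sup>2)\<^sup>\<alpha>\<^sup>-\<^sup>1\<^sup>/\<^sup>2 \<bar>y\<bar>\<^sup>\<gamma>\<close>, i.e. integration by parts.\<close>

lemma ell_pearson:
  "ell ([:1, 0, -1:] * ([:0, 1:] * pderiv q) + [:\<gamma> + 1, 0, - (2 * \<alpha> + \<gamma> + 2):] * q) = 0"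
proof -
  define L where "L q = [:1, 0, -1:] * ([:0, 1:] * pderiv q) + [:\<gamma> + 1, 0, - (2 * \<alpha> + \<gamma> + 2):] * q" for q :: "real poly"
  have L1: "L (monom c i) = smult c (smult (real i + \<gamma> + 1) (monom 1 i) - smult (2 * \<alpha> + \<gamma> + 2 + real i) (monom 1 (i + 2)))" for c i
    by (rule poly_ext) (cases i; simp add: L_def pderiv_monom poly_monom algebra_simps)
  have L2: "ell (L (monom c i)) = 0" for c i
    unfolding L1 ell_smult ell_diff ell_monom_rec by simp
  have L3: "L (p + q) = L p + L q" for p q unfolding L_def pderiv_add by (simp only: algebra_simps)
  have L0: "L 0 = 0" by (simp add: L_def)
  have "L (\<Sum>i\<in>I. f i) = (\<Sum>i\<in>I. L (f i))" for f and I :: "nat set"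
    by (induction I rule: infinite_finite_induct) (auto simp: L3 L0)
  then have "ell (L (\<Sum>i\<le>degree q. monom (poly.coeff q i) i)) = 0" by (simp add: ell_sum L2)
  then show ?thesis unfolding poly_as_sum_of_monoms L_def .
qed

abbreviation (input) ultra_r :: "nat \<Rightarrow> real poly" where
  "ultra_r n \<equiv> rwp (ultra_A \<alpha> \<gamma>) (\<lambda>n. 1 - ultra_A \<alpha> \<gamma> n) n"

text \<open>For \<open>V = r (2 m + 1) / y\<close> the Pearson expression is the right side of the
  structure relation minus \<open>K y r (2 m + 1)\<close>, so the two means agree. The recurrence
  then passes to the next even index.\<close>

lemma ell_ultra_step:
  "ell (ultra_r (2 * m)) = ell ([:0, 1:] * ultra_r (Suc (2 * m)))"
  "ell (ultra_r (2 * m + 2)) = ell (ultra_r (2 * m))"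
proof -
  let ?K = "2 * real m + 2 * \<alpha> + \<gamma> + 2"
  obtain V where R: "ultra_r (Suc (2 * m)) = [:0, 1:] * V"
    using rwp_odd_at_0[of "ultra_A \<alpha> \<gamma>" "\<lambda>n. 1 - ultra_A \<alpha> \<gamma> n" m] by (auto simp: poly_eq_0_iff_dvd dvd_def)
  note E = mass_prop_identity[OF \<alpha> \<gamma> rw_coeffs_ultra[OF \<alpha> \<gamma>] mass_prop_ultra[OF \<alpha> \<gamma>] R]
  have "[:1, 0, -1:] * ([:0, 1:] * pderiv V) + [:\<gamma> + 1, 0, - (2 * \<alpha> + \<gamma> + 2):] * V
    = smult ?K (ultra_r (2 * m)) - smult ?K ([:0, 1:] * ultra_r (Suc (2 * m)))"
    unfolding E unfolding R by (rule poly_ext) (simp add: algebra_simps)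
  then have "?K * ell (ultra_r (2 * m)) - ?K * ell ([:0, 1:] * ultra_r (Suc (2 * m))) = 0"
    using ell_pearson[of V] by (simp only: ell_diff ell_smult)
  moreover have "?K \<noteq> 0" using \<alpha> \<gamma> by linarith
  ultimately show 1: "ell (ultra_r (2 * m)) = ell ([:0, 1:] * ultra_r (Suc (2 * m)))" by simp
  let ?a = "ultra_A \<alpha> \<gamma> (Suc (2 * m))"
  have a: "?a \<noteq> 0" using rw_coeffs_ultra[OF \<alpha> \<gamma>] unfolding rw_coeffs_def by (metis less_irrefl)
  have "[:0, 1:] * ultra_r (Suc (2 * m)) = smult ?a (ultra_r (Suc (Suc (2 * m)))) + smult (1 - ?a) (ultra_r (2 * m))"
    by (rule poly_ext) (use poly_rwp_rec[where a="ultra_A \<alpha> \<gamma>" and n="2 * m" and b="\<lambda>n. 1 - ultra_A \<alpha> \<gamma> n" and 'a=real, OF a] in simp)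
  then have "ell ([:0, 1:] * ultra_r (Suc (2 * m))) = ?a * ell (ultra_r (Suc (Suc (2 * m)))) + (1 - ?a) * ell (ultra_r (2 * m))"
    by (simp only: ell_add ell_smult)
  then show "ell (ultra_r (2 * m + 2)) = ell (ultra_r (2 * m))" using 1 a by (simp add: algebra_simps)
qed

text \<open>These are the cancellations needed at the block boundaries. The means themselves need
  not vanish: all those of even index equal \<open>ell 1\<close>.\<close>

lemma ell_ultra:
  "ell (ultra_r (Suc n)) = ell ([:0, 1:] * ultra_r n)" "ell (ultra_r n) = ell ([:0, 1:] * ultra_r (Suc n))"
proof -
  have odd: "ell (ultra_r (Suc (2 * m))) = 0" "ell ([:0, 1:] * ultra_r (2 * m)) = 0" for m
    by (auto intro!: ell_odd simp: poly_rwp_minus)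
  show "ell (ultra_r (Suc n)) = ell ([:0, 1:] * ultra_r n)"
  proof (cases "even n")
    case True
    then obtain m where "n = 2 * m" by (auto elim: evenE)
    then show ?thesis using odd by (simp only:)
  next
    case False
    then obtain m where "n = Suc (2 * m)" by (auto elim: oddE)
    then show ?thesis using ell_ultra_step[of m] by simp
  qed
  show "ell (ultra_r n) = ell ([:0, 1:] * ultra_r (Suc n))"
  proof (cases "even n")
    case True
    then obtain m where "n = 2 * m" by (auto elim: evenE)
    then show ?thesis using ell_ultra_step(1)[of m] by (simp only:)
  next
    case False
    then obtain m where m: "n = Suc (2 * m)" by (auto elim: oddE)
    show ?thesis using odd(1)[of m] odd(2)[of "Suc m"] by (simp only: m mult_Suc_right add_2_eq_Suc)
  qed
qed

text \<open>Multiplied by \<open>(sin t)^2\<close>, the polynomial of index \<open>n k + j\<close>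
  splits into modes \<open>cos (l t)\<close> times polynomials in \<open>cos (k t)\<close>, with
  \<open>l\<close> among \<open>j\<close>, \<open>j + 2\<close>, \<open>k - 2 - j\<close>,
  \<open>k - j\<close>. Only for \<open>j = 0\<close> and \<open>j = k - 2\<close> is some
  \<open>l\<close> a multiple of \<open>k\<close>; the survivors cancel in pairs by
  \<open>ell_ultra\<close> for \<open>n > 0\<close>, and parity settles block 0.\<close>

lemma Phi_sieved_ultra:
  "Phi (\<lambda>t. (sin t)\<^sup>2 * poly (rwp (sieve k (ultra_A \<alpha> \<gamma>)) (sieve k (\<lambda>n. 1 - ultra_A \<alpha> \<gamma> n)) i) (cos t)) =
    (if i = 0 then ell 1 / 2 else 0)"
proof -
  let ?A = "ultra_A \<alpha> \<gamma>" and ?B = "\<lambda>n. 1 - ultra_A \<alpha> \<gamma> n"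
  define n j where "n = i div k" and "j = i mod k"
  have ij: "i = n * k + j" "j < k" using k by (auto simp: n_def j_def)
  define R where "R = (if n = 0 then 0 else ultra_r (n - 1))"
  define T where "T l q = Phi (\<lambda>t. cos (real_of_int l * t) * poly q (cos (real k * t)))" for l q
  \<comment> \<open>Among the modes that can occur, 0 and \<open>k\<close> are the only multiples of
    \<open>k\<close>.\<close>
  have Tval: "T l q = (if l = 0 then ell q else if l = int k then ell ([:0, 1:] * q) else 0)"
    if l: "- int k < l" "l < 2 * int k" for l q
  proof (cases "int k dvd l")
    case True
    then obtain d where d: "l = int k * d" by (auto elim: dvdE)
    then have "int k * (- 1) < int k * d" "int k * d < int k * 2" using l by linarith+
    moreover have "0 < int k" using k by simp
    ultimately have "- 1 < d" "d < 2" by (simp_all only: mult_less_cancel_left_pos)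
    then have "d = 0 \<or> d = 1" by linarith
    then show ?thesis using d k by (auto simp: T_def ell_def)
  next
    case False
    then show ?thesis using Phi_mode_vanish[OF False] by (auto simp: T_def)
  qed
  have cont: "continuous_on A (\<lambda>t. cos (real_of_int l * t) * poly q (cos (real k * t)))" for A l q
    by (auto intro!: continuous_intros)
  have apos: "\<And>n. 0 < ?A n" using rw_coeffs_ultra[OF \<alpha> \<gamma>] by (simp add: rw_coeffs_def)
  have eq: "(sin t)\<^sup>2 * poly (rwp (sieve k ?A) (sieve k ?B) i) (cos t) =
      1 / 2 * ((cos (real_of_int (int j) * t) * poly (ultra_r n) (cos (real k * t))
        - cos (real_of_int (int j + 2) * t) * poly (ultra_r n) (cos (real k * t)))
      + (cos (real_of_int (int k - 2 - int j) * t) * poly R (cos (real k * t))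
        - cos (real_of_int (int k - int j) * t) * poly R (cos (real k * t))))" for t
  proof -
    have "poly (rwp (sieve k ?A) (sieve k ?B) i) (cos t) =
      poly (cheb_V (Suc j)) (cos t) * poly (ultra_r n) (cos (real k * t)) + poly (cheb_V (k - 1 - j)) (cos t) * poly R (cos (real k * t))"
      using poly_sieved_rwp[where A="?A" and B="?B" and n=n and j=j and x="cos t", OF k apos _ ij(2)]
      unfolding ij(1) cheb_T_cos R_def by auto
    then have "(sin t)\<^sup>2 * poly (rwp (sieve k ?A) (sieve k ?B) i) (cos t) =
      sin t * ((sin t * poly (cheb_V (Suc j)) (cos t)) * poly (ultra_r n) (cos (real k * t))
        + (sin t * poly (cheb_V (k - 1 - j)) (cos t)) * poly R (cos (real k * t)))"
      by (simp only: power2_eq_square) (simp only: algebra_simps)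
    also have "\<dots> = (sin t * sin (real (Suc j) * t)) * poly (ultra_r n) (cos (real k * t))
        + (sin t * sin (real (k - 1 - j) * t)) * poly R (cos (real k * t))"
      unfolding cheb_V_cos by (simp only: algebra_simps)
    also have "sin t * sin (real (Suc j) * t) = 1 / 2 * (cos (real_of_int (int j) * t) - cos (real_of_int (int j + 2) * t))"
      using cos_diff[of "real (Suc j) * t" t] cos_add[of "real (Suc j) * t" t] by (simp add: algebra_simps)
    also have "sin t * sin (real (k - 1 - j) * t) = 1 / 2 * (cos (real_of_int (int k - 2 - int j) * t) - cos (real_of_int (int k - int j) * t))"
      using cos_diff[of "real (k - 1 - j) * t" t] cos_add[of "real (k - 1 - j) * t" t] ij(2)
      by (simp add: of_nat_diff algebra_simps)
    finally show ?thesis by (simp only: algebra_simps)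
  qed
  have "Phi (\<lambda>t. (sin t)\<^sup>2 * poly (rwp (sieve k ?A) (sieve k ?B) i) (cos t)) =
    1 / 2 * ((T (int j) (ultra_r n) - T (int j + 2) (ultra_r n)) + (T (int k - 2 - int j) R - T (int k - int j) R))"
    unfolding eq Phi_cmult T_def
    by (subst Phi_add Phi_diff, (intro continuous_intros)+)+ (rule refl)
  also have "\<dots> = 1 / 2 * (((if j = 0 then ell (ultra_r n) else 0) - (if j + 2 = k then ell ([:0, 1:] * ultra_r n) else 0))
      + ((if j + 2 = k then ell R else 0) - (if j = 0 then ell ([:0, 1:] * R) else 0)))"
    using ij(2) k by (simp add: Tval)
  finally have main: "Phi (\<lambda>t. (sin t)\<^sup>2 * poly (rwp (sieve k ?A) (sieve k ?B) i) (cos t)) = \<dots>" .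
  show ?thesis
  proof (cases n)
    case 0
    have "ell [:0, 1:] = 0" by (rule ell_odd) simp
    then show ?thesis unfolding main using 0 ij by (simp add: R_def)
  next
    case (Suc n')
    have "i \<noteq> 0" using ij Suc k by simp
    then show ?thesis unfolding main using ell_ultra[of n'] by (simp add: R_def Suc del: rwp.simps mult_pCons_left)
  qed
qed

end

section \<open>The orthogonality measure and the main theorem\<close>

lemma cos_image_piece:
  assumes "S = {0<..<pi} \<or> S = {pi<..<2 * pi}"
  shows "inj_on cos S" "cos ` S = {-1<..<1}" "\<And>t. t \<in> S \<Longrightarrow> sin t \<noteq> 0"
proof -
  have sin: "sin t \<noteq> 0" if "t \<in> S" for t
    using assms
  proof
    assume "S = {0<..<pi}"
    then show ?thesis using that sin_gt_zero[of t] by auto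
  next
    assume "S = {pi<..<2 * pi}"
    then show ?thesis using that sin_lt_zero[of t] by auto
  qed
  then show "\<And>t. t \<in> S \<Longrightarrow> sin t \<noteq> 0" .
  show "inj_on cos S"
  proof (rule inj_onI)
    fix x y assume xy: "x \<in> S" "y \<in> S" "cos x = cos y"
    from assms show "x = y"
    proof
      assume "S = {0<..<pi}"
      then have "0 \<le> x" "x \<le> pi" "0 \<le> y" "y \<le> pi" using xy(1,2) by simp_all
      then show ?thesis using xy(3) by (rule cos_inj_pi)
    next
      assume S: "S = {pi<..<2 * pi}"
      have c: "cos (2 * pi - x) = cos (2 * pi - y)" using xy(3) by (simp add: cos_diff)
      have "0 \<le> 2 * pi - x" "2 * pi - x \<le> pi" "0 \<le> 2 * pi - y" "2 * pi - y \<le> pi"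
        using xy(1,2) S by simp_all
      then have "2 * pi - x = 2 * pi - y" using c by (rule cos_inj_pi)
      then show ?thesis by simp
    qed
  qed
  show "cos ` S = {-1<..<1}"
  proof (intro equalityI subsetI)
    fix y assume "y \<in> cos ` S"
    then obtain t where t: "t \<in> S" "y = cos t" by blast
    have "0 < (sin t)\<^sup>2" using sin[OF t(1)] by simp
    then have "y\<^sup>2 < 1" unfolding t(2) using sin_cos_squared_add[of t] by linarith
    then show "y \<in> {-1<..<1}" by (simp add: abs_square_less_1 abs_less_iff)
  next
    fix y :: real assume y: "y \<in> {-1<..<1}"
    have a: "0 < arccos y" "arccos y < pi" "cos (arccos y) = y" using y arccos_lt_bounded[of y] by (auto simp: cos_arccos)
    from assms show "y \<in> cos ` S"
    proof
      assume "S = {0<..<pi}"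
      then show ?thesis using a by (intro image_eqI[of _ _ "arccos y"]) auto
    next
      assume "S = {pi<..<2 * pi}"
      then show ?thesis using a by (intro image_eqI[of _ _ "2 * pi - arccos y"]) (auto simp: cos_diff)
    qed
  qed
qed

text \<open>By \<open>sin (k t) = sin t U_(k-1)(cos t)\<close> the powers match:
  \<open>|sin t|^(2 \<alpha> + 1)\<close> from \<open>w2\<close> and one more \<open>|sin t|\<close>
  from the substitution give \<open>(sin t)^2 |sin t|^(2 \<alpha>)\<close>.\<close>

lemma w2_cos:
  assumes "0 < k" "sin t \<noteq> 0"
  shows "\<bar>- sin t\<bar> * w2 k \<alpha> \<gamma> (cos t) = (sin t)\<^sup>2 * ang_weight \<alpha> \<gamma> (real k * t)"
proof -
  have s: "0 < \<bar>sin t\<bar>" using assms(2) by simp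
  have V: "cheb_U (k - 1) = cheb_V k" using cheb_V_Suc[of "k - 1"] assms(1) by simp
  have sq: "(sin t)\<^sup>2 = \<bar>sin t\<bar> powr 2" using s by (simp add: powr_numeral)
  have f1: "\<bar>sin (real k * t)\<bar> powr (2 * \<alpha>) = \<bar>sin t\<bar> powr (2 * \<alpha>) * \<bar>poly (cheb_V k) (cos t)\<bar> powr (2 * \<alpha>)"
    unfolding cheb_V_cos[symmetric] abs_mult by (rule powr_mult)
  have f2: "1 - (cos t)\<^sup>2 = (sin t)\<^sup>2" by (simp add: sin_squared_eq)
  have f3: "\<bar>- sin t\<bar> * (sin t)\<^sup>2 powr (\<alpha> + 1 / 2) = (sin t)\<^sup>2 * \<bar>sin t\<bar> powr (2 * \<alpha>)"
  proof -
    have "\<bar>- sin t\<bar> * (sin t)\<^sup>2 powr (\<alpha> + 1 / 2) = \<bar>sin t\<bar> powr 1 * \<bar>sin t\<bar> powr (2 * (\<alpha> + 1 / 2))"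
      unfolding sq powr_powr using s by simp
    also have "\<dots> = \<bar>sin t\<bar> powr 2 * \<bar>sin t\<bar> powr (2 * \<alpha>)"
      unfolding powr_add[symmetric] by (simp add: algebra_simps)
    finally show ?thesis unfolding sq .
  qed
  show ?thesis unfolding w2_def ang_weight_def V cheb_T_cos f1 f2 by (simp only: f3 mult.assoc[symmetric])
qed

text \<open>Each half of the circle covers the interval once under the cosine, whence the factor
  1/2.\<close>

lemma w2_integral:
  assumes k: "2 \<le> k" and \<alpha>: "\<alpha> > - 1 / 2" and \<gamma>: "\<gamma> > - 1"
  shows "(\<lambda>x. poly q x * w2 k \<alpha> \<gamma> x) absolutely_integrable_on {-1..1}"
    and "integral {-1..1} (\<lambda>x. poly q x * w2 k \<alpha> \<gamma> x) = Phi k \<alpha> \<gamma> (\<lambda>t. (sin t)\<^sup>2 * poly q (cos t)) / 2"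
proof -
  let ?h = "\<lambda>t. (sin t)\<^sup>2 * poly q (cos t) * ang_weight \<alpha> \<gamma> (real k * t)"
  let ?f = "\<lambda>x. poly q x * w2 k \<alpha> \<gamma> x"
  have h: "?h absolutely_integrable_on {0..2 * pi}"
    by (rule Phi_integrable[OF k \<alpha> \<gamma>]) (intro continuous_intros)
  have h1: "?h absolutely_integrable_on {0..pi}" and h2: "?h absolutely_integrable_on {pi..2 * pi}"
    by (rule absolutely_integrable_subinterval[OF h]; simp)+
  have piece: "?f absolutely_integrable_on {-1<..<1} \<and> integral {-1<..<1} ?f = integral S ?h"
    if S: "S = {0<..<pi} \<or> S = {pi<..<2 * pi}" and hS: "?h absolutely_integrable_on S" for S
  proof -
    have der: "(cos has_field_derivative - sin t) (at t within S)" for t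
      by (auto intro!: derivative_eq_intros)
    have eq: "?h t = \<bar>- sin t\<bar> * ?f (cos t)" if "t \<in> S" for t
      using w2_cos[of k t \<alpha> \<gamma>] cos_image_piece(3)[OF S that] k by (simp add: mult_ac)
    have "(\<lambda>t. \<bar>- sin t\<bar> * ?f (cos t)) absolutely_integrable_on S"
      using hS by (subst (asm) set_integrable_cong[OF refl refl eq]) auto
    moreover have "integral S (\<lambda>t. \<bar>- sin t\<bar> * ?f (cos t)) = integral S ?h"
      by (rule Henstock_Kurzweil_Integration.integral_cong) (simp only: eq)
    moreover have "S \<in> sets lebesgue" using S by auto
    ultimately show ?thesis
      using has_absolute_integral_change_of_variables_1'[OF _ der cos_image_piece(1)[OF S], of ?f "integral S ?h"]
      unfolding cos_image_piece(2)[OF S] by blast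
  qed
  have p1: "?f absolutely_integrable_on {-1<..<1} \<and> integral {-1<..<1} ?f = integral {0..pi} ?h"
    using piece[of "{0<..<pi}"] h1 by (simp add: absolutely_integrable_on_Icc_iff_Ioo integral_open_interval_real)
  have p2: "integral {-1<..<1} ?f = integral {pi..2 * pi} ?h"
    using piece[of "{pi<..<2 * pi}"] h2 by (simp add: absolutely_integrable_on_Icc_iff_Ioo integral_open_interval_real)
  show "?f absolutely_integrable_on {-1..1}" using p1 by (simp add: absolutely_integrable_on_Icc_iff_Ioo)
  have "Phi k \<alpha> \<gamma> (\<lambda>t. (sin t)\<^sup>2 * poly q (cos t)) = integral {0..pi} ?h + integral {pi..2 * pi} ?h"
    unfolding Phi_def[OF k \<alpha> \<gamma>] by (rule absolutely_integrable_join(2)[OF _ _ h1 h2]) auto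
  then show "integral {-1..1} ?f = Phi k \<alpha> \<gamma> (\<lambda>t. (sin t)\<^sup>2 * poly q (cos t)) / 2"
    using p1 p2 by (simp add: integral_open_interval_real)
qed

lemma borel_measurable_w2 [measurable]: "w2 k \<alpha> \<gamma> \<in> borel_measurable borel"
  unfolding w2_def by measurable

lemma w2_nonneg: "0 \<le> w2 k \<alpha> \<gamma> x"
  by (simp add: w2_def)

lemma w2_minus: "w2 k \<alpha> \<gamma> (- x) = w2 k \<alpha> \<gamma> x"
  by (simp add: w2_def cheb_T_eq_rwp cheb_U_eq_rwp poly_rwp_minus abs_mult power_abs)

lemma w2_lborel:
  assumes "2 \<le> k" "\<alpha> > - 1 / 2" "\<gamma> > - 1"
  shows "set_integrable lborel {-1..1} (\<lambda>x. poly q x * w2 k \<alpha> \<gamma> x)"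
    and "(LINT x:{-1..1}|lborel. poly q x * w2 k \<alpha> \<gamma> x) = Phi k \<alpha> \<gamma> (\<lambda>t. (sin t)\<^sup>2 * poly q (cos t)) / 2"
proof -
  have "(\<lambda>x. indicator {-1..1} x *\<^sub>R (poly q x * w2 k \<alpha> \<gamma> x)) \<in> borel_measurable lborel" by measurable
  then show i: "set_integrable lborel {-1..1} (\<lambda>x. poly q x * w2 k \<alpha> \<gamma> x)"
    using w2_integral(1)[OF assms, of q] unfolding set_integrable_def by (simp add: integrable_completion)
  show "(LINT x:{-1..1}|lborel. poly q x * w2 k \<alpha> \<gamma> x) = Phi k \<alpha> \<gamma> (\<lambda>t. (sin t)\<^sup>2 * poly q (cos t)) / 2"
    using set_borel_integral_eq_integral(2)[OF i] w2_integral(2)[OF assms, of q] by simp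
qed

lemma eta_props:
  assumes "2 \<le> k" "\<alpha> > - 1 / 2" "\<gamma> > - 1"
  shows "sym_prob_measure (eta k \<alpha> \<gamma>)"
    and "(\<integral>x. poly q x \<partial>eta k \<alpha> \<gamma>) = Phi k \<alpha> \<gamma> (\<lambda>t. (sin t)\<^sup>2 * poly q (cos t)) / 2 / (LINT y:{-1..1}|lborel. w2 k \<alpha> \<gamma> y)"
proof -
  define Z where "Z = (LINT y:{-1..1}|lborel. w2 k \<alpha> \<gamma> y)"
  define d where "d x = indicator {-1..1} x * w2 k \<alpha> \<gamma> x / Z" for x :: real
  have eta: "eta k \<alpha> \<gamma> = density lborel (\<lambda>x. ennreal (d x))"
    by (simp add: eta_def d_def Z_def)
  have dm [measurable]: "d \<in> borel_measurable borel" unfolding d_def by measurable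
  have Zeq: "Z = Phi k \<alpha> \<gamma> (\<lambda>t. (sin t)\<^sup>2 * poly 1 (cos t)) / 2"
    using w2_lborel(2)[OF assms, of 1] by (simp add: Z_def)
  \<comment> \<open>The normalizing integral is the mean of index 0, equal to
    \<open>ell 1 / 4\<close>.\<close>
  then have Z: "0 < Z" using Phi_sieved_ultra[OF assms, of 0] ell_pos[OF assms] by simp
  have d0: "0 \<le> d x" for x using Z by (simp add: d_def w2_nonneg indicator_def)
  have dint: "integrable lborel (\<lambda>x. d x * poly q x)"
    "(\<integral>x. d x * poly q x \<partial>lborel) = Phi k \<alpha> \<gamma> (\<lambda>t. (sin t)\<^sup>2 * poly q (cos t)) / 2 / Z" for q
  proof -
    have e: "d x * poly q x = indicator {-1..1} x *\<^sub>R (poly q x * w2 k \<alpha> \<gamma> x) / Z" for x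
      by (simp add: d_def)
    show "integrable lborel (\<lambda>x. d x * poly q x)"
      unfolding e using w2_lborel(1)[OF assms, of q] by (simp add: set_integrable_def)
    show "(\<integral>x. d x * poly q x \<partial>lborel) = Phi k \<alpha> \<gamma> (\<lambda>t. (sin t)\<^sup>2 * poly q (cos t)) / 2 / Z"
    proof -
      have "(\<integral>x. d x * poly q x \<partial>lborel) = (LINT x:{-1..1}|lborel. poly q x * w2 k \<alpha> \<gamma> x) / Z"
        unfolding e by (simp add: set_lebesgue_integral_def)
      then show ?thesis unfolding w2_lborel(2)[OF assms] .
    qed
  qed
  show "(\<integral>x. poly q x \<partial>eta k \<alpha> \<gamma>) = Phi k \<alpha> \<gamma> (\<lambda>t. (sin t)\<^sup>2 * poly q (cos t)) / 2 / (LINT y:{-1..1}|lborel. w2 k \<alpha> \<gamma> y)"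
    unfolding eta Z_def[symmetric] using dint(2)[of q] d0
    by (subst integral_density) auto
  have total: "(\<integral>\<^sup>+ x. ennreal (d x) \<partial>lborel) = 1"
  proof -
    have "(\<integral>\<^sup>+ x. ennreal (d x) \<partial>lborel) = ennreal (\<integral>x. d x \<partial>lborel)"
      using dint(1)[of 1] d0 by (intro nn_integral_eq_integral) auto
    also have "(\<integral>x. d x \<partial>lborel) = 1"
      using dint(2)[of 1] Zeq Z by simp
    finally show ?thesis by simp
  qed
  show "sym_prob_measure (eta k \<alpha> \<gamma>)"
    unfolding sym_prob_measure_def
  proof (intro conjI)
    show "prob_space (eta k \<alpha> \<gamma>)"
      unfolding eta by (rule prob_spaceI) (simp add: emeasure_density total)
    show "sets (eta k \<alpha> \<gamma>) = sets borel" by (simp add: eta)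
    show "AE x in eta k \<alpha> \<gamma>. x \<in> {-1..1}"
    proof -
      have "d x = 0" if "x \<notin> {-1..1}" for x using that by (simp add: d_def)
      then have "0 < ennreal (d x) \<longrightarrow> x \<in> {-1..1}" for x by (metis ennreal_0 less_irrefl)
      then show ?thesis unfolding eta by (subst AE_density) simp_all
    qed
    show "distr (eta k \<alpha> \<gamma>) borel uminus = eta k \<alpha> \<gamma>"
    proof (rule measure_eqI)
      fix A assume "A \<in> sets (distr (eta k \<alpha> \<gamma>) borel uminus)"
      then have A [measurable]: "A \<in> sets borel" by simp
      have um [measurable]: "(uminus :: real \<Rightarrow> real) \<in> borel_measurable borel" by measurable
      have A': "uminus -` A \<in> sets borel" using measurable_sets[OF um A] by simp
      have dd: "d (- x) = d x" for x by (auto simp: d_def w2_minus indicator_def)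
      have "emeasure (distr (eta k \<alpha> \<gamma>) borel uminus) A = emeasure (eta k \<alpha> \<gamma>) (uminus -` A)"
        by (subst emeasure_distr) (auto simp: eta)
      also have "\<dots> = (\<integral>\<^sup>+ x. ennreal (d x) * indicator (uminus -` A) x \<partial>lborel)"
        unfolding eta using A' by (subst emeasure_density) auto
      also have "\<dots> = (\<integral>\<^sup>+ x. (\<lambda>y. ennreal (d y) * indicator A y) (- x) \<partial>lborel)"
        by (intro nn_integral_cong) (simp add: dd indicator_def)
      also have "\<dots> = (\<integral>\<^sup>+ y. ennreal (d y) * indicator A y \<partial>distr lborel borel uminus)"
        by (subst nn_integral_distr) auto
      also have "\<dots> = emeasure (eta k \<alpha> \<gamma>) A"
        unfolding lborel_distr_uminus eta by (subst emeasure_density) auto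
      finally show "emeasure (distr (eta k \<alpha> \<gamma>) borel uminus) A = emeasure (eta k \<alpha> \<gamma>) A" .
    qed (simp add: eta)
  qed
qed

text \<open>Multiplication by \<open>x\<close> moves the index by at most one, so \<open>x^j\<close>
  with \<open>j < n\<close> cannot bring index \<open>n\<close> down to 0, and vanishing means
  suffice. The squared norms stay positive because \<open>a n\<close> times the next one is
  \<open>b (Suc n)\<close> times the previous one.\<close>

lemma orthogonality_measureI:
  assumes ab: "rwc a b" and \<mu>: "sym_prob_measure \<mu>"
    and mean: "\<And>n. 0 < n \<Longrightarrow> (\<integral>x. poly (rwp a b n) x \<partial>\<mu>) = 0"
  shows "orthogonality_measure (rwp a b) \<mu>"
proof -
  interpret prob_space \<mu> by (rule sym_prob_measureD[OF \<mu>])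
  let ?r = "rwp a b :: nat \<Rightarrow> real poly"
  define M where "M q = (\<integral>x. poly q x \<partial>\<mu>)" for q
  note int = integrable_poly_sym_prob[OF \<mu>]
  have Madd: "M (p + q) = M p + M q" for p q
    unfolding M_def poly_add by (intro Bochner_Integration.integral_add int)
  have Msm: "M (smult c p) = c * M p" for c p by (simp add: M_def)
  have M0: "M 0 = 0" by (simp add: M_def)
  have Msum: "M (\<Sum>i\<in>I. f i) = (\<Sum>i\<in>I. M (f i))" for f and I :: "nat set"
    by (induction I rule: infinite_finite_induct) (auto simp: Madd M0)
  have rec: "[:0, 1:] * ?r (Suc n) = smult (a (Suc n)) (?r (Suc (Suc n))) + smult (b (Suc n)) (?r n)" for n
    by (rule poly_ext) (use poly_rwp_rec[where a=a and b=b and n=n and 'a=real] rwcD(5)[OF ab, of "Suc n"] in simp)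
  have mono: "M (monom 1 j * ?r n) = 0" if "j < n" for j n
    using that
  proof (induction j arbitrary: n)
    case 0
    then show ?case using mean[of n] by (simp add: M_def poly_monom)
  next
    case (Suc j)
    then obtain i where n: "n = Suc i" "j < i" by (cases n) auto
    have "monom 1 (Suc j) * ?r n = monom 1 j * ([:0, 1:] * ?r (Suc i))"
      unfolding n by (simp only: monom_Suc) simp
    also have "\<dots> = smult (a (Suc i)) (monom 1 j * ?r (Suc (Suc i))) + smult (b (Suc i)) (monom 1 j * ?r i)"
      unfolding rec by (simp add: distrib_left)
    finally show ?case using Suc.IH[of i] Suc.IH[of "Suc (Suc i)"] n by (simp add: Madd Msm)
  qed
  have low: "M (q * ?r n) = 0" if "degree q < n" for q n
  proof -
    have "q * ?r n = (\<Sum>i\<le>degree q. smult (poly.coeff q i) (monom 1 i * ?r n))"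
    proof -
      have "(\<Sum>i\<le>degree q. smult (poly.coeff q i) (monom 1 i * ?r n)) = (\<Sum>i\<le>degree q. monom (poly.coeff q i) i) * ?r n"
        unfolding sum_distrib_right by (intro sum.cong refl) (metis mult.right_neutral mult_smult_left smult_monom)
      then show ?thesis unfolding poly_as_sum_of_monoms ..
    qed
    then have "M (q * ?r n) = (\<Sum>i\<le>degree q. poly.coeff q i * M (monom 1 i * ?r n))" by (simp only: Msum Msm)
    then show ?thesis using mono that by simp
  qed
  have deg: "degree (?r n) = n" for n by (rule degree_rwp[OF rwcD(1)[OF ab]])
  have pos: "0 < M (?r n * ?r n)" for n
  proof (induction n)
    case 0
    then show ?case by (simp add: M_def prob_space)
  next
    case (Suc n)
    have 1: "M (?r n * ([:0, 1:] * ?r (Suc n))) = b (Suc n) * M (?r n * ?r n)"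
      unfolding rec using low[of "?r n" "Suc (Suc n)"] by (simp add: distrib_left Madd Msm deg del: mult_pCons_left)
    have 2: "M (([:0, 1:] * ?r n) * ?r (Suc n)) = a n * M (?r (Suc n) * ?r (Suc n))"
    proof (cases n)
      case 0
      have "[:0, 1:] * ?r 0 = smult (a 0) (?r (Suc 0))" using rwcD(5)[OF ab, of 0] by simp
      then show ?thesis using 0 by (simp add: Msm del: rwp.simps mult_pCons_left)
    next
      case (Suc i)
      show ?thesis unfolding Suc rec using low[of "?r i" "Suc (Suc i)"]
        by (simp add: distrib_right Madd Msm deg)
    qed
    have "?r n * ([:0, 1:] * ?r (Suc n)) = ([:0, 1:] * ?r n) * ?r (Suc n)" by (simp only: mult_ac)
    then have "a n * M (?r (Suc n) * ?r (Suc n)) = b (Suc n) * M (?r n * ?r n)" using 1 2 by simp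
    moreover have "0 < b (Suc n) * M (?r n * ?r n)" using Suc rwcD(2)[OF ab, of "Suc n"] by simp
    ultimately show ?case using rwcD(1)[OF ab, of n] by (metis zero_less_mult_pos)
  qed
  have "M (?r m * ?r n) = 0 \<longleftrightarrow> m \<noteq> n" for m n
  proof (cases "m = n")
    case False
    then consider "m < n" | "n < m" by linarith
    then have "M (?r m * ?r n) = 0"
      using low[of "?r m" n] low[of "?r n" m] deg by cases (simp_all add: mult.commute)
    then show ?thesis using False by simp
  qed (use pos[of n] in simp)
  then show ?thesis using \<mu> unfolding orthogonality_measure_def M_def poly_mult by blast
qed

lemma orthogonality_measure_eta:
  assumes "2 \<le> k" "\<alpha> > - 1 / 2" "\<gamma> > - 1"
  shows "orthogonality_measure (sieved_ultra_poly k \<alpha> \<gamma>) (eta k \<alpha> \<gamma>)"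
proof -
  let ?a = "sieve k (ultra_A \<alpha> \<gamma>)" and ?b = "sieve k (\<lambda>n. 1 - ultra_A \<alpha> \<gamma> n)"
  have "sieved_ultra_poly k \<alpha> \<gamma> = rwp ?a ?b"
    unfolding sieved_ultra_poly_def by (rule ext) (rule sieved_rw_poly_eq_rwp[OF assms(1)])
  moreover have "orthogonality_measure (rwp ?a ?b) (eta k \<alpha> \<gamma>)"
  proof (rule orthogonality_measureI)
    show "rwc ?a ?b" by (intro rwc_sieve rw_coeffs_ultra assms)
    show "sym_prob_measure (eta k \<alpha> \<gamma>)" by (rule eta_props(1)[OF assms])
    show "(\<integral>x. poly (rwp ?a ?b n) x \<partial>eta k \<alpha> \<gamma>) = 0" if "0 < n" for n
      unfolding eta_props(2)[OF assms] using Phi_sieved_ultra[OF assms, of n] that by simp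
  qed
  ultimately show ?thesis by simp
qed

lemma sieved_ultra_reversed:
  assumes "2 \<le> k" "\<alpha> > - 1 / 2" "\<gamma> > - 1" "orthogonality_measure (sieved_ultra_poly k \<alpha> \<gamma>) \<mu>"
  shows "equal_mass_property k (reversed_measure \<mu> (k * (2 * m + 2) - 2))"
    and "mass_ratios k \<alpha> \<gamma> (reversed_measure \<mu> (k * (2 * m + 2) - 2))"
proof -
  note rev = sieved_reversed_measure[OF assms(1) rw_coeffs_ultra[OF assms(2,3)] assms(4)[unfolded sieved_ultra_poly_def], where m=m]
  show "equal_mass_property k (reversed_measure \<mu> (k * (2 * m + 2) - 2))"
    unfolding rev(2) by (auto simp: ultra_masses(1)[OF assms(2,3)])
  show "mass_ratios k \<alpha> \<gamma> (reversed_measure \<mu> (k * (2 * m + 2) - 2))"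
    unfolding rev(3) by (auto simp: ultra_masses[OF assms(2,3)])
qed

theorem theorem3p2:
  fixes k :: nat and \<alpha> \<gamma> :: real
  assumes k: "k \<ge> 2" and \<alpha>: "\<alpha> > - 1 / 2" and \<gamma>: "\<gamma> > - 1"
  shows "orthogonality_measure (sieved_ultra_poly k \<alpha> \<gamma>) (eta k \<alpha> \<gamma>) \<and>
    (\<forall>A B \<mu>. rw_coeffs A B \<and> orthogonality_measure (sieved_rw_poly k A B) \<mu> \<longrightarrow>
       (\<forall>m. card (support_points (reversed_measure \<mu> (k * (2 * m + 2) - 2))) = k * (2 * m + 2) - 1 \<and>
          zeros_T k \<subseteq> support_points (reversed_measure \<mu> (k * (2 * m + 2) - 2)) \<and>
          zeros_U k \<subseteq> support_points (reversed_measure \<mu> (k * (2 * m + 2) - 2)) \<and>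
          card (remaining_points k (reversed_measure \<mu> (k * (2 * m + 2) - 2))) = 2 * m * k) \<and>
       ((\<forall>n. sieved_rw_poly k A B n = sieved_ultra_poly k \<alpha> \<gamma> n) \<longleftrightarrow>
          (\<forall>m. equal_mass_property k (reversed_measure \<mu> (k * (2 * m + 2) - 2))) \<and>
          (\<forall>m\<ge>1. mass_ratios k \<alpha> \<gamma> (reversed_measure \<mu> (k * (2 * m + 2) - 2))))) \<and>
    (\<forall>m\<ge>1. mass_ratios k \<alpha> \<gamma> (reversed_measure (eta k \<alpha> \<gamma>) (k * (2 * m + 2) - 2)))"
proof (intro conjI allI impI)
  show eta: "orthogonality_measure (sieved_ultra_poly k \<alpha> \<gamma>) (eta k \<alpha> \<gamma>)"
    by (rule orthogonality_measure_eta[OF k \<alpha> \<gamma>])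
  show "mass_ratios k \<alpha> \<gamma> (reversed_measure (eta k \<alpha> \<gamma>) (k * (2 * m + 2) - 2))" for m
    by (rule sieved_ultra_reversed(2)[OF k \<alpha> \<gamma> eta])
next
  fix A B \<mu>
  assume "rw_coeffs A B \<and> orthogonality_measure (sieved_rw_poly k A B) \<mu>"
  then have A: "rw_coeffs A B" and \<mu>: "orthogonality_measure (sieved_rw_poly k A B) \<mu>" by auto
  let ?\<nu> = "\<lambda>m. reversed_measure \<mu> (k * (2 * m + 2) - 2)"
  note rev = sieved_reversed_measure[OF k A \<mu>]
  fix m
  show "card (support_points (?\<nu> m)) = k * (2 * m + 2) - 1" "zeros_T k \<subseteq> support_points (?\<nu> m)"
    "zeros_U k \<subseteq> support_points (?\<nu> m)" "card (remaining_points k (?\<nu> m)) = 2 * m * k"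
    using rev(1)[of m] by auto
next
  fix A B \<mu>
  assume "rw_coeffs A B \<and> orthogonality_measure (sieved_rw_poly k A B) \<mu>"
  then have A: "rw_coeffs A B" and \<mu>: "orthogonality_measure (sieved_rw_poly k A B) \<mu>" by auto
  let ?\<nu> = "\<lambda>m. reversed_measure \<mu> (k * (2 * m + 2) - 2)"
  note rev = sieved_reversed_measure[OF k A \<mu>]
  show "(\<forall>n. sieved_rw_poly k A B n = sieved_ultra_poly k \<alpha> \<gamma> n) \<longleftrightarrow>
    (\<forall>m. equal_mass_property k (?\<nu> m)) \<and> (\<forall>m\<ge>1. mass_ratios k \<alpha> \<gamma> (?\<nu> m))" (is "?L \<longleftrightarrow> ?R")
  proof
    assume ?L
    then have "sieved_rw_poly k A B = sieved_ultra_poly k \<alpha> \<gamma>" by blast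
    \<comment> \<open>Here \<mu> is any orthogonality measure of these polynomials; its masses
      follow from the recurrence coefficients, without identifying it with
      \<open>eta\<close>.\<close>
    then have "orthogonality_measure (sieved_ultra_poly k \<alpha> \<gamma>) \<mu>" using \<mu> by simp
    then show ?R using sieved_ultra_reversed[OF k \<alpha> \<gamma>] by blast
  next
    assume R: ?R
    have mp: "mass_prop \<alpha> \<gamma> A B m" if "0 < m" for m
    proof -
      let ?Z = "{t. poly (rwp A B (Suc (2 * m))) t = (0::real)}"
      have "card ?Z = Suc (2 * m)" by (rule card_rwp_roots[OF rw_coeffs_rwc[OF A]])
      \<comment> \<open>For \<open>m > 0\<close> there are at least three zeros, so a nonzero one
        exists; its mass is the witness for \<open>M\<close> in \<open>mass_prop\<close>.\<close>
      then have "\<not> ?Z \<subseteq> {0}" using that card_mono[of "{0::real}" ?Z] by auto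
      then obtain t where "t \<in> ?Z" "t \<notin> {0}" by (meson subsetI)
      then have t: "t \<noteq> 0" "poly (rwp A B (Suc (2 * m))) t = 0" by simp_all
      have e: "equal_mass_property k (?\<nu> m)" and r: "mass_ratios k \<alpha> \<gamma> (?\<nu> m)" using R that by auto
      have "mass_T A B m u = mass_T A B m t" if "u \<noteq> 0" "poly (rwp A B (Suc (2 * m))) u = 0" for u
        using e[unfolded rev(2), rule_format, of u t] that t by blast
      moreover have "mass_U A B m = (2 * \<alpha> + 1) * mass_T A B m t \<and> mass_T A B m 0 = (\<gamma> + 1) * mass_T A B m t"
        using r[unfolded rev(3), rule_format, of t] t by blast
      ultimately show ?thesis unfolding mass_prop_def by (intro exI[of _ "mass_T A B m t"]) blast
    qed
    have "A = ultra_A \<alpha> \<gamma>"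
      by (rule mass_prop_unique[OF \<alpha> \<gamma> A mp rw_coeffs_ultra[OF \<alpha> \<gamma>] mass_prop_ultra[OF \<alpha> \<gamma>]])
    moreover from this have "B = (\<lambda>n. 1 - ultra_A \<alpha> \<gamma> n)"
      using A unfolding rw_coeffs_def by (auto simp: fun_eq_iff) (metis add_diff_cancel_left')
    ultimately show ?L unfolding sieved_ultra_poly_def by simp
  qed
qed

end
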